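(* Let $k$ be a non-negative integer. Let $G=(V,E)$ be an undirected $2k$-edge-connected graph and let $D=(V,A)$ be an orientation of $G$. Then there exist orientations $D_1, D_2, \dots, D_\ell$ of $G$ such that $\ell \le k|V|^3$, $D \rightarrow D_1 \rightarrow D_2 \rightarrow \dots \rightarrow D_\ell$, and $\lambda(D) \le \lambda(D_1) \le \lambda(D_2) \le \dots \le \lambda(D_\ell) = k$. Furthermore, such orientations $D_1,\dots,D_\ell$ can be found in polynomial time.
   Context: Multiple edges are allowed. An undirected graph $G=(V,E)$ is $m$-edge-connected if every non-empty $S\subsetneq V$ has at least $m$ edges of $G$ with exactly one endpoint in $S$ (for $m=0$ this is no condition). An orientation of $G$ is a directed graph obtained by choosing, for each undirected edge $\{u,v\}\in E$, one of the directed edges $(u,v)$ or $(v,u)$. For a directed graph $D=(V,A)$ and $S\subseteq V$, $\delta^+_D(S)$ and $\delta^-_D(S)$ denote the number of edges leaving $S$ and entering $S$, respectively. $D$ is $m$-edge-connected if $\delta^+_D(S)\ge m$ and $\delta^-_D(S)\ge m$ for every non-empty $S\subsetneq V$. The edge-connectivity $\lambda(D)$ is the maximum integer $m$ such that $D$ is $m$-edge-connected. For directed graphs $D,D'$, write $D\rightarrow D'$ if $D'$ is obtained from $D$ by a single edge flip, i.e., by replacing one directed edge $(u,v)$ by $(v,u)$. The sequence $D_1,\dots,D_\ell$ may be empty ($\ell=0$), in which case the last orientation is $D$ itself.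
   Formalization: The formal statement additionally assumes λ(D) ≤ k, which the conclusion forces and without which the claim fails (k = 0, D a directed 2-cycle with λ(D) = 1); this also excludes graphs with at most one vertex, where λ is undefined. *)

theory Defs
  imports
    "Graph_Theory.Digraph"
    "HOL-Library.Extended_Nat"
    "HOL-Computational_Algebra.Polynomial"
begin

section \<open>Undirected multigraphs and their orientations\<close>

text \<open>Edges are named, so that parallel edges are possible; every edge has two distinct endpoints.\<close>

record ('v, 'e) multigraph =
  vertices :: "'v set"
  edges :: "'e set"
  ends :: "'e \<Rightarrow> 'v set"

definition finite_multigraph :: "('v, 'e) multigraph \<Rightarrow> bool" where
  "finite_multigraph G \<longleftrightarrow>
     finite (vertices G) \<and> finite (edges G) \<and>
     (\<forall>e \<in> edges G. ends G e \<subseteq> vertices G \<and> card (ends G e) = 2)"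

definition undirected_edge_connected :: "('v, 'e) multigraph \<Rightarrow> nat \<Rightarrow> bool" where
  "undirected_edge_connected G m \<longleftrightarrow>
     (\<forall>S. S \<noteq> {} \<and> S \<subset> vertices G \<longrightarrow> m \<le> card {e \<in> edges G. card (ends G e \<inter> S) = 1})"

text \<open>An orientation keeps the edge names and chooses a tail and a head for each of them.\<close>

definition orientation :: "('v, 'e) multigraph \<Rightarrow> ('v, 'e) pre_digraph \<Rightarrow> bool" where
  "orientation G D \<longleftrightarrow>
     verts D = vertices G \<and> arcs D = edges G \<and>
     (\<forall>e \<in> edges G. {tail D e, head D e} = ends G e)"

definition cut_out :: "('v, 'e) pre_digraph \<Rightarrow> 'v set \<Rightarrow> nat" where
  "cut_out D S = card {a \<in> arcs D. tail D a \<in> S \<and> head D a \<notin> S}"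

definition cut_in :: "('v, 'e) pre_digraph \<Rightarrow> 'v set \<Rightarrow> nat" where
  "cut_in D S = card {a \<in> arcs D. tail D a \<notin> S \<and> head D a \<in> S}"

definition directed_edge_connected :: "('v, 'e) pre_digraph \<Rightarrow> nat \<Rightarrow> bool" where
  "directed_edge_connected D m \<longleftrightarrow>
     (\<forall>S. S \<noteq> {} \<and> S \<subset> verts D \<longrightarrow> m \<le> cut_out D S \<and> m \<le> cut_in D S)"

text \<open>
  The supremum is a maximum as soon as there are two vertices. With at most one vertex there are
  no cuts, and the value is \<open>\<infinity>\<close>. So a bound \<open>edge_connectivity D \<le> enat k\<close> on the
  initial orientation, without which connectivity could not increase to exactly \<open>k\<close>, also
  excludes the graphs with at most one vertex.
\<close>

definition edge_connectivity :: "('v, 'e) pre_digraph \<Rightarrow> enat" where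
  "edge_connectivity D = Sup (enat ` {m. directed_edge_connected D m})"

lemma directed_edge_connected_mono:
  "directed_edge_connected D m \<Longrightarrow> l \<le> m \<Longrightarrow> directed_edge_connected D l"
  unfolding directed_edge_connected_def by (meson order_trans)

lemma edge_connectivity_ge_iff:
  "enat m \<le> edge_connectivity D \<longleftrightarrow> directed_edge_connected D m"
proof
  assume le: "enat m \<le> edge_connectivity D"
  show "directed_edge_connected D m"
  proof (cases m)
    case 0
    then show ?thesis by (simp add: directed_edge_connected_def)
  next
    case (Suc l)
    with le have "enat l < edge_connectivity D"
      by (metis enat_ord_simps(2) lessI less_le_trans)
    then obtain j where "directed_edge_connected D j" "l < j"
      unfolding edge_connectivity_def less_Sup_iff by auto
    with Suc show ?thesis
      by (auto intro: directed_edge_connected_mono)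
  qed
next
  assume "directed_edge_connected D m"
  then show "enat m \<le> edge_connectivity D"
    unfolding edge_connectivity_def by (auto intro: Sup_upper)
qed

definition flip :: "('v, 'e) pre_digraph \<Rightarrow> ('v, 'e) pre_digraph \<Rightarrow> bool" where
  "flip D D' \<longleftrightarrow>
     verts D' = verts D \<and> arcs D' = arcs D \<and>
     (\<exists>a \<in> arcs D. tail D' a = head D a \<and> head D' a = tail D a \<and>
        (\<forall>b \<in> arcs D - {a}. tail D' b = tail D b \<and> head D' b = head D b))"

text \<open>The list \<open>Ds\<close> holds the orientations after \<open>D\<close>, and may be empty.\<close>

definition monotone_flips ::
  "('v, 'e) multigraph \<Rightarrow> nat \<Rightarrow> ('v, 'e) pre_digraph \<Rightarrow> ('v, 'e) pre_digraph list \<Rightarrow> bool" where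
  "monotone_flips G k D Ds \<longleftrightarrow>
     (\<forall>D' \<in> set Ds. orientation G D') \<and>
     length Ds \<le> k * card (vertices G) ^ 3 \<and>
     successively flip (D # Ds) \<and>
     sorted (map edge_connectivity (D # Ds)) \<and>
     edge_connectivity (last (D # Ds)) = enat k"


section \<open>Polynomial time\<close>

text \<open>
  The machine model is Jones's language WHILE (\<^emph>\<open>Computability and Complexity from a Programming
  Perspective\<close>): imperative programs over binary trees, deterministic, with finitely many
  variables per program. An assignment costs one plus the size of the tree assigned, rather than
  unit cost. So the running time also bounds the size of all data produced, and subtree sharing
  cannot be used to build trees of superpolynomial size; the model simulates, and is simulated by,
  Turing machines with polynomial overhead.
\<close>

datatype tree = Tip | Br tree tree

primrec tree_size :: "tree \<Rightarrow> nat" where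
  "tree_size Tip = 1"
| "tree_size (Br l r) = 1 + tree_size l + tree_size r"

datatype expr = Var nat | ETip | EBr expr expr | Left expr | Right expr

primrec left :: "tree \<Rightarrow> tree" where
  "left Tip = Tip"
| "left (Br l r) = l"

primrec right :: "tree \<Rightarrow> tree" where
  "right Tip = Tip"
| "right (Br l r) = r"

type_synonym state = "nat \<Rightarrow> tree"

primrec expr_val :: "expr \<Rightarrow> state \<Rightarrow> tree" where
  "expr_val (Var x) s = s x"
| "expr_val ETip s = Tip"
| "expr_val (EBr e f) s = Br (expr_val e s) (expr_val f s)"
| "expr_val (Left e) s = left (expr_val e s)"
| "expr_val (Right e) s = right (expr_val e s)"

datatype cmd = Assign nat expr | Seq cmd cmd | If expr cmd cmd | While expr cmd

text \<open>\<open>exec c s t s'\<close>: started in \<open>s\<close>, \<open>c\<close> stops in \<open>s'\<close> after time \<open>t\<close>. \<open>Tip\<close> is false.\<close>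

inductive exec :: "cmd \<Rightarrow> state \<Rightarrow> nat \<Rightarrow> state \<Rightarrow> bool" where
  Assign: "exec (Assign x e) s (1 + tree_size (expr_val e s)) (s(x := expr_val e s))"
| Seq: "exec c s t s' \<Longrightarrow> exec d s' u s'' \<Longrightarrow> exec (Seq c d) s (t + u) s''"
| IfTrue: "expr_val e s \<noteq> Tip \<Longrightarrow> exec c s t s' \<Longrightarrow> exec (If e c d) s (1 + t) s'"
| IfFalse: "expr_val e s = Tip \<Longrightarrow> exec d s t s' \<Longrightarrow> exec (If e c d) s (1 + t) s'"
| WhileFalse: "expr_val e s = Tip \<Longrightarrow> exec (While e c) s 1 s"
| WhileTrue: "expr_val e s \<noteq> Tip \<Longrightarrow> exec c s t s' \<Longrightarrow> exec (While e c) s' u s'' \<Longrightarrow>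
    exec (While e c) s (1 + t + u) s''"

lemma exec_deterministic:
  "exec c s t s' \<Longrightarrow> exec c s u s'' \<Longrightarrow> u = t \<and> s'' = s'"
proof (induction arbitrary: u s'' rule: exec.induct)
  case (Assign x e s)
  then show ?case by (auto elim: exec.cases)
next
  case (Seq c s t s' d u' s1)
  from Seq.prems Seq.IH show ?case by (cases rule: exec.cases) blast+
next
  case (IfTrue e s c t s' d)
  from IfTrue.prems IfTrue.IH IfTrue.hyps show ?case by (cases rule: exec.cases) blast+
next
  case (IfFalse e s d t s' c)
  from IfFalse.prems IfFalse.IH IfFalse.hyps show ?case by (cases rule: exec.cases) blast+
next
  case (WhileFalse e s c)
  from WhileFalse.prems WhileFalse.hyps show ?case by (cases rule: exec.cases) blast+
next
  case (WhileTrue e s c t s' u' s1)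
  from WhileTrue.prems WhileTrue.IH WhileTrue.hyps show ?case by (cases rule: exec.cases) blast+
qed

text \<open>Variable 0 holds the input at the start and the output at the end.\<close>

definition computes_within :: "cmd \<Rightarrow> tree \<Rightarrow> tree \<Rightarrow> nat \<Rightarrow> bool" where
  "computes_within c x y b \<longleftrightarrow>
     (\<exists>t s'. exec c ((\<lambda>_. Tip)(0 := x)) t s' \<and> s' 0 = y \<and> t \<le> b)"

text \<open>
  Numbers are coded in unary. Vertex names and \<open>k\<close> are at most the number of vertices and edges,
  respectively, so this changes the length of the input only polynomially.
\<close>

primrec nat_tree :: "nat \<Rightarrow> tree" where
  "nat_tree 0 = Tip"
| "nat_tree (Suc n) = Br Tip (nat_tree n)"

primrec list_tree :: "tree list \<Rightarrow> tree" where
  "list_tree [] = Tip"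
| "list_tree (x # xs) = Br x (list_tree xs)"

text \<open>Digraphs given to a program have vertices \<open>0, \<dots>, n - 1\<close> and a list of (tail, head) pairs.\<close>

type_synonym arc_list = "(nat \<times> nat) list"

definition list_digraph :: "nat \<Rightarrow> arc_list \<Rightarrow> (nat, nat) pre_digraph" where
  "list_digraph n as =
     \<lparr>verts = {..<n}, arcs = {..<length as}, tail = (\<lambda>i. fst (as ! i)), head = (\<lambda>i. snd (as ! i))\<rparr>"

definition arcs_tree :: "arc_list \<Rightarrow> tree" where
  "arcs_tree as = list_tree (map (\<lambda>(u, v). Br (nat_tree u) (nat_tree v)) as)"

definition input_tree :: "nat \<Rightarrow> nat \<Rightarrow> arc_list \<Rightarrow> tree" where
  "input_tree k n as = Br (nat_tree k) (Br (nat_tree n) (arcs_tree as))"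

definition output_tree :: "arc_list list \<Rightarrow> tree" where
  "output_tree ass = list_tree (map arcs_tree ass)"

end

theory Submission
  imports Defs
begin

text \<open>
  Let the connectivity be \<open>l < k\<close>, and call a set in-tight (out-tight) if exactly \<open>l\<close> arcs enter
  (leave) it. Uncrossing shows that the inclusion-minimal tight sets are pairwise disjoint.
  Reversing a path from \<open>s\<close> to \<open>t\<close> arc by arc never lowers the connectivity if all its vertices lie
  in all out-tight sets containing \<open>s\<close>. There are always \<open>s\<close> in a minimal in-tight set \<open>A\<close>, \<open>t\<close> in a
  minimal out-tight set \<open>B\<close>, and such a path, for which moreover every tight set of the new digraph
  contains an old tight set and some old tight set contains no new one. Then the potential
  \<open>\<Sum>M. n - card M\<close>, taken over the minimal tight sets \<open>M\<close>, decreases. It is at most \<open>n\<^sup>2\<close>, and a path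
  has at most \<open>n\<close> arcs, so at most \<open>n\<^sup>3\<close> flips raise the connectivity by one.

  For the running time, all pairs \<open>(s, t)\<close> are tried. The tight sets needed to test a pair are minimum
  cuts, computed by augmenting paths. All loops are folds over lists, and the functions computed by
  WHILE programs in polynomial time are closed under folds with polynomially bounded intermediate results.
\<close>

section \<open>Cuts of arc lists\<close>

text \<open>Reversing a walk from \<open>s\<close> to \<open>u\<close> changes only cuts that
  separate \<open>s\<close> from \<open>u\<close>, each by one; the inner vertices cancel. So after
  every prefix of a path the connectivity is kept unless an out-tight set contains \<open>s\<close>
  and misses the end of that prefix. The bound 2k enters through l < k: the two degrees of a set add
  up to at least 2l + 2. Hence no set is tight in both senses, and the opposite degree of a tight
  set is at least l + 2, so a shift by one destroys its tightness without making it tight in the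
  other sense. The obstacle is a tight set that properly contains a tight set of the other kind,
  since it breaks the uncrossing arguments. The pair is therefore sought inside an inclusion-minimal
  such set (or in all of V), where overlapping in-tight sets still intersect in in-tight sets. The
  summand n - card M records both kinds of progress: a minimal tight set that disappears, and one
  that gives way to a larger one. A run through a level stops as soon as the last tight set is gone,
  because a further flip of the same path could lower the connectivity again.\<close>

definition dout :: "('a \<times> 'a) list \<Rightarrow> 'a set \<Rightarrow> nat" where
  "dout as S = length (filter (\<lambda>e. fst e \<in> S \<and> snd e \<notin> S) as)"

definition din :: "('a \<times> 'a) list \<Rightarrow> 'a set \<Rightarrow> nat" where
  "din as S = length (filter (\<lambda>e. fst e \<notin> S \<and> snd e \<in> S) as)"

lemma dout_Nil [simp]: "dout [] S = 0" and din_Nil [simp]: "din [] S = 0"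
  by (simp_all add: dout_def din_def)

lemma dout_Cons: "dout (e # as) S = of_bool (fst e \<in> S \<and> snd e \<notin> S) + dout as S"
  and din_Cons: "din (e # as) S = of_bool (fst e \<notin> S \<and> snd e \<in> S) + din as S"
  by (simp_all add: dout_def din_def)

lemma dout_swap [simp]: "dout (map prod.swap as) S = din as S"
  and din_swap [simp]: "din (map prod.swap as) S = dout as S"
  by (induction as) (auto simp: dout_Cons din_Cons)

lemma dout_submodular: "dout as (X \<inter> Y) + dout as (X \<union> Y) \<le> dout as X + dout as Y"
  by (induction as) (auto simp: dout_Cons)

lemma din_submodular: "din as (X \<inter> Y) + din as (X \<union> Y) \<le> din as X + din as Y"
  using dout_submodular[of "map prod.swap as"] by simp

text \<open>This is submodularity of \<open>din\<close> for \<open>X\<close> and the complement of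
  \<open>Y\<close>, whose in-degree is \<open>dout as Y\<close>, rephrased with differences so that
  no ground set is mentioned.\<close>

lemma din_dout_uncross: "din as (X - Y) + dout as (Y - X) \<le> din as X + dout as Y"
  by (induction as) (auto simp: dout_Cons din_Cons)

lemma dout_compl: "set as \<subseteq> V \<times> V \<Longrightarrow> dout as (V - X) = din as X"
  by (induction as) (auto simp: dout_Cons din_Cons)

lemma din_compl: "set as \<subseteq> V \<times> V \<Longrightarrow> din as (V - X) = dout as X"
  by (induction as) (auto simp: dout_Cons din_Cons)

lemma dout_0_iff: "dout as S = 0 \<longleftrightarrow> (\<forall>e\<in>set as. fst e \<in> S \<longrightarrow> snd e \<in> S)"
  by (auto simp: dout_def filter_empty_conv)

lemma din_mono_outside:
  assumes "\<And>e. e \<in> set as \<Longrightarrow> fst e \<notin> X \<Longrightarrow> snd e \<in> X \<Longrightarrow> fst e \<notin> Y \<and> snd e \<in> Y"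
  shows "din as X \<le> din as Y"
  using assms by (induction as) (auto simp: din_Cons)

lemma dout_mono_outside:
  assumes "\<And>e. e \<in> set as \<Longrightarrow> fst e \<in> X \<Longrightarrow> snd e \<notin> X \<Longrightarrow> fst e \<in> Y \<and> snd e \<notin> Y"
  shows "dout as X \<le> dout as Y"
  using assms by (induction as) (auto simp: dout_Cons)

text \<open>Arcs inside \<open>S\<close> cancel. As the right-hand side is additive, inequalities
  between in-degree and out-degree can be summed over disjoint sets.\<close>

lemma cut_balance:
  assumes "finite S"
  shows "int (din as S) - int (dout as S) =
    (\<Sum>v\<in>S. int (din as {v}) - int (dout as {v}))"
proof (induction as)
  case (Cons e as)
  have "(\<Sum>v\<in>S. int (din (e # as) {v}) - int (dout (e # as) {v})) =
    (\<Sum>v\<in>S. (of_bool (snd e = v) - of_bool (fst e = v)) + (int (din as {v}) - int (dout as {v})))"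
    by (intro sum.cong) (auto simp: din_Cons dout_Cons)
  also have "\<dots> = (of_bool (snd e \<in> S) - of_bool (fst e \<in> S)) + (\<Sum>v\<in>S. int (din as {v}) - int (dout as {v}))"
    using assms by (simp add: sum.distrib sum_subtractf of_bool_def)
  finally show ?case using Cons by (auto simp: din_Cons dout_Cons)
qed simp

definition conn :: "'a set \<Rightarrow> nat \<Rightarrow> ('a \<times> 'a) list \<Rightarrow> bool" where
  "conn V l as \<longleftrightarrow> (\<forall>S. S \<noteq> {} \<and> S \<subset> V \<longrightarrow> l \<le> dout as S \<and> l \<le> din as S)"

lemma conn_swap [simp]: "conn V l (map prod.swap as) = conn V l as"
  by (auto simp: conn_def)

definition itight :: "'a set \<Rightarrow> nat \<Rightarrow> ('a \<times> 'a) list \<Rightarrow> 'a set \<Rightarrow> bool" where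
  "itight V l as X \<longleftrightarrow> X \<noteq> {} \<and> X \<subset> V \<and> din as X = l"

definition otight :: "'a set \<Rightarrow> nat \<Rightarrow> ('a \<times> 'a) list \<Rightarrow> 'a set \<Rightarrow> bool" where
  "otight V l as X \<longleftrightarrow> X \<noteq> {} \<and> X \<subset> V \<and> dout as X = l"

definition tight :: "'a set \<Rightarrow> nat \<Rightarrow> ('a \<times> 'a) list \<Rightarrow> 'a set \<Rightarrow> bool" where
  "tight V l as X \<longleftrightarrow> itight V l as X \<or> otight V l as X"

lemma itight_swap [simp]: "itight V l (map prod.swap as) X = otight V l as X"
  and otight_swap [simp]: "otight V l (map prod.swap as) X = itight V l as X"
  by (auto simp: itight_def otight_def)

lemma tight_swap [simp]: "tight V l (map prod.swap as) X = tight V l as X"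
  by (auto simp: tight_def)

lemma tight_subset: "tight V l as X \<Longrightarrow> X \<subset> V" and tight_nonempty: "tight V l as X \<Longrightarrow> X \<noteq> {}"
  by (auto simp: tight_def itight_def otight_def)

lemma conn_Suc_iff:
  assumes "conn V l as"
  shows "conn V (Suc l) as \<longleftrightarrow> (\<forall>X. \<not> tight V l as X)"
proof -
  have "Suc l \<le> dout as S \<and> Suc l \<le> din as S \<longleftrightarrow> \<not> tight V l as S" if "S \<noteq> {}" "S \<subset> V" for S
    using assms that unfolding conn_def tight_def itight_def otight_def
    by (metis Suc_leI le_neq_implies_less not_less_eq_eq order_refl)
  then show ?thesis unfolding conn_def by (metis tight_nonempty tight_subset)
qed


section \<open>Tight sets\<close>

text \<open>\<open>degree\<close> comes from \<open>2 * k\<close>-edge-connectivity of the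
  underlying graph and \<open>l < k\<close>. It separates the two kinds of tight sets and gives each
  of them slack two in its other degree.\<close>

locale tight_graph =
  fixes V :: "'a set" and as :: "('a \<times> 'a) list" and l :: nat
  assumes finite_V: "finite V"
    and arcs_V: "set as \<subseteq> V \<times> V"
    and conn: "conn V l as"
    and degree: "S \<noteq> {} \<Longrightarrow> S \<subset> V \<Longrightarrow> 2 * l + 2 \<le> dout as S + din as S"
begin

text \<open>Reversing all arcs exchanges in-tight and out-tight sets; interpreting the locale for
  the reversed arcs yields dual results.\<close>

lemma swapped: "tight_graph V (map prod.swap as) l"
  using finite_V arcs_V conn degree by unfold_locales (auto simp: add.commute)

abbreviation "it \<equiv> itight V l as"
abbreviation "ot \<equiv> otight V l as"
abbreviation "ti \<equiv> tight V l as"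

lemma le_dout: "S \<noteq> {} \<Longrightarrow> S \<subset> V \<Longrightarrow> l \<le> dout as S"
  and le_din: "S \<noteq> {} \<Longrightarrow> S \<subset> V \<Longrightarrow> l \<le> din as S"
  using conn by (auto simp: conn_def)

lemma not_it_ot: "it X \<Longrightarrow> \<not> ot X"
  using degree[of X] by (auto simp: itight_def otight_def)

lemma ot_compl: "it X \<Longrightarrow> ot (V - X)" and it_compl: "ot X \<Longrightarrow> it (V - X)"
  using arcs_V by (auto simp: itight_def otight_def dout_compl din_compl)

section \<open>Uncrossing and disjointness of minimal tight sets\<close>

lemma it_inter_union:
  assumes "it X" "it Y" "X \<inter> Y \<noteq> {}" "X \<union> Y \<noteq> V"
  shows "it (X \<inter> Y)" "it (X \<union> Y)"
proof -
  have "l \<le> din as (X \<inter> Y)" "l \<le> din as (X \<union> Y)"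
    using assms by (intro le_din; auto simp: itight_def)+
  with din_submodular[of as X Y] assms show "it (X \<inter> Y)" "it (X \<union> Y)"
    by (auto simp: itight_def)
qed

lemma it_ot_uncross:
  assumes "it X" "ot Y" "X - Y \<noteq> {}" "Y - X \<noteq> {}"
  shows "it (X - Y)" "ot (Y - X)"
proof -
  have "l \<le> din as (X - Y)" "l \<le> dout as (Y - X)"
    using assms by (intro le_din le_dout; auto simp: itight_def otight_def)+
  with din_dout_uncross[of as X Y] assms show "it (X - Y)" "ot (Y - X)"
    by (auto simp: itight_def otight_def)
qed

definition minimal :: "'a set \<Rightarrow> bool" where
  "minimal X \<longleftrightarrow> ti X \<and> (\<forall>Y. Y \<subset> X \<longrightarrow> \<not> ti Y)"

lemma ex_minimal: "ti X \<Longrightarrow> \<exists>M\<subseteq>X. minimal M"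
proof -
  assume X: "ti X"
  have fin: "finite {M. M \<subseteq> X \<and> ti M}"
    by (rule finite_subset[of _ "Pow V"]) (use finite_V in \<open>auto dest: tight_subset\<close>)
  have "{M. M \<subseteq> X \<and> ti M} \<noteq> {}" using X by auto
  from finite_has_minimal[OF fin this] obtain M where "M \<subseteq> X" "ti M"
    "\<And>M'. M' \<subseteq> X \<Longrightarrow> ti M' \<Longrightarrow> M' \<subseteq> M \<Longrightarrow> M = M'" by auto
  then have "minimal M" unfolding minimal_def by (metis order.trans psubset_eq)
  with \<open>M \<subseteq> X\<close> show ?thesis by blast
qed

text \<open>Overlapping in-tight sets are uncrossed to their intersection, sets of opposite kinds to
  a difference; if two in-tight sets cover \<open>V\<close>, the complement of one is out-tight and
  lies inside the other. In each case a tight set appears properly inside \<open>X\<close>.\<close>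

lemma minimal_disjoint_aux:
  assumes "minimal X" "minimal Y" "it X" "X \<noteq> Y"
  shows "X \<inter> Y = {}"
proof (rule ccontr)
  assume ne: "X \<inter> Y \<noteq> {}"
  have nsub: "\<not> X \<subseteq> Y" "\<not> Y \<subseteq> X" using assms unfolding minimal_def by blast+
  show False
  proof (cases "it Y")
    case True
    show False
    proof (cases "X \<union> Y = V")
      case True
      then have "V - Y \<subset> X" using ne assms(3) by (auto simp: itight_def)
      moreover have "ti (V - Y)" using ot_compl[OF \<open>it Y\<close>] by (auto simp: tight_def)
      ultimately show False using assms unfolding minimal_def by blast
    next
      case False
      then have "ti (X \<inter> Y)" using it_inter_union(1)[OF assms(3) True ne] by (auto simp: tight_def)
      moreover have "X \<inter> Y \<subset> X" using nsub by blast
      ultimately show False using assms unfolding minimal_def by blast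
    qed
  next
    case False
    then have "ot Y" using assms by (auto simp: minimal_def tight_def)
    then have "ti (X - Y)" using it_ot_uncross(1)[OF assms(3)] nsub by (auto simp: tight_def)
    moreover have "X - Y \<subset> X" using ne by blast
    ultimately show False using assms unfolding minimal_def by blast
  qed
qed

end

lemma (in tight_graph) minimal_disjoint:
  assumes "minimal X" "minimal Y" "X \<noteq> Y"
  shows "X \<inter> Y = {}"
proof (cases "it X")
  case True
  then show ?thesis using minimal_disjoint_aux assms by blast
next
  case False
  then have "ot X" using assms by (auto simp: minimal_def tight_def)
  interpret S: tight_graph V "map prod.swap as" l by (rule swapped)
  have "S.minimal X" "S.minimal Y" using assms by (auto simp: minimal_def S.minimal_def)
  then show ?thesis using S.minimal_disjoint_aux[of X Y] \<open>ot X\<close> assms by simp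
qed

section \<open>End vertices inside minimal tight sets\<close>

lemma union_closed_cover_sum_le:
  fixes b :: "'a \<Rightarrow> int"
  assumes fin: "finite \<F>" "\<And>S. S \<in> \<F> \<Longrightarrow> finite S"
    and un: "\<And>S T. S \<in> \<F> \<Longrightarrow> T \<in> \<F> \<Longrightarrow> S \<inter> T \<noteq> {} \<Longrightarrow> S \<union> T \<in> \<F>"
    and le: "\<And>S. S \<in> \<F> \<Longrightarrow> sum b S \<le> 0"
  shows "sum b (\<Union>\<F>) \<le> 0"
proof -
  define M where "M = {S\<in>\<F>. \<forall>T\<in>\<F>. S \<subseteq> T \<longrightarrow> T = S}"
  have "\<exists>T\<in>M. S \<subseteq> T" if S: "S \<in> \<F>" for S
  proof -
    obtain T where "T \<in> \<F>" "S \<subseteq> T" "\<And>U. U \<in> \<F> \<Longrightarrow> T \<subseteq> U \<Longrightarrow> T = U"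
      using finite_has_maximal2[OF fin(1) S] by auto
    then show ?thesis unfolding M_def by (intro bexI[of _ T]) auto
  qed
  then have eq: "\<Union>\<F> = \<Union>M" unfolding M_def by blast
  \<comment> \<open>The maximal members have the same union as the family and, by closure under
    union, are pairwise disjoint, so the sum splits over them.\<close>
  have disj: "S \<inter> T = {}" if "S \<in> M" "T \<in> M" "S \<noteq> T" for S T
  proof (rule ccontr)
    assume "S \<inter> T \<noteq> {}"
    then have "S \<union> T \<in> \<F>" using that un by (auto simp: M_def)
    then have "S \<union> T = S" "S \<union> T = T" using that by (auto simp: M_def)
    with that show False by blast
  qed
  have "sum b (\<Union>M) = sum (sum b) M"
    using fin disj by (subst sum.Union_disjoint) (auto simp: M_def)
  also have "\<dots> \<le> 0" using le by (intro sum_nonpos[of M "sum b"]) (simp add: M_def)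
  finally show ?thesis using eq by simp
qed

context tight_graph
begin

text \<open>
  The sets to be avoided are closed under union when they intersect, and on each of them the
  out-degree is at least the in-degree. So they cannot cover \<open>B\<close>, where it is the other way round.
\<close>

lemma safe_sink:
  assumes B: "ot B" "\<And>Y. Y \<subset> B \<Longrightarrow> \<not> ot Y"
  obtains t where "t \<in> B" "\<And>S. S \<subseteq> B \<Longrightarrow> t \<in> S \<Longrightarrow> \<not> it S"
    "\<And>S. S \<subseteq> B \<Longrightarrow> t \<in> S \<Longrightarrow> din as S = Suc l \<Longrightarrow> \<exists>T\<subseteq>S. ti T"
proof -
  \<comment> \<open>A shift towards \<open>t\<close> lowers in-degree \<open>Suc l\<close> to
    \<open>l\<close>; a critical set containing \<open>t\<close> could thereby become tight without
    containing an old tight set.\<close>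
  define crit where "crit S \<longleftrightarrow> S \<noteq> {} \<and> S \<subseteq> B \<and> din as S = Suc l \<and> (\<forall>T\<subseteq>S. \<not> ti T)" for S
  define bad where "bad S \<longleftrightarrow> S \<subseteq> B \<and> (it S \<or> crit S)" for S
  have BV: "B \<subset> V" "B \<noteq> {}" using B by (auto simp: otight_def)
  have tt: "it (S \<union> S')" if "it S" "it S'" "S \<subseteq> B" "S' \<subseteq> B" "S \<inter> S' \<noteq> {}" for S S'
    using it_inter_union(2)[of S S'] that BV by blast
  have crit_inter: "Suc l \<le> din as (S \<inter> S')" if "crit S'" "S \<inter> S' \<noteq> {}" for S S'
  proof -
    have "S \<inter> S' \<subset> V" using that BV by (auto simp: crit_def)
    moreover have "\<not> it (S \<inter> S')" using that by (auto simp: crit_def tight_def)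
    ultimately show ?thesis using le_din[of "S \<inter> S'"] that by (auto simp: itight_def)
  qed
  \<comment> \<open>The intersection lies in a critical set, so it is not in-tight and has in-degree
    at least \<open>Suc l\<close>; submodularity then leaves only \<open>l\<close> for the
    union.\<close>
  have tc: "it (S \<union> S')" if "it S" "crit S'" "S \<subseteq> B" "S \<inter> S' \<noteq> {}" for S S'
  proof -
    have "din as (S \<union> S') \<le> l"
      using din_submodular[of as S S'] crit_inter[OF that(2,4)] that by (auto simp: crit_def itight_def)
    moreover have "S \<union> S' \<subset> V" "S \<union> S' \<noteq> {}" using that BV by (auto simp: crit_def itight_def)
    ultimately show ?thesis using le_din[of "S \<union> S'"] by (auto simp: itight_def)
  qed
  have cc: "it (S \<union> S') \<or> crit (S \<union> S')" if c: "crit S" "crit S'" "S \<inter> S' \<noteq> {}" for S S'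
  proof (rule ccontr)
    assume no: "\<not> (it (S \<union> S') \<or> crit (S \<union> S'))"
    have sub: "S \<union> S' \<subset> V" "S \<union> S' \<noteq> {}" "S \<union> S' \<subseteq> B" using c BV by (auto simp: crit_def)
    have "din as (S \<union> S') \<le> Suc l"
      using din_submodular[of as S S'] crit_inter[OF c(2,3)] c by (auto simp: crit_def)
    then have d: "din as (S \<union> S') = Suc l" using le_din[of "S \<union> S'"] sub no by (auto simp: itight_def)
    \<comment> \<open>This tight set cannot be out-tight: it would be all of \<open>B\<close>, whose
      in-degree is at least \<open>l + 2\<close>. If it is in-tight, it meets one of the two
      critical sets and by \<open>tc\<close> absorbs first that one and then the other, so the union
      is in-tight, against \<open>d\<close>.\<close>
    then obtain T where T: "T \<subseteq> S \<union> S'" "ti T" using no sub by (auto simp: crit_def)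
    show False
    proof (cases "it T")
      case False
      then have "ot T" using T by (auto simp: tight_def)
      then have "T = B" using B(2) T sub by blast
      then have "S \<union> S' = B" using T sub by blast
      then show False using d degree[of B] B(1) BV by (auto simp: otight_def)
    next
      case True
      have key: False if "crit X" "crit Y" "X \<inter> Y \<noteq> {}" "T \<inter> X \<noteq> {}" "X \<union> Y = S \<union> S'" for X Y
      proof -
        have "T \<subseteq> B" using T(1) sub(3) by (rule subset_trans)
        have "X \<subseteq> B" using that(1) by (simp add: crit_def)
        have TX: "it (T \<union> X)" using tc[OF True that(1) \<open>T \<subseteq> B\<close> that(4)] .
        have "T \<union> X \<subseteq> B" "(T \<union> X) \<inter> Y \<noteq> {}" using \<open>T \<subseteq> B\<close> \<open>X \<subseteq> B\<close> that(3) by blast+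
        then have "it (T \<union> X \<union> Y)" using tc[OF TX that(2)] by simp
        moreover have "T \<union> X \<union> Y = S \<union> S'" using T(1) that(5) by blast
        ultimately show False using d by (simp add: itight_def)
      qed
      have "T \<noteq> {}" using T tight_nonempty by blast
      then consider "T \<inter> S \<noteq> {}" | "T \<inter> S' \<noteq> {}" using T by blast
      then show False
      proof cases
        case 1
        then show False using key[OF c] by simp
      next
        case 2
        then show False using key[OF c(2,1)] c(3) by (simp add: Un_commute Int_commute)
      qed
    qed
  qed
  have bad_un: "bad (S \<union> S')" if bb: "bad S" "bad S'" "S \<inter> S' \<noteq> {}" for S S'
  proof -
    have "S \<union> S' \<subseteq> B" using that by (simp add: bad_def)
    consider "it S" "it S'" | "it S" "crit S'" | "crit S" "it S'" | "crit S" "crit S'"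
      using bb(1,2) unfolding bad_def by metis
    then have "it (S \<union> S') \<or> crit (S \<union> S')"
    proof cases
      case 1
      with tt[OF 1] bb show ?thesis by (simp add: bad_def)
    next
      case 2
      with tc[OF 2] bb show ?thesis by (simp add: bad_def)
    next
      case 3
      with tc[OF 3(2,1)] bb show ?thesis by (simp add: bad_def Int_commute Un_commute)
    next
      case 4
      with cc[OF 4] bb show ?thesis by simp
    qed
    with \<open>S \<union> S' \<subseteq> B\<close> show ?thesis by (simp add: bad_def)
  qed
  let ?b = "\<lambda>v. int (din as {v}) - int (dout as {v})"
  have finB: "finite B" using BV finite_V finite_subset by blast
  \<comment> \<open>Half of the degree bound \<open>2 * l + 2\<close> is \<open>Suc l\<close>, the
    largest in-degree of a bad set.\<close>
  have bal: "sum ?b S \<le> 0" if "bad S" for S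
  proof -
    have S: "S \<noteq> {}" "S \<subset> V" "finite S" using that BV finB finite_subset
      by (auto simp: bad_def crit_def itight_def)
    have "din as S \<le> Suc l" using that by (auto simp: bad_def crit_def itight_def)
    then have "din as S \<le> dout as S" using degree[of S] S by linarith
    then show ?thesis using cut_balance[OF S(3), of as] by linarith
  qed
  have "\<Union>{S. bad S} \<noteq> B"
  proof
    assume cov: "\<Union>{S. bad S} = B"
    have finb: "finite {S. bad S}" using finB finite_subset[of _ "Pow B"] by (auto simp: bad_def)
    have "sum ?b (\<Union>{S. bad S}) \<le> 0"
    proof (rule union_closed_cover_sum_le[OF finb])
      show "finite S" if "S \<in> {S. bad S}" for S
        using that finB finite_subset by (auto simp: bad_def)
    qed (use bal bad_un in auto)
    then have "din as B \<le> dout as B" using cov cut_balance[OF finB, of as] by simp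
    then show False using degree[of B] B BV by (auto simp: otight_def)
  qed
  then obtain t where t: "t \<in> B" "\<And>S. bad S \<Longrightarrow> t \<notin> S" by (auto simp: bad_def)
  show ?thesis
  proof (rule that[OF t(1)])
    show "\<not> it S" if "S \<subseteq> B" "t \<in> S" for S
      using t(2)[of S] that by (auto simp: bad_def)
    show "\<exists>T\<subseteq>S. ti T" if "S \<subseteq> B" "t \<in> S" "din as S = Suc l" for S
      using t(2)[of S] that by (auto simp: bad_def crit_def)
  qed
qed

end

lemma (in tight_graph) safe_source:
  assumes A: "it A" "\<And>Y. Y \<subset> A \<Longrightarrow> \<not> it Y"
  obtains s where "s \<in> A" "\<And>S. S \<subseteq> A \<Longrightarrow> s \<in> S \<Longrightarrow> \<not> ot S"
    "\<And>S. S \<subseteq> A \<Longrightarrow> s \<in> S \<Longrightarrow> dout as S = Suc l \<Longrightarrow> \<exists>T\<subseteq>S. ti T"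
proof -
  interpret S: tight_graph V "map prod.swap as" l by (rule swapped)
  show ?thesis using S.safe_sink[of A thesis] A that by simp
qed

text \<open>Reversing a path from \<open>s\<close> to \<open>t\<close> has this effect on all cuts.\<close>

definition shifted :: "'a \<Rightarrow> 'a \<Rightarrow> ('a \<times> 'a) list \<Rightarrow> ('a \<times> 'a) list \<Rightarrow> bool" where
  "shifted s t as as' \<longleftrightarrow> (\<forall>S. dout as' S + of_bool (s \<in> S) = dout as S + of_bool (t \<in> S) \<and>
     din as' S + of_bool (t \<in> S) = din as S + of_bool (s \<in> S))"

definition better :: "'a set \<Rightarrow> nat \<Rightarrow> ('a \<times> 'a) list \<Rightarrow> ('a \<times> 'a) list \<Rightarrow> bool" where
  "better V l as as' \<longleftrightarrow> (\<forall>X. tight V l as' X \<longrightarrow> (\<exists>Y\<subseteq>X. tight V l as Y)) \<and>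
     (\<exists>Y. tight V l as Y \<and> (\<forall>X. tight V l as' X \<longrightarrow> \<not> X \<subseteq> Y))"

section \<open>Effect of a shift on the tight sets\<close>

context tight_graph
begin

text \<open>Below an inclusion-minimal \<open>W\<close> of this form, tight sets of opposite kinds
  are never nested, except with \<open>W\<close> itself as the outer set.\<close>

definition inhom :: "'a set \<Rightarrow> bool" where
  "inhom W \<longleftrightarrow> it W \<and> (\<exists>Y\<subset>W. ot Y) \<or> ot W \<and> (\<exists>Y\<subset>W. it Y)"

text \<open>These are the vertices \<open>u\<close> for which a shift from \<open>s\<close> to
  \<open>u\<close> keeps all cuts at least \<open>l\<close>: out-degrees drop only for sets
  containing \<open>s\<close> but not \<open>u\<close>, in-degrees only for complements of such
  sets.\<close>

definition safe :: "'a \<Rightarrow> 'a \<Rightarrow> bool" where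
  "safe s u \<longleftrightarrow> (\<forall>T. ot T \<longrightarrow> s \<in> T \<longrightarrow> u \<in> T)"

text \<open>A shift changes each degree by at most one. A newly tight set therefore had slack one in
  the degree that dropped; its other degree rose and cannot have become \<open>l\<close>.\<close>

lemma shifted_cases:
  assumes sh: "shifted s t as as'" and X: "tight V l as' X"
  obtains "ti X" | "t \<in> X" "s \<notin> X" "din as X = Suc l" | "s \<in> X" "t \<notin> X" "dout as X = Suc l"
proof -
  have XV: "X \<noteq> {}" "X \<subset> V" using X tight_subset tight_nonempty by blast+
  have e: "dout as' X + of_bool (s \<in> X) = dout as X + of_bool (t \<in> X)"
    "din as' X + of_bool (t \<in> X) = din as X + of_bool (s \<in> X)"
    using sh by (auto simp: shifted_def)
  have "l \<le> dout as X" "l \<le> din as X" using le_dout le_din XV by auto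
  with e X XV that show thesis
    by (cases "s \<in> X"; cases "t \<in> X") (auto simp: tight_def itight_def otight_def)
qed

text \<open>Uncrossing with slack one: \<open>B - X\<close> is not out-tight, so its out-degree is
  at least \<open>Suc l\<close> and absorbs the slack, leaving at most \<open>l\<close> for the
  in-degree of \<open>X - B\<close>.\<close>

lemma near_uncross:
  assumes "din as X = Suc l" "ot B" "X - B \<noteq> {}" "B - X \<noteq> {}" "\<not> ot (B - X)" "X \<subset> V"
  shows "it (X - B)"
proof -
  have "l \<le> din as (X - B)" "l \<le> dout as (B - X)"
    using assms by (intro le_din le_dout; auto simp: otight_def)+
  moreover have "dout as (B - X) \<noteq> l" using assms by (auto simp: otight_def)
  ultimately show ?thesis using assms din_dout_uncross[of as X B] by (auto simp: itight_def otight_def)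
qed

lemma near_uncross':
  assumes "dout as X = Suc l" "it A" "X - A \<noteq> {}" "A - X \<noteq> {}" "\<not> it (A - X)" "X \<subset> V"
  shows "ot (X - A)"
proof -
  have "l \<le> dout as (X - A)" "l \<le> din as (A - X)"
    using assms by (intro le_din le_dout; auto simp: itight_def)+
  moreover have "din as (A - X) \<noteq> l" using assms by (auto simp: itight_def)
  ultimately show ?thesis using assms din_dout_uncross[of as A X] by (auto simp: itight_def otight_def)
qed

text \<open>A newly tight set contains \<open>B\<close> (or \<open>A\<close>), lies in it, or
  crosses it; the choice of \<open>t\<close> (or \<open>s\<close>) settles the second case and
  uncrossing the third. \<open>AB\<close> ensures that \<open>A\<close> or \<open>B\<close> is
  minimal among tight sets of both kinds, and this one is destroyed by the shift.\<close>

lemma shifted_better: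
  assumes sh: "shifted s t as as'"
    and A: "it A" "\<And>Y. Y \<subset> A \<Longrightarrow> \<not> it Y" and B: "ot B" "\<And>Y. Y \<subset> B \<Longrightarrow> \<not> ot Y"
    and s: "s \<in> A" "\<And>S. S \<subseteq> A \<Longrightarrow> s \<in> S \<Longrightarrow> \<not> ot S"
      "\<And>S. S \<subseteq> A \<Longrightarrow> s \<in> S \<Longrightarrow> dout as S = Suc l \<Longrightarrow> \<exists>T\<subseteq>S. ti T"
    and t: "t \<in> B" "\<And>S. S \<subseteq> B \<Longrightarrow> t \<in> S \<Longrightarrow> \<not> it S"
      "\<And>S. S \<subseteq> B \<Longrightarrow> t \<in> S \<Longrightarrow> din as S = Suc l \<Longrightarrow> \<exists>T\<subseteq>S. ti T"
    and AB: "(\<exists>Y\<subseteq>A. ot Y) \<Longrightarrow> B \<subset> A \<and> (\<forall>Y\<subset>B. \<not> it Y)"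
  shows "better V l as as'"
proof -
  have sub: "\<exists>Y\<subseteq>X. ti Y" if X: "tight V l as' X" for X
    using sh X
  proof (cases rule: shifted_cases)
    case 1
    then show ?thesis by blast
  next
    case 2
    consider "B \<subseteq> X" | "X \<subseteq> B" | "X - B \<noteq> {}" "B - X \<noteq> {}" by blast
    then show ?thesis
    proof cases
      case 1
      then show ?thesis using B by (auto simp: tight_def)
    next
      case 2
      then show ?thesis using t(3) \<open>t \<in> X\<close> \<open>din as X = Suc l\<close> by blast
    next
      case 3
      \<comment> \<open>As \<open>t\<close> lies in both \<open>B\<close> and \<open>X\<close>,
        minimality of \<open>B\<close> prevents \<open>B - X\<close> from being out-tight, as
        uncrossing with slack one demands.\<close>
      have "B - X \<subset> B" using t(1) 2(1) by blast
      then have "it (X - B)"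
        using near_uncross[OF 2(3) B(1) 3] B(2) tight_subset[OF X] by blast
      then show ?thesis by (auto simp: tight_def)
    qed
  next
    case 3
    note c = 3
    consider "A \<subseteq> X" | "X \<subseteq> A" | "X - A \<noteq> {}" "A - X \<noteq> {}" by blast
    then show ?thesis
    proof cases
      case 1
      then show ?thesis using A by (auto simp: tight_def)
    next
      case 2
      then show ?thesis using s(3) c by blast
    next
      case 3
      have "A - X \<subset> A" using s(1) c(1) by blast
      then have "ot (X - A)"
        using near_uncross'[OF c(3) A(1) 3] A(2) tight_subset[OF X] by blast
      then show ?thesis by (auto simp: tight_def)
    qed
  qed
  have "\<exists>M. minimal M \<and> \<not> tight V l as' M"
  proof (cases "\<exists>Y\<subseteq>A. ot Y")
    case False
    then have "minimal A" using A by (auto simp: minimal_def tight_def)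
    moreover have "t \<notin> A"
    proof
      assume "t \<in> A"
      consider "A \<subseteq> B" | "B \<subseteq> A" | "A - B \<noteq> {}" "B - A \<noteq> {}" by blast
      then show False
      proof cases
        case 1
        then show False using t(2) A(1) \<open>t \<in> A\<close> by blast
      next
        case 2
        then show False using False B(1) by blast
      next
        case 3
        then have "it (A - B)" using it_ot_uncross(1) A B by blast
        moreover have "A - B \<subset> A" using \<open>t \<in> A\<close> t(1) by blast
        ultimately show False using A(2) by blast
      qed
    qed
    \<comment> \<open>The shift takes one leaving arc from \<open>A\<close>; starting from
      \<open>l + 2\<close>, the out-degree stays above \<open>l\<close>, so \<open>A\<close> does
      not become out-tight instead.\<close>
    have "dout as A \<ge> l + 2" using degree[of A] A(1) by (auto simp: itight_def)
    have "\<not> tight V l as' A"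
    proof
      assume "tight V l as' A"
      moreover have "dout as' A + 1 = dout as A" "din as' A = din as A + 1"
        using sh[unfolded shifted_def, rule_format, of A] s(1) \<open>t \<notin> A\<close> by simp_all
      ultimately show False using A(1) \<open>dout as A \<ge> l + 2\<close> by (auto simp: tight_def itight_def otight_def)
    qed
    ultimately show ?thesis by blast
  next
    case True
    then have BA: "B \<subset> A" "\<And>Y. Y \<subset> B \<Longrightarrow> \<not> it Y" using AB by blast+
    then have "minimal B" using B by (auto simp: minimal_def tight_def)
    have "s \<notin> B" using s(2) BA(1) B(1) by blast
    have "din as B \<ge> l + 2" using degree[of B] B(1) by (auto simp: otight_def)
    have "\<not> tight V l as' B"
    proof
      assume "tight V l as' B"
      moreover have "dout as' B = dout as B + 1" "din as' B + 1 = din as B"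
        using sh[unfolded shifted_def, rule_format, of B] t(1) \<open>s \<notin> B\<close> by simp_all
      ultimately show False using B(1) \<open>din as B \<ge> l + 2\<close> by (auto simp: tight_def itight_def otight_def)
    qed
    with \<open>minimal B\<close> show ?thesis by blast
  qed
  then obtain M where M: "minimal M" "\<not> tight V l as' M" by blast
  \<comment> \<open>A new tight set inside \<open>M\<close> contains an old one, which is
    \<open>M\<close> by minimality; so it equals \<open>M\<close>, which is no longer tight.\<close>
  have "\<not> X \<subseteq> M" if X: "tight V l as' X" for X
  proof
    assume "X \<subseteq> M"
    obtain Y where "Y \<subseteq> X" "ti Y" using sub[OF X] by blast
    then have "Y = M" using M(1) \<open>X \<subseteq> M\<close> unfolding minimal_def by blast
    then have "X = M" using \<open>Y \<subseteq> X\<close> \<open>X \<subseteq> M\<close> by blast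
    then show False using X M(2) by simp
  qed
  then show ?thesis using sub M(1) unfolding better_def minimal_def by blast
qed

lemma ex_minimal_it:
  assumes "it X" shows "\<exists>A\<subseteq>X. it A \<and> (\<forall>Y. Y \<subset> A \<longrightarrow> \<not> it Y)"
proof -
  have fin: "finite {M. M \<subseteq> X \<and> it M}"
    by (rule finite_subset[of _ "Pow V"]) (use finite_V in \<open>auto simp: itight_def\<close>)
  have "{M. M \<subseteq> X \<and> it M} \<noteq> {}" using assms by auto
  from finite_has_minimal[OF fin this] obtain M where "M \<subseteq> X" "it M"
    "\<And>M'. M' \<subseteq> X \<Longrightarrow> it M' \<Longrightarrow> M' \<subseteq> M \<Longrightarrow> M = M'" by auto
  then show ?thesis by (intro exI[of _ M]) (metis order.trans psubset_eq)
qed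

end

lemma (in tight_graph) ex_minimal_ot:
  assumes "ot X" shows "\<exists>A\<subseteq>X. ot A \<and> (\<forall>Y. Y \<subset> A \<longrightarrow> \<not> ot Y)"
proof -
  interpret S: tight_graph V "map prod.swap as" l by (rule swapped)
  show ?thesis using S.ex_minimal_it[of X] assms by simp
qed

section \<open>Existence of a good pair of end vertices\<close>

context tight_graph
begin

text \<open>
  \<open>I u\<close> is the smallest in-tight subset of \<open>W\<close> containing \<open>u\<close>. Walking backwards from \<open>t\<close> along
  arcs on which \<open>I\<close> does not grow, one ends up in a minimal in-tight set \<open>A\<close>; conversely
  \<open>A \<subseteq> I u\<close> for all \<open>u\<close> on the walk, which is what makes it safe.
\<close>

lemma good_pair_within:
  assumes W: "W = V \<or> inhom W" and hom: "\<And>Z. Z \<subset> W \<Longrightarrow> \<not> inhom Z" and ex: "ti X0"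
  obtains s t where "s \<in> V" "t \<in> V" "\<And>as'. shifted s t as as' \<Longrightarrow> better V l as as'"
    "\<And>H. s \<in> H \<Longrightarrow> (\<And>e. e \<in> set as \<Longrightarrow> fst e \<in> H \<Longrightarrow> safe s (snd e) \<Longrightarrow> snd e \<in> H) \<Longrightarrow> t \<in> H"
proof -
  have WV: "W \<subseteq> V" using W by (auto simp: inhom_def itight_def otight_def)
  have W_cases: "W = V \<or> it W \<or> ot W" using W by (auto simp: inhom_def)
  obtain X where X: "it X" using ex ot_compl it_compl by (auto simp: tight_def)
  have exB: "\<exists>B\<subseteq>W. ot B"
    using W X ot_compl[OF X] by (auto simp: inhom_def otight_def)
  have exA: "\<exists>X\<subset>W. it X" if "\<not> it W"
    using W X that by (auto simp: inhom_def itight_def)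
  obtain B where B: "B \<subseteq> W" "ot B" "\<And>Y. Y \<subset> B \<Longrightarrow> \<not> ot Y"
    using exB ex_minimal_ot by (meson order.trans)
  obtain t where t: "t \<in> B" "\<And>S. S \<subseteq> B \<Longrightarrow> t \<in> S \<Longrightarrow> \<not> it S"
    "\<And>S. S \<subseteq> B \<Longrightarrow> t \<in> S \<Longrightarrow> din as S = Suc l \<Longrightarrow> \<exists>T\<subseteq>S. ti T"
    using safe_sink[OF B(2,3)] by blast
  have tW: "t \<in> W" using t B by blast
  define I where "I u = W \<inter> \<Inter>{Y. it Y \<and> Y \<subseteq> W \<and> u \<in> Y}" for u
  have I_sub: "I u \<subseteq> Y" if "it Y" "Y \<subseteq> W" "u \<in> Y" for u Y using that by (auto simp: I_def)
  have I_mem: "u \<in> I u" if "u \<in> W" for u using that by (auto simp: I_def)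
  have I_W: "I u \<subseteq> W" for u by (auto simp: I_def)
  have I_mono: "I u \<subseteq> I v" if "u \<in> I v" for u v using that by (auto simp: I_def)
  \<comment> \<open>Here minimality of \<open>W\<close> makes the sets \<open>I u\<close> well
    behaved: two overlapping in-tight sets that cover \<open>V\<close> would turn one of them into
    an inhomogeneous proper subset of \<open>W\<close>, as it contains the complement of the
    other.\<close>
  have un: "X \<union> Y \<noteq> V" if "it X" "it Y" "X \<subseteq> W" "Y \<subseteq> W" "X \<inter> Y \<noteq> {}" for X Y
  proof
    assume XY: "X \<union> Y = V"
    then have "W = V" using that WV by blast
    have "V - X \<subset> Y" using XY that by blast
    then have "inhom Y" using that(2) ot_compl[OF that(1)] unfolding inhom_def by blast
    moreover have "Y \<subset> W" using that(2) \<open>W = V\<close> by (auto simp: itight_def)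
    ultimately show False using hom by blast
  qed
  have I_it: "it (I u)" if ex: "it Y" "Y \<subseteq> W" "u \<in> Y" for u Y
  proof -
    let ?F = "{Y. it Y \<and> Y \<subseteq> W \<and> u \<in> Y}"
    have "finite ?F" by (rule finite_subset[of _ "Pow V"]) (use finite_V in \<open>auto simp: itight_def\<close>)
    moreover have "?F \<noteq> {}" using ex by blast
    ultimately obtain M where M: "M \<in> ?F" "\<And>Y. Y \<in> ?F \<Longrightarrow> Y \<subseteq> M \<Longrightarrow> M = Y"
      using finite_has_minimal[of ?F] by auto
    have "M \<subseteq> Y" if "Y \<in> ?F" for Y
    proof -
      have "it (M \<inter> Y)" using it_inter_union(1)[of M Y] un[of M Y] M(1) that by blast
      then have "M \<inter> Y \<in> ?F" using M(1) that by blast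
      then show ?thesis using M(2)[of "M \<inter> Y"] by blast
    qed
    then have "I u = M" using M(1) by (auto simp: I_def)
    then show ?thesis using M(1) by simp
  qed
  define r where "r = {(u', u). (u', u) \<in> set as \<and> u' \<in> W \<and> u \<in> W \<and> I u' \<subseteq> I u}"
  define C where "C = {u. (u, t) \<in> r\<^sup>*}"
  have tC: "t \<in> C" by (simp add: C_def)
  have CW: "C \<subseteq> W"
  proof
    fix u assume "u \<in> C"
    then have "(u, t) \<in> r\<^sup>*" by (simp add: C_def)
    then show "u \<in> W" using tW by (cases rule: converse_rtranclE) (auto simp: r_def)
  qed
  have C_step: "u' \<in> C" if "(u', u) \<in> r" "u \<in> C" for u u'
    using that by (auto simp: C_def)
  have "finite (I ` C)" using CW WV finite_V by (meson finite_imageI finite_subset)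
  moreover have "I ` C \<noteq> {}" using tC by blast
  ultimately obtain x where x: "x \<in> C" "\<And>y. y \<in> C \<Longrightarrow> I y \<subseteq> I x \<Longrightarrow> I x = I y"
    using finite_has_minimal[of "I ` C"] by auto
  define A where "A = I x"
  define C' where "C' = {u\<in>C. I u = A}"
  have C'A: "C' \<subseteq> A" using I_mem CW by (auto simp: C'_def)
  have xC': "x \<in> C'" using x by (auto simp: C'_def A_def)
  \<comment> \<open>A backward step that stays in \<open>A\<close> leads to a vertex with
    \<open>I u' \<subseteq> A\<close>, so it remains among the vertices reaching \<open>t\<close>,
    and by the choice of \<open>x\<close> the set \<open>I u'\<close> cannot be smaller than
    \<open>A\<close>.\<close>
  have closed: "u' \<in> C'" if "(u', u) \<in> set as" "u \<in> C'" "u' \<in> A" for u u'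
  proof -
    have "I u' \<subseteq> A" using I_mono that by (auto simp: A_def)
    moreover have "u' \<in> W" "u \<in> W" using that I_W CW by (auto simp: A_def C'_def)
    ultimately have "(u', u) \<in> r" using that by (auto simp: r_def C'_def)
    then have "u' \<in> C" using C_step that by (auto simp: C'_def)
    then show ?thesis using x(2)[of u'] \<open>I u' \<subseteq> A\<close> by (auto simp: C'_def A_def)
  qed
  have itA: "it A"
  proof (rule ccontr)
    \<comment> \<open>Then no in-tight subset of \<open>W\<close> meets \<open>C'\<close>, so
      \<open>A = W\<close>. By \<open>closed\<close> no arc leads from \<open>W - C'\<close> to
      \<open>C'\<close>; hence \<open>W - C'\<close> has out-degree at most \<open>l\<close> and is
      an out-tight set around an in-tight one, against minimality of \<open>W\<close>.\<close>
    assume nit: "\<not> it A"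
    have none: "u \<notin> Y" if "it Y" "Y \<subseteq> W" "u \<in> C'" for u Y
      using I_it[OF that(1,2)] that(3) nit by (auto simp: C'_def)
    have "A = W" using none[OF _ _ xC'] by (auto simp: A_def I_def)
    obtain X where X: "X \<subset> W" "it X" using exA nit \<open>A = W\<close> by blast
    have XC: "X \<subseteq> W - C'" using none[of X] X by blast
    have "dout as (W - C') \<le> l"
    proof (cases "W = V")
      case True
      have "dout as (W - C') = 0"
        unfolding dout_0_iff using closed arcs_V \<open>A = W\<close> True by fastforce
      then show ?thesis by simp
    next
      case False
      then have "ot W" using W_cases nit \<open>A = W\<close> by blast
      have "dout as (W - C') \<le> dout as W"
        by (rule dout_mono_outside) (use closed \<open>A = W\<close> in fastforce)
      then show ?thesis using \<open>ot W\<close> by (auto simp: otight_def)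
    qed
    moreover have ne: "W - C' \<noteq> {}" "W - C' \<subset> V" using XC X WV CW xC' by (auto simp: itight_def C'_def)
    ultimately have "ot (W - C')" using le_dout[OF ne] by (auto simp: otight_def)
    moreover have "X \<noteq> W - C'" using \<open>ot (W - C')\<close> not_it_ot X by blast
    ultimately have "inhom (W - C')" using X XC by (auto simp: inhom_def)
    moreover have "W - C' \<subset> W" using xC' CW by (auto simp: C'_def)
    ultimately show False using hom by blast
  qed
  have AW: "A \<subseteq> W" using I_W by (auto simp: A_def)
  have AV: "A \<subset> V" using itA by (auto simp: itight_def)
  \<comment> \<open>By \<open>closed\<close>, arcs entering \<open>C'\<close> come from outside
    \<open>A\<close>. So \<open>C'\<close> is itself in-tight and, containing \<open>x\<close>,
    includes \<open>I x\<close>.\<close>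
  have "din as C' \<le> din as A"
    by (rule din_mono_outside) (use closed C'A in fastforce)
  moreover have "l \<le> din as C'" using le_din[of C'] C'A AV xC' by blast
  ultimately have "it C'" using itA C'A AV xC' by (auto simp: itight_def)
  then have "A \<subseteq> C'" unfolding A_def using I_sub[of C' x] xC' CW by (auto simp: C'_def)
  then have AC: "A = C'" using C'A by blast
  have minA: "\<not> it Y" if "Y \<subset> A" for Y
  proof
    assume "it Y"
    then obtain u where u: "u \<in> Y" by (auto simp: itight_def)
    then have "I u \<subseteq> Y" using I_sub[of Y u] \<open>it Y\<close> that AW by blast
    moreover have "u \<in> C'" using u that AC by blast
    then have "I u = A" by (simp add: C'_def)
    ultimately show False using that by blast
  qed
  obtain s where s: "s \<in> A" "\<And>S. S \<subseteq> A \<Longrightarrow> s \<in> S \<Longrightarrow> \<not> ot S"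
    "\<And>S. S \<subseteq> A \<Longrightarrow> s \<in> S \<Longrightarrow> dout as S = Suc l \<Longrightarrow> \<exists>T\<subseteq>S. ti T"
    using safe_source[OF itA minA] by blast
  have "s \<in> C'" using s(1) AC by blast
  then have sC: "(s, t) \<in> r\<^sup>*" "I s = A" by (simp_all add: C'_def C_def)
  \<comment> \<open>Otherwise an in-tight \<open>Y\<close> contains \<open>u\<close> but not
    \<open>s\<close>. By the choice of \<open>A\<close> and \<open>s\<close> it is disjoint from
    \<open>A\<close>. Comparing it with \<open>W\<close> gives either an in-tight subset of
    \<open>W\<close> containing \<open>u\<close> but not \<open>s\<close>, against
    \<open>A \<subseteq> I u\<close>, or an out-tight set around \<open>A\<close> properly inside
    \<open>W\<close>.\<close>
  have safe_walk: "safe s u" if su: "A \<subseteq> I u" "u \<in> W" for u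
  proof (rule ccontr)
    assume "\<not> safe s u"
    then obtain T where T: "ot T" "s \<in> T" "u \<notin> T" by (auto simp: safe_def)
    define Y where "Y = V - T"
    have Y: "it Y" "u \<in> Y" "s \<notin> Y" using T it_compl su WV by (auto simp: Y_def)
    have VY: "V - Y = T" using T(1) by (auto simp: Y_def otight_def)
    have inW: False if "it Z" "Z \<subseteq> W" "u \<in> Z" "s \<notin> Z" for Z
      using I_sub[OF that(1-3)] su s(1) that(4) by blast
    have disj: "A \<inter> Y = {}"
    proof (rule ccontr)
      assume ne: "A \<inter> Y \<noteq> {}"
      show False
      proof (cases "A \<union> Y = V")
        case True
        then have "T \<subseteq> A" using VY by blast
        then show False using s(2) T by blast
      next
        case False
        then have "it (A \<inter> Y)" using it_inter_union(1) itA Y ne by blast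
        moreover have "A \<inter> Y \<subset> A" using s(1) Y(3) by blast
        ultimately show False using minA by blast
      qed
    qed
    have no_ot: False if "ot Z" "A \<subseteq> Z" "Z \<subset> W" for Z
    proof -
      have "A \<noteq> Z" using that itA not_it_ot by blast
      then have "inhom Z" using that itA by (auto simp: inhom_def)
      then show False using hom that by blast
    qed
    show False
    proof (cases "Y \<subseteq> W")
      case True
      then show False using inW Y by blast
    next
      case False
      then consider "ot W" | "it W" using W_cases Y by (auto simp: itight_def)
      then show False
      proof cases
        case 1
        then have "ot (W - Y)"
          using it_ot_uncross(2)[OF Y(1) 1] False s(1) AW Y(3) by blast
        then show False using no_ot[of "W - Y"] disj AW Y su by blast
      next
        case 2
        show False
        proof (cases "Y \<union> W = V")
          case True
          then have "T \<subset> W" using VY su T(3) by blast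
          moreover have "A \<subseteq> T" using disj VY AV by blast
          ultimately show False using no_ot T(1) by blast
        next
          case False
          then have "it (Y \<inter> W)" using it_inter_union(1)[OF Y(1) 2] su Y by blast
          then show False using inW[of "Y \<inter> W"] su Y by blast
        qed
      qed
    qed
  qed
  show thesis
  proof (rule that)
    show "s \<in> V" using s(1) AV by blast
    show "t \<in> V" using tW WV by blast
    show "better V l as as'" if "shifted s t as as'" for as'
    proof (rule shifted_better[OF that itA minA B(2,3) s t], assumption)
      \<comment> \<open>Then \<open>A\<close> is inhomogeneous, hence all of \<open>W\<close>, and
        so \<open>B\<close> lies properly inside it.\<close>
      assume "\<exists>Y\<subseteq>A. ot Y"
      then obtain Y where Y: "Y \<subseteq> A" "ot Y" by blast
      then have "Y \<noteq> A" using itA not_it_ot by blast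
      then have "inhom A" using Y itA by (auto simp: inhom_def)
      then have "A = W" using hom AW by blast
      then have BA: "B \<subset> A" using B(1,2) itA not_it_ot by blast
      have "\<not> it Y" if "Y \<subset> B" for Y
      proof
        assume "it Y"
        then have "inhom B" using that B(2) by (auto simp: inhom_def)
        then show False using hom BA \<open>A = W\<close> by blast
      qed
      then show "B \<subset> A \<and> (\<forall>Y\<subset>B. \<not> it Y)" using BA by blast
    qed
    show "t \<in> H" if H: "s \<in> H"
      "\<And>e. e \<in> set as \<Longrightarrow> fst e \<in> H \<Longrightarrow> safe s (snd e) \<Longrightarrow> snd e \<in> H" for H
    proof -
      have "u \<in> H \<and> A \<subseteq> I u" if "(s, u) \<in> r\<^sup>*" for u
        using that
      proof (induction rule: rtrancl_induct)
        case base
        then show ?case using H sC by simp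
      next
        case (step y z)
        then have "(y, z) \<in> set as" "z \<in> W" "A \<subseteq> I z" by (auto simp: r_def)
        then show ?case using H(2)[of "(y, z)"] step.IH safe_walk by simp
      qed
      then show ?thesis using sC by blast
    qed
  qed
qed

text \<open>Reachability of \<open>t\<close> through safe vertices is phrased by closed sets
  \<open>H\<close>, so that the set found by a search can be put for \<open>H\<close>. The set
  \<open>W\<close> is an inclusion-minimal inhomogeneous set, or \<open>V\<close> if there is
  none.\<close>

lemma good_pair:
  assumes "ti X0"
  obtains s t where "s \<in> V" "t \<in> V" "\<And>as'. shifted s t as as' \<Longrightarrow> better V l as as'"
    "\<And>H. s \<in> H \<Longrightarrow> (\<And>e. e \<in> set as \<Longrightarrow> fst e \<in> H \<Longrightarrow> safe s (snd e) \<Longrightarrow> snd e \<in> H) \<Longrightarrow> t \<in> H"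
proof (cases "\<exists>W. inhom W")
  case False
  then show ?thesis using good_pair_within[of V X0] assms that by blast
next
  case True
  have fin: "finite {W. inhom W}"
    by (rule finite_subset[of _ "Pow V"]) (use finite_V in \<open>auto simp: inhom_def itight_def otight_def\<close>)
  obtain W where W: "inhom W" "\<And>Z. inhom Z \<Longrightarrow> Z \<subseteq> W \<Longrightarrow> W = Z"
    using finite_has_minimal[OF fin] True by auto
  have "\<not> inhom Z" if "Z \<subset> W" for Z using W(2)[of Z] that by blast
  then show ?thesis using good_pair_within[of W X0] W(1) assms that by blast
qed

end

section \<open>The potential\<close>

definition pot :: "'a set \<Rightarrow> nat \<Rightarrow> ('a \<times> 'a) list \<Rightarrow> nat" where
  "pot V l as = (\<Sum>M | tight V l as M \<and> (\<forall>Y\<subset>M. \<not> tight V l as Y). card V - card M)"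

context tight_graph
begin

lemma pot_eq: "pot V l as = (\<Sum>M | minimal M. card V - card M)"
  by (simp add: pot_def minimal_def)

lemma finite_minimal: "finite {M. minimal M}"
  by (rule finite_subset[of _ "Pow V"]) (use finite_V in \<open>auto simp: minimal_def dest: tight_subset\<close>)

lemma card_minimal_less: "minimal M \<Longrightarrow> card M < card V"
  using finite_V by (auto simp: minimal_def dest!: tight_subset intro: psubset_card_mono)

lemma pot_pos: "ti X \<Longrightarrow> 0 < pot V l as"
proof -
  assume "ti X"
  then obtain M where "minimal M" using ex_minimal by blast
  then show ?thesis
    unfolding pot_eq using finite_minimal card_minimal_less[of M] by (intro sum_pos2[of _ M]) auto
qed

text \<open>Minimal tight sets are nonempty and disjoint, so there are at most \<open>card V\<close>
  of them.\<close>

lemma pot_le: "pot V l as \<le> card V * card V"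
proof -
  have sub: "M \<subseteq> V" if "minimal M" for M using that by (auto simp: minimal_def dest: tight_subset)
  have "card {M. minimal M} = (\<Sum>M | minimal M. 1)" by simp
  also have "\<dots> \<le> (\<Sum>M | minimal M. card M)"
  proof (rule sum_mono)
    fix M assume "M \<in> {M. minimal M}"
    then have "M \<noteq> {}" "finite M" using sub finite_V
      by (auto simp: minimal_def dest: tight_nonempty intro: finite_subset)
    then show "1 \<le> card M" by (simp add: Suc_le_eq card_gt_0_iff)
  qed
  also have "\<dots> = card (\<Union>{M. minimal M})"
    using sub finite_V minimal_disjoint
    by (subst card_Union_disjoint) (auto simp: pairwise_def disjnt_def intro: finite_subset)
  also have "\<dots> \<le> card V" using sub finite_V by (intro card_mono) auto
  finally have "card {M. minimal M} \<le> card V" .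
  moreover have "pot V l as \<le> card {M. minimal M} * card V"
    unfolding pot_eq using sum_bounded_above[of "{M. minimal M}" "\<lambda>M. card V - card M" "card V"] by simp
  ultimately show ?thesis by (meson mult_le_mono1 order.trans)
qed

text \<open>Choosing an old minimal set inside each new one is injective because the new ones are
  disjoint, and no summand exceeds that of the chosen set. Strictness comes from an old minimal set
  \<open>M\<close> containing no new tight set: either it is not chosen, or it is chosen for a
  properly larger set.\<close>

lemma pot_better:
  assumes "tight_graph V as' l" "better V l as as'"
  shows "pot V l as' < pot V l as"
proof -
  interpret T: tight_graph V as' l by fact
  have "\<exists>M\<subseteq>X. minimal M" if X: "T.minimal X" for X
  proof -
    obtain Y where "Y \<subseteq> X" "ti Y" using assms(2) X unfolding better_def T.minimal_def by blast
    then show ?thesis using ex_minimal by (meson order.trans)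
  qed
  then have "\<forall>X. \<exists>M. T.minimal X \<longrightarrow> M \<subseteq> X \<and> minimal M" by blast
  from choice[OF this] obtain f where f: "\<And>X. T.minimal X \<Longrightarrow> f X \<subseteq> X \<and> minimal (f X)" by blast
  have inj: "inj_on f {X. T.minimal X}"
  proof (rule inj_onI)
    fix X Y assume "X \<in> {X. T.minimal X}" "Y \<in> {X. T.minimal X}" and eq: "f X = f Y"
    then have XY: "T.minimal X" "T.minimal Y" by simp_all
    have "f X \<subseteq> X" "f X \<subseteq> Y" using f[OF XY(1)] f[OF XY(2)] eq by simp_all
    moreover have "f X \<noteq> {}"
      using f[OF XY(1)] unfolding minimal_def by (blast dest: tight_nonempty)
    ultimately show "X = Y" using T.minimal_disjoint[OF XY] by blast
  qed
  obtain Y0 where Y0: "ti Y0" "\<And>X. tight V l as' X \<Longrightarrow> \<not> X \<subseteq> Y0"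
    using assms(2) unfolding better_def by blast
  obtain M where M: "M \<subseteq> Y0" "minimal M" using ex_minimal[OF Y0(1)] by blast
  have M': "\<not> X \<subseteq> M" if "T.minimal X" for X
    using Y0(2)[of X] that M(1) unfolding T.minimal_def by blast
  have finX: "finite X" if "T.minimal X" for X
  proof -
    have "X \<subset> V" using that tight_subset[of V l as' X] by (simp add: T.minimal_def)
    then show ?thesis using finite_V by (auto intro: finite_subset)
  qed
  let ?g = "\<lambda>M. card V - card M"
  have le: "?g X \<le> ?g (f X)" if "T.minimal X" for X
    using card_mono[OF finX[OF that]] f[OF that] by (simp add: diff_le_mono2)
  have img: "f ` {X. T.minimal X} \<subseteq> {M. minimal M}" using f by auto
  have S: "(\<Sum>X | T.minimal X. ?g (f X)) = sum ?g (f ` {X. T.minimal X})"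
    using inj by (simp add: sum.reindex)
  show ?thesis
  proof (cases "M \<in> f ` {X. T.minimal X}")
    case True
    then obtain X where X: "T.minimal X" "M = f X" by auto
    then have "M \<subset> X" using f[OF X(1)] M'[OF X(1)] by blast
    then have "card M < card X" using finX[OF X(1)] by (rule psubset_card_mono[rotated])
    moreover have "card X < card V" using T.card_minimal_less X(1) by blast
    ultimately have "?g X < ?g (f X)" using X(2) by simp
    then have "(\<Sum>X | T.minimal X. ?g X) < (\<Sum>X | T.minimal X. ?g (f X))"
      using T.finite_minimal X(1) le by (intro sum_strict_mono_ex1) auto
    also have "\<dots> \<le> (\<Sum>M | minimal M. ?g M)"
      unfolding S using img finite_minimal by (intro sum_mono2) auto
    finally show ?thesis by (simp add: pot_eq T.pot_eq)
  next
    case False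
    have "(\<Sum>X | T.minimal X. ?g X) \<le> sum ?g (f ` {X. T.minimal X})"
      unfolding S[symmetric] using le by (intro sum_mono) auto
    also have "\<dots> < (\<Sum>M | minimal M. ?g M)"
      using finite_minimal img M(2) False card_minimal_less[OF M(2)]
      by (intro sum_strict_mono2[of _ _ M]) auto
    finally show ?thesis by (simp add: pot_eq T.pot_eq)
  qed
qed

lemma shifted_conn:
  assumes "shifted s u as as'" "safe s u" "s \<in> V"
  shows "conn V l as'"
  unfolding conn_def
proof (intro allI impI conjI)
  fix S assume S: "S \<noteq> {} \<and> S \<subset> V"
  then have d: "l \<le> dout as S" "l \<le> din as S" using le_dout le_din by auto
  have e: "dout as' S + of_bool (s \<in> S) = dout as S + of_bool (u \<in> S)"
    "din as' S + of_bool (u \<in> S) = din as S + of_bool (s \<in> S)"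
    using assms(1) by (auto simp: shifted_def)
  show "l \<le> dout as' S"
  proof (rule ccontr)
    assume "\<not> ?thesis"
    then have "ot S" "s \<in> S" "u \<notin> S" using d e S
      by (cases "s \<in> S"; cases "u \<in> S"; auto simp: otight_def)+
    then show False using assms(2) by (auto simp: safe_def)
  qed
  show "l \<le> din as' S"
  proof (rule ccontr)
    assume "\<not> ?thesis"
    then have "it S" "s \<notin> S" "u \<in> S" using d e S
      by (cases "s \<in> S"; cases "u \<in> S"; auto simp: itight_def)+
    then have "ot (V - S)" "s \<in> V - S" "u \<notin> V - S" using ot_compl assms(3) by auto
    then show False using assms(2) by (auto simp: safe_def)
  qed
qed

lemma shifted_tight_graph:
  assumes "shifted s u as as'" "conn V l as'" "set as' \<subseteq> V \<times> V"
  shows "tight_graph V as' l"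
proof
  fix S assume S: "S \<noteq> {}" "S \<subset> V"
  have "dout as' S + of_bool (s \<in> S) = dout as S + of_bool (u \<in> S)"
    "din as' S + of_bool (u \<in> S) = din as S + of_bool (s \<in> S)"
    using assms(1) by (auto simp: shifted_def)
  then show "2 * l + 2 \<le> dout as' S + din as' S" using degree[OF S] by linarith
qed (use assms finite_V in auto)

end


section \<open>Reversing paths\<close>

text \<open>Only the first copy of \<open>e\<close> is reversed, and it keeps its position, because
  positions later stand for edge names. Which of several parallel copies is taken makes no
  difference to cuts.\<close>

primrec flip1 :: "'a \<times> 'a \<Rightarrow> ('a \<times> 'a) list \<Rightarrow> ('a \<times> 'a) list" where
  "flip1 e [] = []"
| "flip1 e (x # xs) = (if x = e then prod.swap x # xs else x # flip1 e xs)"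

lemma set_flip1: "set (flip1 e as) \<subseteq> insert (prod.swap e) (set as)"
  by (induction as) auto

lemma set_flip1_other: "f \<in> set as \<Longrightarrow> f \<noteq> e \<Longrightarrow> f \<in> set (flip1 e as)"
  by (induction as) auto

lemma flip1_within: "set as \<subseteq> V \<times> V \<Longrightarrow> e \<in> V \<times> V \<Longrightarrow> set (flip1 e as) \<subseteq> V \<times> V"
  using set_flip1[of e as] by auto

lemma shifted_refl [simp]: "shifted s s as as"
  by (simp add: shifted_def)

lemma shifted_trans: "shifted s t as bs \<Longrightarrow> shifted t u bs cs \<Longrightarrow> shifted s u as cs"
  unfolding shifted_def
proof (intro allI)
  fix S
  assume "\<forall>S. dout bs S + of_bool (s \<in> S) = dout as S + of_bool (t \<in> S) \<and>
      din bs S + of_bool (t \<in> S) = din as S + of_bool (s \<in> S)"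
    "\<forall>S. dout cs S + of_bool (t \<in> S) = dout bs S + of_bool (u \<in> S) \<and>
      din cs S + of_bool (u \<in> S) = din bs S + of_bool (t \<in> S)"
  from this[THEN spec, of S] show "dout cs S + of_bool (s \<in> S) = dout as S + of_bool (u \<in> S) \<and>
      din cs S + of_bool (u \<in> S) = din as S + of_bool (s \<in> S)"
    by linarith
qed

lemma dout_flip1:
  "e \<in> set as \<Longrightarrow> dout (flip1 e as) S + of_bool (fst e \<in> S) = dout as S + of_bool (snd e \<in> S)"
  by (induction as) (auto simp: dout_Cons)

lemma din_flip1:
  "e \<in> set as \<Longrightarrow> din (flip1 e as) S + of_bool (snd e \<in> S) = din as S + of_bool (fst e \<in> S)"
  by (induction as) (auto simp: din_Cons)

lemma shifted_flip1: "e \<in> set as \<Longrightarrow> shifted (fst e) (snd e) as (flip1 e as)"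
  by (simp add: shifted_def dout_flip1 din_flip1)

primrec walk :: "'a \<Rightarrow> ('a \<times> 'a) list \<Rightarrow> 'a \<Rightarrow> bool" where
  "walk s [] t \<longleftrightarrow> s = t"
| "walk s (e # q) t \<longleftrightarrow> fst e = s \<and> walk (snd e) q t"

lemma walk_append: "walk s (p @ q) t \<longleftrightarrow> (\<exists>u. walk s p u \<and> walk u q t)"
  by (induction p arbitrary: s) auto

lemma fold_flip1_other: "f \<in> set as \<Longrightarrow> f \<notin> set q \<Longrightarrow> f \<in> set (fold flip1 q as)"
  by (induction q arbitrary: as) (auto simp: set_flip1_other)

lemma fold_flip1_within:
  "set as \<subseteq> V \<times> V \<Longrightarrow> set q \<subseteq> V \<times> V \<Longrightarrow> set (fold flip1 q as) \<subseteq> V \<times> V"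
  by (induction q arbitrary: as) (auto simp: flip1_within)

text \<open>The effects of the single flips telescope along the walk; \<open>distinct q\<close>
  guarantees that each arc is still present when its turn comes.\<close>

lemma shifted_walk:
  "walk s q t \<Longrightarrow> distinct q \<Longrightarrow> set q \<subseteq> set as \<Longrightarrow> shifted s t as (fold flip1 q as)"
proof (induction q arbitrary: s as)
  case (Cons e q)
  then have "e \<in> set as" by simp
  then have "shifted (fst e) (snd e) as (flip1 e as)" by (rule shifted_flip1)
  moreover have "set q \<subseteq> set (flip1 e as)"
    using Cons.prems set_flip1_other[of _ as e] by fastforce
  moreover from this have "shifted (snd e) t (flip1 e as) (fold flip1 q (flip1 e as))"
    using Cons.prems by (intro Cons.IH) auto
  ultimately show ?case using Cons.prems(1) shifted_trans by fastforce
qed simp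


section \<open>Searching for paths\<close>

text \<open>
  The search list pairs each vertex found so far with the reversed list of arcs leading to it.
\<close>

definition search_step ::
  "'a list \<Rightarrow> 'a \<times> 'a \<Rightarrow> ('a \<times> ('a \<times> 'a) list) list \<Rightarrow> ('a \<times> ('a \<times> 'a) list) list" where
  "search_step U e ps =
     (if snd e \<in> set U \<and> snd e \<notin> set (map fst ps)
      then (case map_of ps (fst e) of None \<Rightarrow> ps | Some q \<Rightarrow> (snd e, e # q) # ps) else ps)"

text \<open>The entries of the outer list serve only to count \<open>length U\<close> passes over
  the arcs.\<close>

definition search :: "'a list \<Rightarrow> 'a \<Rightarrow> ('a \<times> 'a) list \<Rightarrow> ('a \<times> ('a \<times> 'a) list) list" where
  "search U s as = fold (\<lambda>_. fold (search_step U) as) U [(s, [])]"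

text \<open>The strict length bound limits paths by the number of vertices found, which later bounds
  both the number of flips and the size of the search list. The start \<open>s\<close> may lie
  outside \<open>U\<close>, hence \<open>insert s (set U)\<close>.\<close>

definition search_inv ::
  "'a list \<Rightarrow> 'a \<Rightarrow> ('a \<times> 'a) list \<Rightarrow> ('a \<times> ('a \<times> 'a) list) list \<Rightarrow> bool" where
  "search_inv U s as ps \<longleftrightarrow>
     distinct (map fst ps) \<and> s \<in> fst ` set ps \<and> fst ` set ps \<subseteq> insert s (set U) \<and>
     (\<forall>v q. (v, q) \<in> set ps \<longrightarrow> walk s (rev q) v \<and> set q \<subseteq> set as \<and> distinct q \<and>
        snd ` set q \<subseteq> set U \<inter> fst ` set ps \<and> length q < length ps)"

lemma search_inv_init: "search_inv U s as [(s, [])]"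
  by (auto simp: search_inv_def)

lemma search_inv_step:
  assumes "search_inv U s as ps" "e \<in> set as"
  shows "search_inv U s as (search_step U e ps)"
proof (cases "snd e \<in> set U \<and> snd e \<notin> set (map fst ps)")
  case False
  then have "search_step U e ps = ps" by (auto simp: search_step_def)
  then show ?thesis using assms by simp
next
  case True
  show ?thesis
  proof (cases "map_of ps (fst e)")
    case None
    then show ?thesis using assms by (simp add: search_step_def)
  next
    case (Some q)
    then have "(fst e, q) \<in> set ps" by (rule map_of_SomeD)
    then have q: "walk s (rev q) (fst e)" "set q \<subseteq> set as" "distinct q"
      "snd ` set q \<subseteq> set U \<inter> fst ` set ps" "length q < length ps"
      using assms(1) by (auto simp: search_inv_def)
    have "e \<notin> set q" using q(4) True by auto
    let ?ps = "(snd e, e # q) # ps"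
    have old: "walk s (rev p) v \<and> set p \<subseteq> set as \<and> distinct p \<and>
      snd ` set p \<subseteq> set U \<inter> fst ` set ?ps \<and> length p < length ?ps" if "(v, p) \<in> set ps" for v p
    proof -
      have "walk s (rev p) v \<and> set p \<subseteq> set as \<and> distinct p \<and>
          snd ` set p \<subseteq> set U \<inter> fst ` set ps \<and> length p < length ps"
        using assms(1) that by (simp add: search_inv_def)
      then show ?thesis by auto
    qed
    have new: "walk s (rev (e # q)) (snd e) \<and> set (e # q) \<subseteq> set as \<and> distinct (e # q) \<and>
      snd ` set (e # q) \<subseteq> set U \<inter> fst ` set ?ps \<and> length (e # q) < length ?ps"
      using q assms(2) True \<open>e \<notin> set q\<close> by (auto simp: walk_append)
    have "distinct (map fst ?ps)" "s \<in> fst ` set ?ps" "fst ` set ?ps \<subseteq> insert s (set U)"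
      using assms(1) True by (auto simp: search_inv_def)
    then have "search_inv U s as ?ps"
      unfolding search_inv_def using old new by (metis (no_types, lifting) prod.inject set_ConsD)
    then show ?thesis using True Some by (simp add: search_step_def)
  qed
qed

lemma search_inv_pass:
  "search_inv U s as ps \<Longrightarrow> set bs \<subseteq> set as \<Longrightarrow> search_inv U s as (fold (search_step U) bs ps)"
  by (induction bs arbitrary: ps) (auto simp: search_inv_step)

lemma search_inv_length: "search_inv U s as ps \<Longrightarrow> length ps \<le> Suc (length U)"
proof -
  assume "search_inv U s as ps"
  then have "length ps = card (fst ` set ps)" "fst ` set ps \<subseteq> insert s (set U)"
    unfolding search_inv_def by (metis distinct_card length_map set_map, blast)
  then have "length ps \<le> card (insert s (set U))" by (simp add: card_mono)
  also have "\<dots> \<le> Suc (card (set U))" by (simp add: card_insert_if)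
  also have "\<dots> \<le> Suc (length U)" by (simp add: card_length)
  finally show ?thesis .
qed

lemma search_inv_passes:
  "search_inv U s as ps \<Longrightarrow> search_inv U s as (fold (\<lambda>_. fold (search_step U) as) xs ps)"
  by (induction xs arbitrary: ps) (auto simp: search_inv_pass)

lemma search_inv_search: "search_inv U s as (search U s as)"
  unfolding search_def by (intro search_inv_passes search_inv_init)

definition search_closed :: "'a set \<Rightarrow> ('a \<times> 'a) list \<Rightarrow> ('a \<times> 'b) list \<Rightarrow> bool" where
  "search_closed U as ps \<longleftrightarrow>
     (\<forall>e\<in>set as. fst e \<in> fst ` set ps \<longrightarrow> snd e \<in> U \<longrightarrow> snd e \<in> fst ` set ps)"

lemma search_step_cases:
  "length ps < length (search_step U e ps) \<or> search_step U e ps = ps \<and> search_closed (set U) [e] ps"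
  by (auto simp: search_step_def search_closed_def map_of_eq_None_iff split: option.splits)

lemma search_closed_Cons: "search_closed U (e # as) ps \<longleftrightarrow> search_closed U [e] ps \<and> search_closed U as ps"
  by (simp add: search_closed_def)

lemma search_closed_step: "search_closed (set U) [e] ps \<Longrightarrow> search_step U e ps = ps"
proof (cases "map_of ps (fst e)")
  case (Some q)
  assume "search_closed (set U) [e] ps"
  moreover have "fst e \<in> fst ` set ps" using map_of_SomeD[OF Some] by force
  ultimately show ?thesis by (auto simp: search_closed_def search_step_def)
qed (simp add: search_step_def)

lemma search_closed_pass: "search_closed (set U) as ps \<Longrightarrow> fold (search_step U) as ps = ps"
proof (induction as)
  case (Cons e as)
  then show ?case unfolding search_closed_Cons[of _ e as] by (simp add: search_closed_step)
qed simp

lemma search_pass_cases: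
  "length ps < length (fold (search_step U) as ps) \<or>
   fold (search_step U) as ps = ps \<and> search_closed (set U) as ps"
proof (induction as arbitrary: ps)
  case (Cons e as)
  show ?case using search_step_cases[of ps U e] Cons[of "search_step U e ps"]
    unfolding search_closed_Cons[of _ e as] by auto
qed (simp add: search_closed_def)

lemma search_passes_cases:
  "length ps + length xs \<le> length (fold (\<lambda>_. fold (search_step U) as) xs ps) \<or>
   search_closed (set U) as (fold (\<lambda>_. fold (search_step U) as) xs ps)"
proof (induction xs rule: rev_induct)
  case (snoc x xs)
  show ?case using snoc search_pass_cases[of "fold (\<lambda>_. fold (search_step U) as) xs ps" U as]
    search_closed_pass[of U as "fold (\<lambda>_. fold (search_step U) as) xs ps"] by auto
qed simp

text \<open>A pass that does not already start from a closed set finds a new vertex. If all passes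
  do, everything in \<open>insert s (set U)\<close> has been found, and that is closed too.\<close>

lemma search_closed: "search_closed (set U) as (search U s as)"
proof (rule ccontr)
  assume no: "\<not> ?thesis"
  let ?ps = "search U s as"
  have inv: "search_inv U s as ?ps" by (rule search_inv_search)
  have "Suc (length U) \<le> length ?ps"
    using search_passes_cases[of "[(s, [])]" U U as] no by (auto simp: search_def)
  moreover have "length ?ps = card (fst ` set ?ps)"
    using inv unfolding search_inv_def by (metis distinct_card length_map set_map)
  moreover have "card (insert s (set U)) \<le> Suc (length U)"
    using card_length[of U] by (simp add: card_insert_if)
  ultimately have "fst ` set ?ps = insert s (set U)"
    using inv card_seteq[of "insert s (set U)" "fst ` set ?ps"] by (simp add: search_inv_def)
  then show False using no by (auto simp: search_closed_def)
qed

lemma search_start: "s \<in> fst ` set (search U s as)"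
  using search_inv_search[of U s as] by (simp add: search_inv_def)

lemma search_walk:
  assumes "map_of (search U s as) v = Some q"
  shows "walk s (rev q) v" and "set q \<subseteq> set as" and "distinct q" and "snd ` set q \<subseteq> set U"
    and "length q \<le> length U"
proof -
  have "(v, q) \<in> set (search U s as)" using assms by (rule map_of_SomeD)
  then have "walk s (rev q) v \<and> set q \<subseteq> set as \<and> distinct q \<and> snd ` set q \<subseteq> set U \<and>
    length q < length (search U s as)"
    using search_inv_search[of U s as] unfolding search_inv_def by blast
  then show "walk s (rev q) v" "set q \<subseteq> set as" "distinct q" "snd ` set q \<subseteq> set U" "length q \<le> length U"
    using search_inv_length[OF search_inv_search[of U s as]] by simp_all
qed

lemma walk_closed: "walk s q v \<Longrightarrow> set q \<subseteq> set as \<Longrightarrow> dout as S = 0 \<Longrightarrow> s \<in> S \<Longrightarrow> v \<in> S"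
  by (induction q arbitrary: s) (auto simp: dout_0_iff)

lemma search_least:
  assumes "dout as S = 0" "s \<in> S"
  shows "fst ` set (search U s as) \<subseteq> S"
proof
  fix v assume "v \<in> fst ` set (search U s as)"
  then obtain q where "(v, q) \<in> set (search U s as)" by auto
  then have "walk s (rev q) v \<and> set (rev q) \<subseteq> set as"
    using search_inv_search[of U s as] unfolding search_inv_def set_rev by blast
  then show "v \<in> S" using walk_closed[of s "rev q" v as S] assms by simp
qed

lemma search_dout:
  assumes "set as \<subseteq> set vs \<times> set vs"
  shows "dout as (fst ` set (search vs s as)) = 0"
  unfolding dout_0_iff
proof (intro ballI impI)
  fix e assume e: "e \<in> set as" "fst e \<in> fst ` set (search vs s as)"
  have "e \<in> set vs \<times> set vs" using e(1) assms by (rule subsetD[rotated])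
  then have "snd e \<in> set vs" by (simp add: mem_Times_iff)
  then show "snd e \<in> fst ` set (search vs s as)"
    using search_closed[of vs as s] e unfolding search_closed_def by simp
qed

section \<open>Minimum cuts\<close>

text \<open>Reversing the arcs of an augmenting path turns the digraph into the residual digraph.\<close>

definition augment :: "'a list \<Rightarrow> 'a \<Rightarrow> 'a \<Rightarrow> ('a \<times> 'a) list \<Rightarrow> ('a \<times> 'a) list" where
  "augment vs u v as = (case map_of (search vs u as) v of None \<Rightarrow> as | Some q \<Rightarrow> fold flip1 (rev q) as)"

text \<open>In an \<open>l\<close>-connected digraph \<open>l\<close> augmentations are possible.
  Afterwards the cuts from \<open>u\<close> to \<open>v\<close> that had size \<open>l\<close> have
  no leaving arcs, so the set reachable from \<open>u\<close> is the smallest of them. If it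
  contains \<open>v\<close>, there is no such cut.\<close>

definition mincut :: "nat \<Rightarrow> 'a list \<Rightarrow> 'a \<Rightarrow> 'a \<Rightarrow> ('a \<times> 'a) list \<Rightarrow> 'a list" where
  "mincut l vs u v as = map fst (search vs u ((augment vs u v ^^ l) as))"

lemma augment_within:
  assumes "set as \<subseteq> V \<times> V" shows "set (augment vs u v as) \<subseteq> V \<times> V"
proof (cases "map_of (search vs u as) v")
  case (Some q)
  then have "set (rev q) \<subseteq> V \<times> V" using search_walk(2)[OF Some] assms by auto
  then show ?thesis using fold_flip1_within[OF assms, of "rev q"] Some by (simp add: augment_def)
qed (simp add: augment_def assms)

lemma residual_within: "set as \<subseteq> V \<times> V \<Longrightarrow> set ((augment vs u v ^^ i) as) \<subseteq> V \<times> V"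
  by (induction i) (simp_all add: augment_within)

text \<open>An augmentation is a shift from \<open>u\<close> to \<open>v\<close>. Were
  \<open>v\<close> unreachable after \<open>i < l\<close> rounds, the set reached would have
  out-degree \<open>i\<close> in \<open>as\<close>, against \<open>conn\<close>.\<close>

lemma residual_dout:
  assumes "conn (set vs) l as" "set as \<subseteq> set vs \<times> set vs" "u \<in> set vs" "v \<in> set vs"
    and "i \<le> l" "u \<in> S" "v \<notin> S"
  shows "dout ((augment vs u v ^^ i) as) S + i = dout as S"
  using assms(5-7)
proof (induction i arbitrary: S)
  case (Suc i)
  let ?as = "(augment vs u v ^^ i) as"
  have IH: "dout ?as T + i = dout as T" if "u \<in> T" "v \<notin> T" for T using Suc that by simp
  have w: "set ?as \<subseteq> set vs \<times> set vs" using assms(2) by (rule residual_within)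
  obtain q where q: "map_of (search vs u ?as) v = Some q"
  proof (cases "map_of (search vs u ?as) v")
    case None
    define R where "R = fst ` set (search vs u ?as)"
    have R: "u \<in> R" "v \<notin> R" using None search_start[of u vs ?as] by (simp_all add: R_def map_of_eq_None_iff)
    have "R \<subseteq> insert u (set vs)" using search_inv_search[of vs u ?as] by (simp add: search_inv_def R_def)
    then have "R \<noteq> {} \<and> R \<subset> set vs" using assms(3,4) R by blast
    then have "l \<le> dout as R" using assms(1) by (simp add: conn_def)
    moreover have "dout as R = i" using IH[OF R] search_dout[OF w, of u] by (simp add: R_def)
    ultimately show ?thesis using Suc by simp
  qed
  have "shifted u v ?as (augment vs u v ?as)"
    using shifted_walk[of u "rev q" v ?as] search_walk[OF q] q by (simp add: augment_def)
  then have "dout (augment vs u v ?as) S + of_bool (u \<in> S) = dout ?as S + of_bool (v \<in> S)"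
    by (simp add: shifted_def)
  then have "dout (augment vs u v ?as) S + 1 = dout ?as S"
    using Suc.prems by simp
  then show ?case using IH[of S] Suc.prems by simp
qed simp

lemma mincut_mem: "u \<in> set (mincut l vs u v as)"
  using search_start[of u] by (simp add: mincut_def)

lemma mincut_otight:
  assumes "conn (set vs) l as" "set as \<subseteq> set vs \<times> set vs" "u \<in> set vs" "v \<in> set vs"
    and "v \<notin> set (mincut l vs u v as)"
  shows "otight (set vs) l as (set (mincut l vs u v as))"
proof -
  let ?as = "(augment vs u v ^^ l) as" and ?R = "set (mincut l vs u v as)"
  have R: "?R = fst ` set (search vs u ?as)" by (simp add: mincut_def)
  have "?R \<subseteq> insert u (set vs)" using search_inv_search[of vs u ?as] by (simp add: search_inv_def R)
  then have "?R \<subseteq> set vs" using assms(3) by (simp add: insert_absorb)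
  moreover have "?R \<noteq> set vs" using assms(4,5) by metis
  moreover have "?R \<noteq> {}" using mincut_mem by (metis empty_iff)
  ultimately have sub: "?R \<subset> set vs" "?R \<noteq> {}" by simp_all
  have "dout ?as ?R = 0" unfolding R by (rule search_dout[OF residual_within[OF assms(2)]])
  then have "dout as ?R = l"
    using residual_dout[OF assms(1-4) order_refl mincut_mem assms(5)] by simp
  with sub show ?thesis by (simp add: otight_def)
qed

lemma mincut_least:
  assumes "conn (set vs) l as" "set as \<subseteq> set vs \<times> set vs" "u \<in> set vs" "v \<in> set vs"
    and "otight (set vs) l as S" "u \<in> S" "v \<notin> S"
  shows "set (mincut l vs u v as) \<subseteq> S"
proof -
  have "dout ((augment vs u v ^^ l) as) S = 0"
    using residual_dout[OF assms(1-4) order_refl assms(6,7)] assms(5) by (simp add: otight_def)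
  then show ?thesis using search_least assms(6) by (simp add: mincut_def)
qed

text \<open>One least out-tight set per pair of vertices: quadratically many sets, with at least one
  of them inside every out-tight set.\<close>

definition cuts :: "nat \<Rightarrow> 'a list \<Rightarrow> ('a \<times> 'a) list \<Rightarrow> 'a list list" where
  "cuts l vs as = concat (map (\<lambda>u. concat (map (\<lambda>v.
     if v \<in> set (mincut l vs u v as) then [] else [mincut l vs u v as]) vs)) vs)"

definition tight_list :: "nat \<Rightarrow> 'a list \<Rightarrow> ('a \<times> 'a) list \<Rightarrow> 'a list list" where
  "tight_list l vs as = cuts l vs as @ cuts l vs (map prod.swap as)"

lemma cuts_otight:
  assumes "conn (set vs) l as" "set as \<subseteq> set vs \<times> set vs" "X \<in> set (cuts l vs as)"
  shows "otight (set vs) l as (set X)"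
  using assms mincut_otight[OF assms(1,2)] by (auto simp: cuts_def split: if_splits)

lemma cuts_least:
  assumes "conn (set vs) l as" "set as \<subseteq> set vs \<times> set vs" "otight (set vs) l as S"
  shows "\<exists>X\<in>set (cuts l vs as). set X \<subseteq> S"
proof -
  obtain u v where uv: "u \<in> set vs" "v \<in> set vs" "u \<in> S" "v \<notin> S"
    using assms(3) by (auto simp: otight_def)
  then have sub: "set (mincut l vs u v as) \<subseteq> S" using mincut_least assms by metis
  then have "mincut l vs u v as \<in> set (cuts l vs as)" using uv by (fastforce simp: cuts_def)
  then show ?thesis using sub by blast
qed

lemma tight_list_tight:
  assumes "conn (set vs) l as" "set as \<subseteq> set vs \<times> set vs" "X \<in> set (tight_list l vs as)"
  shows "tight (set vs) l as (set X)"
proof -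
  have "set (map prod.swap as) \<subseteq> set vs \<times> set vs" using assms(2) by auto
  then show ?thesis
    using assms(1,3) cuts_otight[OF assms(1,2)] cuts_otight[of vs l "map prod.swap as" X]
    by (auto simp: tight_list_def tight_def)
qed

lemma tight_list_least:
  assumes "conn (set vs) l as" "set as \<subseteq> set vs \<times> set vs" "tight (set vs) l as S"
  shows "\<exists>X\<in>set (tight_list l vs as). set X \<subseteq> S"
proof (cases "otight (set vs) l as S")
  case True
  then show ?thesis using cuts_least[OF assms(1,2)] by (auto simp: tight_list_def)
next
  case False
  have "set (map prod.swap as) \<subseteq> set vs \<times> set vs" using assms(2) by auto
  then show ?thesis using False cuts_least[of vs l "map prod.swap as" S] assms(1,3)
    by (auto simp: tight_list_def tight_def)
qed

lemma tight_list_Nil_iff: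
  assumes "conn (set vs) l as" "set as \<subseteq> set vs \<times> set vs"
  shows "tight_list l vs as = [] \<longleftrightarrow> conn (set vs) (Suc l) as"
  unfolding conn_Suc_iff[OF assms(1)]
  using tight_list_tight[OF assms] tight_list_least[OF assms]
  by (metis empty_iff empty_set list.set_intros(1) neq_Nil_conv)

definition better_list :: "'a list list \<Rightarrow> 'a list list \<Rightarrow> bool" where
  "better_list L L' \<longleftrightarrow>
     list_all (\<lambda>X. list_ex (\<lambda>Y. set Y \<subseteq> set X) L) L' \<and>
     list_ex (\<lambda>Y. list_all (\<lambda>X. \<not> set X \<subseteq> set Y) L') L"

text \<open>\<open>better\<close> speaks only of inclusions between tight sets. The listed sets are
  tight and every tight set contains a listed one, so the lists can replace the families.\<close>

lemma better_list_iff: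
  assumes "conn (set vs) l as" "set as \<subseteq> set vs \<times> set vs"
    and "conn (set vs) l as'" "set as' \<subseteq> set vs \<times> set vs"
  shows "better_list (tight_list l vs as) (tight_list l vs as') \<longleftrightarrow> better (set vs) l as as'"
proof
  assume "better_list (tight_list l vs as) (tight_list l vs as')"
  then have b: "\<And>X. X \<in> set (tight_list l vs as') \<Longrightarrow> \<exists>Y\<in>set (tight_list l vs as). set Y \<subseteq> set X"
    "\<exists>Y\<in>set (tight_list l vs as). \<forall>X\<in>set (tight_list l vs as'). \<not> set X \<subseteq> set Y"
    by (auto simp: better_list_def list_all_iff list_ex_iff)
  show "better (set vs) l as as'"
    unfolding better_def
    using b tight_list_tight[OF assms(1,2)] tight_list_least[OF assms(3,4)]
    by (meson order.trans)
next
  assume b: "better (set vs) l as as'"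
  have "\<exists>Y\<in>set (tight_list l vs as). set Y \<subseteq> set X" if "X \<in> set (tight_list l vs as')" for X
    using b tight_list_tight[OF assms(3,4) that] tight_list_least[OF assms(1,2)]
    unfolding better_def by (meson order.trans)
  moreover have "\<exists>Y\<in>set (tight_list l vs as). \<forall>X\<in>set (tight_list l vs as'). \<not> set X \<subseteq> set Y"
    using b tight_list_tight[OF assms(3,4)] tight_list_least[OF assms(1,2)]
    unfolding better_def by (meson order.trans)
  ultimately show "better_list (tight_list l vs as) (tight_list l vs as')"
    by (auto simp: better_list_def list_all_iff list_ex_iff)
qed

text \<open>The minimum cut from \<open>s\<close> to \<open>v\<close> reaches \<open>v\<close>
  exactly when no out-tight set contains \<open>s\<close> but not \<open>v\<close>.\<close>

definition safe_list :: "nat \<Rightarrow> 'a list \<Rightarrow> 'a \<Rightarrow> ('a \<times> 'a) list \<Rightarrow> 'a list" where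
  "safe_list l vs s as = filter (\<lambda>v. v \<in> set (mincut l vs s v as)) vs"

lemma safe_list_iff:
  assumes "tight_graph (set vs) as l" "s \<in> set vs" "v \<in> set vs"
  shows "v \<in> set (safe_list l vs s as) \<longleftrightarrow> tight_graph.safe (set vs) as l s v"
proof -
  interpret tight_graph "set vs" as l by fact
  show ?thesis
    using mincut_otight[OF conn arcs_V assms(2,3)] mincut_least[OF conn arcs_V assms(2,3)] mincut_mem[of s l vs v as] assms(3)
    unfolding safe_list_def safe_def by auto
qed

section \<open>The algorithm\<close>

text \<open>An unreachable \<open>t\<close> yields the empty path; for it the test in
  \<open>attempt\<close> fails, because every listed set contains itself.\<close>

definition path_to :: "nat \<Rightarrow> 'a list \<Rightarrow> 'a \<Rightarrow> 'a \<Rightarrow> ('a \<times> 'a) list \<Rightarrow> ('a \<times> 'a) list" where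
  "path_to l vs s t as = (case map_of (search (safe_list l vs s as) s as) t of None \<Rightarrow> [] | Some q \<Rightarrow> rev q)"

text \<open>The second component of a state is the list of all arc lists after the first, latest first.\<close>

type_synonym 'a run_state = "('a \<times> 'a) list \<times> ('a \<times> 'a) list list"

text \<open>Once no tight set is left, the rest of the path is skipped: the connectivity has reached
  \<open>l + 1\<close>, and another flip might bring it back to \<open>l\<close>.\<close>

definition push :: "nat \<Rightarrow> 'a list \<Rightarrow> 'a \<times> 'a \<Rightarrow> 'a run_state \<Rightarrow> 'a run_state" where
  "push l vs e \<sigma> =
     (if tight_list l vs (fst \<sigma>) = [] then \<sigma> else (flip1 e (fst \<sigma>), flip1 e (fst \<sigma>) # snd \<sigma>))"

definition attempt :: "nat \<Rightarrow> 'a list \<Rightarrow> 'a \<Rightarrow> 'a \<Rightarrow> 'a run_state \<Rightarrow> 'a run_state" where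
  "attempt l vs s t \<sigma> =
     (if better_list (tight_list l vs (fst \<sigma>))
          (tight_list l vs (fold flip1 (path_to l vs s t (fst \<sigma>)) (fst \<sigma>)))
      then fold (push l vs) (path_to l vs s t (fst \<sigma>)) \<sigma> else \<sigma>)"

definition sweep :: "nat \<Rightarrow> 'a list \<Rightarrow> 'a run_state \<Rightarrow> 'a run_state" where
  "sweep l vs \<sigma> = fold (\<lambda>s. fold (\<lambda>t. attempt l vs s t) vs) vs \<sigma>"

text \<open>The two folds merely count \<open>n * n\<close> sweeps, as many as the potential can
  require.\<close>

definition raise_level :: "nat \<Rightarrow> 'a list \<Rightarrow> 'a run_state \<Rightarrow> 'a run_state" where
  "raise_level l vs \<sigma> = fold (\<lambda>_. fold (\<lambda>_. sweep l vs) vs) vs \<sigma>"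

definition run :: "nat \<Rightarrow> 'a list \<Rightarrow> ('a \<times> 'a) list \<Rightarrow> ('a \<times> 'a) list list" where
  "run k vs as = rev (snd (fold (\<lambda>l. raise_level l vs) [0..<k] (as, [])))"

text \<open>The number \<open>l\<close> is the exact connectivity before the flip. Being below
  \<open>k\<close>, it also ensures that a single flip cannot lead beyond \<open>k\<close>.\<close>

definition good_flip :: "'a set \<Rightarrow> nat \<Rightarrow> ('a \<times> 'a) list \<Rightarrow> ('a \<times> 'a) list \<Rightarrow> bool" where
  "good_flip V k as as' \<longleftrightarrow> (\<exists>e\<in>set as. as' = flip1 e as) \<and>
     (\<exists>l<k. conn V l as \<and> \<not> conn V (Suc l) as \<and> conn V l as')"

lemma fold_product:
  "fold (\<lambda>x. fold (f x) ys) xs a = fold (\<lambda>p. f (fst p) (snd p)) (List.product xs ys) a"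
  by (induction xs arbitrary: a) (simp_all add: fold_map comp_def)

lemma fold_const: "fold (\<lambda>_. f) xs = f ^^ length xs"
  by (induction xs) (simp_all add: funpow_swap1 fun_eq_iff)

section \<open>Correctness of the algorithm and the number of flips\<close>

locale run_graph =
  fixes vs :: "'a list" and k :: nat and as0 :: "('a \<times> 'a) list"
  assumes distinct: "distinct vs"
    and arcs0: "set as0 \<subseteq> set vs \<times> set vs"
    and degree0: "S \<noteq> {} \<Longrightarrow> S \<subset> set vs \<Longrightarrow> 2 * k \<le> dout as0 S + din as0 S"
begin

text \<open>The history is stored latest first, hence the reversed order in
  \<open>good_flip\<close>. Flips preserve the sum of the two degrees of each set, which carries the
  bound \<open>2 * k\<close> to all later states.\<close>

definition ok :: "nat \<Rightarrow> 'a run_state \<Rightarrow> bool" where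
  "ok l \<sigma> \<longleftrightarrow> conn (set vs) l (fst \<sigma>) \<and> set (fst \<sigma>) \<subseteq> set vs \<times> set vs \<and>
     (\<forall>S. dout (fst \<sigma>) S + din (fst \<sigma>) S = dout as0 S + din as0 S) \<and>
     successively (\<lambda>as' as. good_flip (set vs) k as as') (snd \<sigma> @ [as0]) \<and>
     hd (snd \<sigma> @ [as0]) = fst \<sigma>"

lemma ok_tight_graph:
  assumes "ok l \<sigma>" "l < k" shows "tight_graph (set vs) (fst \<sigma>) l"
proof
  fix S assume "S \<noteq> {}" "S \<subset> set vs"
  then have "2 * k \<le> dout as0 S + din as0 S" by (rule degree0)
  moreover have "dout (fst \<sigma>) S + din (fst \<sigma>) S = dout as0 S + din as0 S"
    using assms(1) by (simp add: ok_def)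
  ultimately show "2 * l + 2 \<le> dout (fst \<sigma>) S + din (fst \<sigma>) S" using assms(2) by linarith
qed (use assms in \<open>auto simp: ok_def\<close>)

lemma push_ok:
  assumes ok: "ok l \<sigma>" and "l < k" and e: "e \<in> set (fst \<sigma>)" and c: "conn (set vs) l (flip1 e (fst \<sigma>))"
  shows "ok l (push l vs e \<sigma>)"
proof (cases "tight_list l vs (fst \<sigma>) = []")
  case True
  then show ?thesis using ok by (simp add: push_def)
next
  case False
  let ?as = "fst \<sigma>"
  have w: "conn (set vs) l ?as" "set ?as \<subseteq> set vs \<times> set vs" using ok by (simp_all add: ok_def)
  have "\<not> conn (set vs) (Suc l) ?as" using False tight_list_Nil_iff[OF w] by simp
  then have g: "good_flip (set vs) k ?as (flip1 e ?as)"
    using w(1) c e \<open>l < k\<close> unfolding good_flip_def by blast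
  have sh: "dout (flip1 e ?as) S + din (flip1 e ?as) S = dout ?as S + din ?as S" for S
    using dout_flip1[OF e, of S] din_flip1[OF e, of S] by linarith
  have "set (flip1 e ?as) \<subseteq> set vs \<times> set vs" using w(2) e flip1_within by blast
  moreover have "successively (\<lambda>as' as. good_flip (set vs) k as as') ((flip1 e ?as # snd \<sigma>) @ [as0])"
    using ok g by (cases "snd \<sigma>") (simp_all add: ok_def)
  ultimately show ?thesis using ok False c sh by (simp add: push_def ok_def)
qed

text \<open>Safety is judged in the digraph before the path, and this suffices: the state after a
  prefix is one shift from \<open>s\<close> to the end of that prefix, which is a safe
  vertex.\<close>

lemma push_path:
  assumes ok: "ok l \<sigma>" and l: "l < k" and s: "s \<in> set vs"
    and q: "walk s q t" "distinct q" "set q \<subseteq> set (fst \<sigma>)"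
    and safe: "\<And>e. e \<in> set q \<Longrightarrow> tight_graph.safe (set vs) (fst \<sigma>) l s (snd e)"
  shows "ok l (fold (push l vs) q \<sigma>) \<and> length (snd (fold (push l vs) q \<sigma>)) \<le> length (snd \<sigma>) + length q \<and>
    (tight_list l vs (fst (fold (push l vs) q \<sigma>)) = [] \<or>
     fst (fold (push l vs) q \<sigma>) = fold flip1 q (fst \<sigma>))"
  using q safe
proof (induction q arbitrary: t rule: rev_induct)
  case Nil
  then show ?case using ok by simp
next
  case (snoc e q)
  interpret tight_graph "set vs" "fst \<sigma>" l using ok l by (rule ok_tight_graph)
  obtain u where u: "walk s q u" "walk u [e] t" using snoc.prems(1) by (auto simp: walk_append)
  let ?\<sigma> = "fold (push l vs) q \<sigma>"
  have IH: "ok l ?\<sigma>" "length (snd ?\<sigma>) \<le> length (snd \<sigma>) + length q"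
    "tight_list l vs (fst ?\<sigma>) = [] \<or> fst ?\<sigma> = fold flip1 q (fst \<sigma>)"
    using snoc.IH[OF u(1)] snoc.prems by simp_all
  show ?case
  proof (cases "tight_list l vs (fst ?\<sigma>) = []")
    case True
    then have "push l vs e ?\<sigma> = ?\<sigma>" by (simp add: push_def)
    then show ?thesis using IH True by simp
  next
    case False
    then have eq: "fst ?\<sigma> = fold flip1 q (fst \<sigma>)" using IH(3) by simp
    have e: "e \<in> set (fst ?\<sigma>)"
      unfolding eq using snoc.prems(2,3) by (intro fold_flip1_other) auto
    have "shifted s t (fst \<sigma>) (fold flip1 (q @ [e]) (fst \<sigma>))"
      using snoc.prems(1-3) by (rule shifted_walk)
    moreover have "safe s t" using snoc.prems(4)[of e] u(2) by simp
    ultimately have "conn (set vs) l (flip1 e (fst ?\<sigma>))"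
      using shifted_conn[of s t _] s unfolding eq by simp
    then have "ok l (push l vs e ?\<sigma>)" using IH(1) l e by (intro push_ok)
    moreover have "push l vs e ?\<sigma> = (flip1 e (fst ?\<sigma>), flip1 e (fst ?\<sigma>) # snd ?\<sigma>)"
      using False by (simp add: push_def)
    ultimately show ?thesis using IH(2) eq by simp
  qed
qed

lemma path_to_walk:
  fixes t
  assumes ok: "ok l \<sigma>" and l: "l < k" and s: "s \<in> set vs"
  defines "q \<equiv> path_to l vs s t (fst \<sigma>)"
  shows "distinct q" "set q \<subseteq> set (fst \<sigma>)" "length q \<le> length vs"
    "\<And>e. e \<in> set q \<Longrightarrow> tight_graph.safe (set vs) (fst \<sigma>) l s (snd e)"
    "\<exists>u. walk s q u \<and> tight_graph.safe (set vs) (fst \<sigma>) l s u"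
proof -
  interpret tight_graph "set vs" "fst \<sigma>" l using ok l by (rule ok_tight_graph)
  let ?U = "safe_list l vs s (fst \<sigma>)"
  have U: "safe s v" if "v \<in> set ?U" for v
  proof -
    have "v \<in> set vs" using that by (simp add: safe_list_def)
    then show ?thesis using safe_list_iff[OF tight_graph_axioms s] that by simp
  qed
  have "distinct q \<and> set q \<subseteq> set (fst \<sigma>) \<and> length q \<le> length vs \<and> snd ` set q \<subseteq> set ?U \<and> (\<exists>u. walk s q u)"
  proof (cases "map_of (search ?U s (fst \<sigma>)) t")
    case None
    then show ?thesis by (simp add: q_def path_to_def)
  next
    case (Some p)
    have "length ?U \<le> length vs" by (simp add: safe_list_def)
    then have "length p \<le> length vs" using search_walk(5)[OF Some] by linarith
    moreover have "q = rev p" using Some by (simp add: q_def path_to_def)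
    ultimately show ?thesis using search_walk(1-4)[OF Some] by auto
  qed
  then obtain u where q: "distinct q" "set q \<subseteq> set (fst \<sigma>)" "length q \<le> length vs"
    "snd ` set q \<subseteq> set ?U" "walk s q u" by blast
  show "distinct q" "set q \<subseteq> set (fst \<sigma>)" "length q \<le> length vs" by (fact q)+
  show safe_q: "safe s (snd e)" if "e \<in> set q" for e using q(4) U that by auto
  have "safe s u"
  proof (cases q rule: rev_cases)
    case Nil
    then show ?thesis using q(5) by (simp add: safe_def)
  next
    case (snoc p e)
    then have "u = snd e" using q(5) by (auto simp: walk_append)
    then show ?thesis using safe_q snoc by simp
  qed
  then show "\<exists>u. walk s q u \<and> safe s u" using q(5) by blast
qed

text \<open>The last conjunct is an amortised count: a success costs at most
  \<open>length vs\<close> flips and lowers the potential by at least one.\<close>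

definition descends :: "nat \<Rightarrow> 'a run_state \<Rightarrow> 'a run_state \<Rightarrow> bool" where
  "descends l \<sigma> \<sigma>' \<longleftrightarrow> ok l \<sigma>' \<and>
     (\<sigma>' = \<sigma> \<or> pot (set vs) l (fst \<sigma>') < pot (set vs) l (fst \<sigma>)) \<and>
     length (snd \<sigma>') + length vs * pot (set vs) l (fst \<sigma>') \<le>
     length (snd \<sigma>) + length vs * pot (set vs) l (fst \<sigma>)"

lemma descends_refl: "ok l \<sigma> \<Longrightarrow> descends l \<sigma> \<sigma>"
  by (simp add: descends_def)

lemma descends_trans: "descends l \<sigma> \<sigma>' \<Longrightarrow> descends l \<sigma>' \<sigma>'' \<Longrightarrow> descends l \<sigma> \<sigma>''"
  unfolding descends_def by (elim conjE disjE; simp)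

lemma descends_ok: "descends l \<sigma> \<sigma>' \<Longrightarrow> ok l \<sigma>'"
  by (simp add: descends_def)

lemma descends_pot_le: "descends l \<sigma> \<sigma>' \<Longrightarrow> pot (set vs) l (fst \<sigma>') \<le> pot (set vs) l (fst \<sigma>)"
  by (auto simp: descends_def)

text \<open>A completed path decreases the potential by \<open>pot_better\<close>. If it was cut
  short, no tight set is left and the potential is zero, whereas \<open>better\<close> presupposes
  an old tight set.\<close>

lemma attempt_better:
  assumes ok: "ok l \<sigma>" and l: "l < k" and s: "s \<in> set vs"
    and b: "better_list (tight_list l vs (fst \<sigma>))
          (tight_list l vs (fold flip1 (path_to l vs s t (fst \<sigma>)) (fst \<sigma>)))"
  shows "descends l \<sigma> (attempt l vs s t \<sigma>)"
    "pot (set vs) l (fst (attempt l vs s t \<sigma>)) < pot (set vs) l (fst \<sigma>)"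
proof -
  interpret tight_graph "set vs" "fst \<sigma>" l using ok l by (rule ok_tight_graph)
  define q where "q = path_to l vs s t (fst \<sigma>)"
  note q = path_to_walk[OF ok l s, where t = t, folded q_def]
  obtain u where u: "walk s q u" "safe s u" using q(5) by blast
  let ?as' = "fold flip1 q (fst \<sigma>)" and ?\<sigma>' = "attempt l vs s t \<sigma>"
  have \<sigma>': "?\<sigma>' = fold (push l vs) q \<sigma>" using b by (simp add: attempt_def q_def)
  have sh: "shifted s u (fst \<sigma>) ?as'" using u(1) q(1,2) by (rule shifted_walk)
  have c: "conn (set vs) l ?as'" using sh u(2) s by (rule shifted_conn)
  have w: "set ?as' \<subseteq> set vs \<times> set vs" using q(2) arcs_V by (intro fold_flip1_within) auto
  have bet: "better (set vs) l (fst \<sigma>) ?as'"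
    using b better_list_iff[OF conn arcs_V c w] by (simp add: q_def)
  have p: "ok l ?\<sigma>'" "length (snd ?\<sigma>') \<le> length (snd \<sigma>) + length q"
    "tight_list l vs (fst ?\<sigma>') = [] \<or> fst ?\<sigma>' = ?as'"
    using push_path[OF ok l s u(1) q(1,2,4)] unfolding \<sigma>' by simp_all
  show less: "pot (set vs) l (fst ?\<sigma>') < pot (set vs) l (fst \<sigma>)"
  proof (cases "tight_list l vs (fst ?\<sigma>') = []")
    case True
    have "conn (set vs) l (fst ?\<sigma>')" "set (fst ?\<sigma>') \<subseteq> set vs \<times> set vs" using p(1) by (simp_all add: ok_def)
    then have "\<not> tight (set vs) l (fst ?\<sigma>') X" for X
      using True tight_list_Nil_iff conn_Suc_iff by blast
    then have "pot (set vs) l (fst ?\<sigma>') = 0" by (simp add: pot_def)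
    moreover obtain X where "tight (set vs) l (fst \<sigma>) X" using bet by (auto simp: better_def)
    ultimately show ?thesis using pot_pos by simp
  next
    case False
    then have "fst ?\<sigma>' = ?as'" using p(3) by simp
    then show ?thesis using pot_better[OF shifted_tight_graph[OF sh c w] bet] by simp
  qed
  have "length vs * pot (set vs) l (fst ?\<sigma>') + length vs \<le> length vs * pot (set vs) l (fst \<sigma>)"
    using mult_le_mono2[OF Suc_leI[OF less], of "length vs"] by simp
  then have "length (snd ?\<sigma>') + length vs * pot (set vs) l (fst ?\<sigma>') \<le>
     length (snd \<sigma>) + length vs * pot (set vs) l (fst \<sigma>)"
    using p(2) q(3) by linarith
  then show "descends l \<sigma> ?\<sigma>'" using p(1) less by (simp add: descends_def)
qed

lemma attempt_descends:
  "ok l \<sigma> \<Longrightarrow> l < k \<Longrightarrow> s \<in> set vs \<Longrightarrow> descends l \<sigma> (attempt l vs s t \<sigma>)"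
  using attempt_better(1) descends_refl by (metis attempt_def)

lemma ex_attempt:
  assumes ok: "ok l \<sigma>" and l: "l < k" and pos: "0 < pot (set vs) l (fst \<sigma>)"
  obtains s t where "s \<in> set vs" "t \<in> set vs"
    "pot (set vs) l (fst (attempt l vs s t \<sigma>)) < pot (set vs) l (fst \<sigma>)"
proof -
  interpret tight_graph "set vs" "fst \<sigma>" l using ok l by (rule ok_tight_graph)
  have "\<exists>X. ti X"
  proof (rule ccontr)
    assume "\<nexists>X. ti X"
    then show False using pos by (simp add: pot_def)
  qed
  then obtain X where "ti X" by blast
  then obtain s t where st: "s \<in> set vs" "t \<in> set vs"
    "\<And>as'. shifted s t (fst \<sigma>) as' \<Longrightarrow> better (set vs) l (fst \<sigma>) as'"
    "\<And>H. s \<in> H \<Longrightarrow> (\<And>e. e \<in> set (fst \<sigma>) \<Longrightarrow> fst e \<in> H \<Longrightarrow> safe s (snd e) \<Longrightarrow> snd e \<in> H) \<Longrightarrow> t \<in> H"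
    using good_pair by blast
  let ?U = "safe_list l vs s (fst \<sigma>)"
  let ?ps = "search ?U s (fst \<sigma>)"
  \<comment> \<open>The vertices found by the search are closed under arcs into safe vertices, so
    they can be put for \<open>H\<close> in \<open>good_pair\<close>.\<close>
  have "t \<in> fst ` set ?ps"
  proof (rule st(4))
    show "s \<in> fst ` set ?ps" by (rule search_start)
    fix e assume e: "e \<in> set (fst \<sigma>)" "fst e \<in> fst ` set ?ps" "safe s (snd e)"
    have "snd e \<in> set vs" using subsetD[OF arcs_V e(1)] by (simp add: mem_Times_iff)
    then have "snd e \<in> set ?U" using safe_list_iff[OF tight_graph_axioms st(1)] e(3) by simp
    then show "snd e \<in> fst ` set ?ps"
      using search_closed[of ?U "fst \<sigma>" s] e(1,2) by (simp add: search_closed_def)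
  qed
  then obtain q where q: "map_of ?ps t = Some q"
    by (metis map_of_eq_None_iff not_None_eq)
  have sh: "shifted s t (fst \<sigma>) (fold flip1 (rev q) (fst \<sigma>))"
    using search_walk(1-3)[OF q] by (intro shifted_walk) simp_all
  have p: "path_to l vs s t (fst \<sigma>) = rev q" using q by (simp add: path_to_def)
  obtain u where u: "walk s (rev q) u" "safe s u" using path_to_walk(5)[OF ok l st(1), where t = t] p by auto
  have sh': "shifted s u (fst \<sigma>) (fold flip1 (rev q) (fst \<sigma>))"
    using search_walk(2,3)[OF q] u(1) by (intro shifted_walk) simp_all
  have c: "conn (set vs) l (fold flip1 (rev q) (fst \<sigma>))" using sh' u(2) st(1) by (rule shifted_conn)
  have w: "set (fold flip1 (rev q) (fst \<sigma>)) \<subseteq> set vs \<times> set vs"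
    using search_walk(2)[OF q] arcs_V by (intro fold_flip1_within) auto
  have "better_list (tight_list l vs (fst \<sigma>))
          (tight_list l vs (fold flip1 (path_to l vs s t (fst \<sigma>)) (fst \<sigma>)))"
    unfolding p better_list_iff[OF conn arcs_V c w] using st(3) sh by blast
  then show ?thesis using attempt_better(2)[OF ok l st(1)] st(1,2) that by blast
qed

lemma fold_descends:
  assumes "ok l \<sigma>" "\<And>x \<sigma>. x \<in> set xs \<Longrightarrow> ok l \<sigma> \<Longrightarrow> descends l \<sigma> (f x \<sigma>)"
  shows "descends l \<sigma> (fold f xs \<sigma>)"
  using assms
proof (induction xs arbitrary: \<sigma>)
  case (Cons x xs)
  have d: "descends l \<sigma> (f x \<sigma>)" using Cons.prems by simp
  have "descends l (f x \<sigma>) (fold f xs (f x \<sigma>))"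
    using Cons.prems(2) descends_ok[OF d] by (intro Cons.IH) simp_all
  then show ?case using descends_trans[OF d] by simp
qed (simp add: descends_refl)

text \<open>A successful pair is known only for the state at the start of the sweep. Either that
  state is still unchanged when the pair is tried, or an earlier attempt has changed it and thereby
  lowered the potential.\<close>

lemma sweep_descends:
  assumes ok: "ok l \<sigma>" and l: "l < k"
  shows "descends l \<sigma> (sweep l vs \<sigma>)"
    "0 < pot (set vs) l (fst \<sigma>) \<Longrightarrow> pot (set vs) l (fst (sweep l vs \<sigma>)) < pot (set vs) l (fst \<sigma>)"
proof -
  let ?f = "\<lambda>p. attempt l vs (fst p) (snd p)"
  have sw: "sweep l vs \<sigma> = fold ?f (List.product vs vs) \<sigma>"
    unfolding sweep_def by (rule fold_product)
  have f: "descends l \<tau> (?f p \<tau>)" if "p \<in> set (List.product vs vs)" "ok l \<tau>" for p \<tau>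
    using attempt_descends[OF that(2) l] that(1) by auto
  show "descends l \<sigma> (sweep l vs \<sigma>)" unfolding sw using ok f by (rule fold_descends)
  assume pos: "0 < pot (set vs) l (fst \<sigma>)"
  obtain s t where st: "s \<in> set vs" "t \<in> set vs"
    "pot (set vs) l (fst (attempt l vs s t \<sigma>)) < pot (set vs) l (fst \<sigma>)"
    using ex_attempt[OF ok l pos] .
  then have "(s, t) \<in> set (List.product vs vs)" by simp
  then obtain us ws where split: "List.product vs vs = us @ (s, t) # ws" by (meson split_list)
  let ?\<sigma>1 = "fold ?f us \<sigma>"
  have d1: "descends l \<sigma> ?\<sigma>1" using ok f by (rule fold_descends) (simp_all add: split)
  have "(s, t) \<in> set (List.product vs vs)" by (simp add: split)
  then have d2: "descends l ?\<sigma>1 (?f (s, t) ?\<sigma>1)" using f descends_ok[OF d1] by blast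
  have less: "pot (set vs) l (fst (?f (s, t) ?\<sigma>1)) < pot (set vs) l (fst \<sigma>)"
  proof (cases "?\<sigma>1 = \<sigma>")
    case True
    then show ?thesis using st(3) by simp
  next
    case False
    then have "pot (set vs) l (fst ?\<sigma>1) < pot (set vs) l (fst \<sigma>)" using d1 by (simp add: descends_def)
    then show ?thesis using descends_pot_le[OF d2] by linarith
  qed
  have "descends l (?f (s, t) ?\<sigma>1) (fold ?f ws (?f (s, t) ?\<sigma>1))"
    using descends_ok[OF d2] f by (rule fold_descends) (simp_all add: split)
  from descends_pot_le[OF this] less
  show "pot (set vs) l (fst (sweep l vs \<sigma>)) < pot (set vs) l (fst \<sigma>)"
    unfolding sw split by simp
qed

lemma sweeps_descend:
  assumes ok: "ok l \<sigma>" and l: "l < k"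
  shows "descends l \<sigma> ((sweep l vs ^^ i) \<sigma>) \<and>
    (pot (set vs) l (fst ((sweep l vs ^^ i) \<sigma>)) = 0 \<or>
     pot (set vs) l (fst ((sweep l vs ^^ i) \<sigma>)) + i \<le> pot (set vs) l (fst \<sigma>))"
proof (induction i)
  case 0
  then show ?case using ok by (simp add: descends_refl)
next
  case (Suc i)
  let ?\<tau> = "(sweep l vs ^^ i) \<sigma>"
  have d: "descends l \<sigma> ?\<tau>" using Suc.IH by simp
  note sw = sweep_descends[OF descends_ok[OF d] l]
  have "pot (set vs) l (fst (sweep l vs ?\<tau>)) = 0 \<or>
     pot (set vs) l (fst (sweep l vs ?\<tau>)) + Suc i \<le> pot (set vs) l (fst \<sigma>)"
    using Suc.IH sw(2) descends_pot_le[OF sw(1)] by (cases "pot (set vs) l (fst ?\<tau>) = 0") auto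
  then show ?case using descends_trans[OF d sw(1)] by simp
qed

text \<open>As the potential is at most \<open>n * n\<close>, that many sweeps bring it to zero; the
  amortised count then allows \<open>n * (n * n)\<close> flips.\<close>

lemma raise_level_ok:
  assumes ok: "ok l \<sigma>" and l: "l < k"
  shows "ok (Suc l) (raise_level l vs \<sigma>)"
    "length (snd (raise_level l vs \<sigma>)) \<le> length (snd \<sigma>) + length vs ^ 3"
proof -
  interpret tight_graph "set vs" "fst \<sigma>" l using ok l by (rule ok_tight_graph)
  let ?n = "length vs" and ?\<sigma>' = "raise_level l vs \<sigma>"
  have "?\<sigma>' = (sweep l vs ^^ (?n * ?n)) \<sigma>"
    by (simp add: raise_level_def fold_const funpow_mult)
  then have d: "descends l \<sigma> ?\<sigma>'" "pot (set vs) l (fst ?\<sigma>') = 0 \<or>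
     pot (set vs) l (fst ?\<sigma>') + ?n * ?n \<le> pot (set vs) l (fst \<sigma>)"
    using sweeps_descend[OF ok l, of "?n * ?n"] by simp_all
  have bound: "pot (set vs) l (fst \<sigma>) \<le> ?n * ?n" using pot_le distinct by (simp add: distinct_card)
  then have 0: "pot (set vs) l (fst ?\<sigma>') = 0" using d(2) by linarith
  have ok': "ok l ?\<sigma>'" using d(1) by (rule descends_ok)
  interpret T: tight_graph "set vs" "fst ?\<sigma>'" l using ok' l by (rule ok_tight_graph)
  have "conn (set vs) (Suc l) (fst ?\<sigma>')" using T.pot_pos 0 conn_Suc_iff[OF T.conn] by auto
  then show "ok (Suc l) ?\<sigma>'" using ok' by (simp add: ok_def)
  have "length (snd ?\<sigma>') \<le> length (snd \<sigma>) + ?n * pot (set vs) l (fst \<sigma>)"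
    using d(1) 0 by (simp add: descends_def)
  also have "\<dots> \<le> length (snd \<sigma>) + ?n * (?n * ?n)" using bound by simp
  finally show "length (snd ?\<sigma>') \<le> length (snd \<sigma>) + ?n ^ 3" by (simp add: power3_eq_cube mult.assoc)
qed

lemma run_ok:
  assumes "j \<le> k"
  shows "ok j (fold (\<lambda>l. raise_level l vs) [0..<j] (as0, [])) \<and>
    length (snd (fold (\<lambda>l. raise_level l vs) [0..<j] (as0, []))) \<le> j * length vs ^ 3"
  using assms
proof (induction j)
  case 0
  then show ?case using arcs0 by (simp add: ok_def conn_def)
next
  case (Suc j)
  let ?\<sigma> = "fold (\<lambda>l. raise_level l vs) [0..<j] (as0, [])"
  have "ok j ?\<sigma>" "length (snd ?\<sigma>) \<le> j * length vs ^ 3" using Suc by simp_all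
  with raise_level_ok[of j ?\<sigma>] Suc.prems show ?case by simp
qed

lemma run_correct:
  shows "successively (good_flip (set vs) k) (as0 # run k vs as0)"
    and "conn (set vs) k (last (as0 # run k vs as0))"
    and "length (run k vs as0) \<le> k * length vs ^ 3"
proof -
  let ?\<sigma> = "fold (\<lambda>l. raise_level l vs) [0..<k] (as0, [])"
  have ok: "ok k ?\<sigma>" and len: "length (snd ?\<sigma>) \<le> k * length vs ^ 3" using run_ok[of k] by simp_all
  have eq: "as0 # run k vs as0 = rev (snd ?\<sigma> @ [as0])" by (simp add: run_def)
  show "successively (good_flip (set vs) k) (as0 # run k vs as0)"
    unfolding eq successively_rev using ok by (simp add: ok_def)
  show "conn (set vs) k (last (as0 # run k vs as0))"
    unfolding eq last_rev using ok by (simp add: ok_def)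
  show "length (run k vs as0) \<le> k * length vs ^ 3" using len by (simp add: run_def)
qed

end

section \<open>Polynomial time functions\<close>

class enc =
  fixes enc :: "'a \<Rightarrow> tree"

instantiation unit :: enc
begin
definition enc_unit :: "unit \<Rightarrow> tree" where "enc_unit x = Tip"
instance ..
end

instantiation bool :: enc
begin
definition enc_bool :: "bool \<Rightarrow> tree" where "enc_bool b = (if b then Br Tip Tip else Tip)"
instance ..
end

instantiation nat :: enc
begin
definition enc_nat :: "nat \<Rightarrow> tree" where "enc_nat = nat_tree"
instance ..
end

instantiation prod :: (enc, enc) enc
begin
definition enc_prod :: "'a \<times> 'b \<Rightarrow> tree" where "enc_prod z = Br (enc (fst z)) (enc (snd z))"
instance ..
end

instantiation list :: (enc) enc
begin
definition enc_list :: "'a list \<Rightarrow> tree" where "enc_list xs = list_tree (map enc xs)"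
instance ..
end

lemma enc_simps [simp]:
  "enc () = Tip" "enc True = Br Tip Tip" "enc False = Tip"
  "enc (0::nat) = Tip" "enc (Suc n) = Br Tip (enc n)"
  "enc (a, b) = Br (enc a) (enc b)"
  "enc ([]::'a::enc list) = Tip" "enc (y # ys) = Br (enc y) (enc (ys::'a list))"
  by (simp_all add: enc_unit_def enc_bool_def enc_nat_def enc_prod_def enc_list_def)

lemma enc_bool_eq_Tip_iff [simp]: "enc (b::bool) = Tip \<longleftrightarrow> \<not> b"
  by (cases b) simp_all

lemma enc_nat_eq_Tip_iff [simp]: "enc (n::nat) = Tip \<longleftrightarrow> n = 0"
  by (cases n) simp_all

lemma enc_list_eq_Tip_iff [simp]: "enc (xs::'a::enc list) = Tip \<longleftrightarrow> xs = []"
  by (cases xs) simp_all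

abbreviation sz :: "'a::enc \<Rightarrow> nat" where "sz x \<equiv> tree_size (enc x)"

section \<open>Sizes of codes and polynomial bounds\<close>

lemma sz_Cons_mem: "y \<in> set ys \<Longrightarrow> sz y < sz ys"
  by (induction ys) auto

lemma length_less_sz: "length ys < sz ys"
  by (induction ys) auto

lemma sz_append: "sz (xs @ ys) + 1 = sz xs + sz ys"
  by (induction xs) auto

lemma sz_rev [simp]: "sz (rev xs) = sz xs"
proof (induction xs)
  case (Cons x xs)
  then show ?case using sz_append[of "rev xs" "[x]"] by simp
qed simp

lemma sz_list_le: "(\<And>y. y \<in> set ys \<Longrightarrow> sz y \<le> B) \<Longrightarrow> sz ys \<le> 1 + length ys * (1 + B)"
  by (induction ys) fastforce+

lemma sz_pair: "sz z = 1 + sz (fst z) + sz (snd z)"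
  by (cases z) simp

lemma sz_bool: "sz (b::bool) \<le> 3"
  by (cases b) auto

lemma poly_nat_mono: "x \<le> y \<Longrightarrow> poly p x \<le> poly p (y::nat)"
  by (induction p) (auto intro!: add_mono mult_mono)

definition pbound :: "'a::enc set \<Rightarrow> ('a \<Rightarrow> nat) \<Rightarrow> bool" where
  "pbound E h \<longleftrightarrow> (\<exists>q. \<forall>x\<in>E. h x \<le> poly q (sz x))"

lemma pboundI: "(\<And>x. x \<in> E \<Longrightarrow> h x \<le> poly q (sz x)) \<Longrightarrow> pbound E h"
  by (auto simp: pbound_def)

lemma pbound_const: "pbound E (\<lambda>_. c)"
  by (rule pboundI[of _ _ "[:c:]"]) simp

lemma pbound_id: "pbound E sz"
  by (rule pboundI[of _ _ "[:0, 1:]"]) simp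

lemma pbound_add: "pbound E g \<Longrightarrow> pbound E h \<Longrightarrow> pbound E (\<lambda>x. g x + h x)"
proof -
  assume "pbound E g" "pbound E h"
  then obtain p q where "\<And>x. x \<in> E \<Longrightarrow> g x \<le> poly p (sz x)" "\<And>x. x \<in> E \<Longrightarrow> h x \<le> poly q (sz x)"
    by (auto simp: pbound_def)
  then show ?thesis by (intro pboundI[of _ _ "p + q"]) (simp add: add_mono)
qed

lemma pbound_mult: "pbound E g \<Longrightarrow> pbound E h \<Longrightarrow> pbound E (\<lambda>x. g x * h x)"
proof -
  assume "pbound E g" "pbound E h"
  then obtain p q where "\<And>x. x \<in> E \<Longrightarrow> g x \<le> poly p (sz x)" "\<And>x. x \<in> E \<Longrightarrow> h x \<le> poly q (sz x)"
    by (auto simp: pbound_def)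
  then show ?thesis by (intro pboundI[of _ _ "p * q"]) (simp add: mult_mono)
qed

lemma pbound_mono: "pbound E h \<Longrightarrow> (\<And>x. x \<in> E \<Longrightarrow> g x \<le> h x) \<Longrightarrow> pbound E g"
  unfolding pbound_def by (meson order.trans)

lemma pbound_poly: "pbound E h \<Longrightarrow> pbound E (\<lambda>x. poly p (h x))"
proof -
  assume "pbound E h"
  then obtain q where "\<And>x. x \<in> E \<Longrightarrow> h x \<le> poly q (sz x)" by (auto simp: pbound_def)
  then show ?thesis by (intro pboundI[of _ _ "pcompose p q"]) (simp add: poly_pcompose poly_nat_mono)
qed

text \<open>
  A program working at \<open>m\<close> reads and writes variable \<open>m\<close> and may overwrite all later variables.
\<close>

definition works :: "nat \<Rightarrow> cmd \<Rightarrow> tree \<Rightarrow> tree \<Rightarrow> nat \<Rightarrow> bool" where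
  "works m c x y b \<longleftrightarrow> (\<forall>s. s m = x \<longrightarrow>
     (\<exists>t s'. exec c s t s' \<and> s' m = y \<and> (\<forall>i<m. s' i = s i) \<and> t \<le> b))"

text \<open>The program depends on the base variable \<open>m\<close>, so that it can be placed
  above the variables in use, but the time bound does not. The domain \<open>E\<close> carries
  preconditions and loop invariants.\<close>

definition ptime :: "'a::enc set \<Rightarrow> ('a \<Rightarrow> 'b::enc) \<Rightarrow> bool" where
  "ptime E f \<longleftrightarrow> (\<exists>h. pbound E h \<and> (\<forall>m. \<exists>c. \<forall>x\<in>E. works m c (enc x) (enc (f x)) (h x)))"

lemma worksD:
  assumes "works m c x y b" "s m = x"
  obtains t s' where "exec c s t s'" "s' m = y" "\<And>i. i < m \<Longrightarrow> s' i = s i" "t \<le> b"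
  using assms unfolding works_def by blast

lemma works_mono: "works m c x y b \<Longrightarrow> b \<le> b' \<Longrightarrow> works m c x y b'"
  unfolding works_def by (blast intro: order.trans)

lemma ptimeI:
  assumes "pbound E h" "\<And>m. \<exists>c. \<forall>x\<in>E. works m c (enc x) (enc (f x)) (h x)"
  shows "ptime E f"
  using assms by (auto simp: ptime_def)

lemma ptimeE:
  assumes "ptime E f"
  obtains h c where "pbound E h" "\<And>m x. x \<in> E \<Longrightarrow> works m (c m) (enc x) (enc (f x)) (h x)"
proof -
  obtain h where h: "pbound E h" "\<forall>m. \<exists>c. \<forall>x\<in>E. works m c (enc x) (enc (f x)) (h x)"
    using assms by (auto simp: ptime_def)
  from choice[OF h(2)] show ?thesis using that[OF h(1)] by blast
qed

text \<open>Assignments pay for the size of the assigned tree, so time bounds size. This keeps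
  compositions of polynomial time functions polynomial.\<close>

lemma exec_size: "exec c s t s' \<Longrightarrow> s' x = s x \<or> tree_size (s' x) \<le> t"
  by (induction rule: exec.induct) auto

lemma ptime_sz: "ptime E f \<Longrightarrow> pbound E (\<lambda>x. sz (f x))"
proof -
  assume "ptime E f"
  then obtain h c where h: "pbound E h" "\<And>m x. x \<in> E \<Longrightarrow> works m (c m) (enc x) (enc (f x)) (h x)"
    by (rule ptimeE) blast
  have "sz (f x) \<le> sz x + h x" if x: "x \<in> E" for x
  proof -
    obtain t s' where "exec (c 0) (\<lambda>_. enc x) t s'" "s' 0 = enc (f x)" "t \<le> h x"
      using worksD[OF h(2)[OF x, of 0], of "\<lambda>_. enc x"] by blast
    then show ?thesis using exec_size[of "c 0" "\<lambda>_. enc x" t s' 0] by auto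
  qed
  then show ?thesis by (rule pbound_mono[OF pbound_add[OF pbound_id h(1)]])
qed

lemma ptime_subset: "ptime E f \<Longrightarrow> E' \<subseteq> E \<Longrightarrow> ptime E' f"
  unfolding ptime_def pbound_def by (meson subsetD)

text \<open>Only codes matter. Thus \<open>Cons\<close> and \<open>Suc\<close> are obtained from
  pairing, and a list of units from the number that is its length.\<close>

lemma ptime_enc_cong: "ptime E f \<Longrightarrow> (\<And>x. x \<in> E \<Longrightarrow> enc (g x) = enc (f x)) \<Longrightarrow> ptime E g"
  unfolding ptime_def by (metis (mono_tags, lifting))

lemma works_Seq:
  assumes "works m c x y b" "works m d y z b'"
  shows "works m (Seq c d) x z (b + b')"
  unfolding works_def
proof (intro allI impI)
  fix s assume "s m = x"
  then obtain t s' where 1: "exec c s t s'" "s' m = y" "\<And>i. i < m \<Longrightarrow> s' i = s i" "t \<le> b"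
    using worksD[of m c x y b s, OF assms(1)] by blast
  obtain t' s'' where 2: "exec d s' t' s''" "s'' m = z" "\<And>i. i < m \<Longrightarrow> s'' i = s' i" "t' \<le> b'"
    using worksD[of m d y z b' s', OF assms(2) 1(2)] by blast
  show "\<exists>t s'. exec (Seq c d) s t s' \<and> s' m = z \<and> (\<forall>i<m. s' i = s i) \<and> t \<le> b + b'"
    using exec.Seq[OF 1(1) 2(1)] 1 2 by (intro exI[of _ "t + t'"] exI[of _ s'']) auto
qed

lemma ptime_comp:
  assumes "ptime E f" "ptime E' g" "\<And>x. x \<in> E \<Longrightarrow> f x \<in> E'"
  shows "ptime E (\<lambda>x. g (f x))"
proof -
  obtain h c where h: "pbound E h" "\<And>m x. x \<in> E \<Longrightarrow> works m (c m) (enc x) (enc (f x)) (h x)"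
    using assms(1) by (rule ptimeE) blast
  obtain k d where k: "pbound E' k" "\<And>m x. x \<in> E' \<Longrightarrow> works m (d m) (enc x) (enc (g x)) (k x)"
    using assms(2) by (rule ptimeE) blast
  obtain q where q: "\<And>x. x \<in> E' \<Longrightarrow> k x \<le> poly q (sz x)" using k(1) by (auto simp: pbound_def)
  show ?thesis
  proof (rule ptimeI)
    show "pbound E (\<lambda>x. h x + poly q (sz (f x)))"
      using h(1) ptime_sz[OF assms(1)] by (intro pbound_add pbound_poly)
    show "\<exists>c. \<forall>x\<in>E. works m c (enc x) (enc (g (f x))) (h x + poly q (sz (f x)))" for m
      using works_Seq[OF h(2) works_mono[OF k(2) q]] assms(3) by blast
  qed
qed

lemma ptime_expr:
  assumes "pbound E (\<lambda>x. sz (f x))"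
    "\<And>m. \<exists>e. \<forall>x\<in>E. \<forall>s. s m = enc x \<longrightarrow> expr_val e s = enc (f x)"
  shows "ptime E f"
proof (rule ptimeI)
  show "pbound E (\<lambda>x. 1 + sz (f x))" using assms(1) by (intro pbound_add pbound_const)
  show "\<exists>c. \<forall>x\<in>E. works m c (enc x) (enc (f x)) (1 + sz (f x))" for m
  proof -
    obtain e where e: "\<And>x s. x \<in> E \<Longrightarrow> s m = enc x \<Longrightarrow> expr_val e s = enc (f x)"
      using assms(2) by blast
    have "works m (Assign m e) (enc x) (enc (f x)) (1 + sz (f x))" if "x \<in> E" for x
      unfolding works_def
    proof (intro allI impI)
      fix s assume "s m = enc x"
      then show "\<exists>t s'. exec (Assign m e) s t s' \<and> s' m = enc (f x) \<and> (\<forall>i<m. s' i = s i) \<and> t \<le> 1 + sz (f x)"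
        using exec.Assign[of m e s] e[OF that, of s]
        by (intro exI[of _ "1 + sz (f x)"] exI[of _ "s(m := enc (f x))"]) simp
    qed
    then show ?thesis by blast
  qed
qed

lemma ptime_id: "ptime E (\<lambda>x. x)"
  by (rule ptime_expr) (auto intro: pbound_id exI[of _ "Var _"])

lemma ex_const_expr: "\<exists>e. \<forall>s. expr_val e s = t"
proof (induction t)
  case Tip
  then show ?case by (auto intro: exI[of _ ETip])
next
  case (Br l r)
  then obtain e f where "\<forall>s. expr_val e s = l" "\<forall>s. expr_val f s = r" by blast
  then show ?case by (intro exI[of _ "EBr e f"]) auto
qed

lemma ptime_const: "ptime E (\<lambda>_. c)"
  using ex_const_expr[of "enc c"] by (intro ptime_expr pbound_const) blast

lemma left_size: "tree_size (left t) \<le> tree_size t" and right_size: "tree_size (right t) \<le> tree_size t"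
  by (cases t; simp)+

lemma ptime_left_id: "(\<And>x. x \<in> E \<Longrightarrow> enc (g x) = left (enc x)) \<Longrightarrow> ptime E g"
proof (rule ptime_expr)
  fix m
  assume "\<And>x. x \<in> E \<Longrightarrow> enc (g x) = left (enc x)"
  then show "\<exists>e. \<forall>x\<in>E. \<forall>s. s m = enc x \<longrightarrow> expr_val e s = enc (g x)"
    by (intro exI[of _ "Left (Var m)"]) auto
qed (simp add: pbound_mono[OF pbound_id] left_size)

lemma ptime_right_id: "(\<And>x. x \<in> E \<Longrightarrow> enc (g x) = right (enc x)) \<Longrightarrow> ptime E g"
proof (rule ptime_expr)
  fix m
  assume "\<And>x. x \<in> E \<Longrightarrow> enc (g x) = right (enc x)"
  then show "\<exists>e. \<forall>x\<in>E. \<forall>s. s m = enc x \<longrightarrow> expr_val e s = enc (g x)"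
    by (intro exI[of _ "Right (Var m)"]) auto
qed (simp add: pbound_mono[OF pbound_id] right_size)

lemma ptime_fst: "ptime E f \<Longrightarrow> ptime E (\<lambda>x. fst (f x))"
  by (rule ptime_comp[of _ f UNIV fst]) (auto intro: ptime_left_id simp: enc_prod_def)

lemma ptime_snd: "ptime E f \<Longrightarrow> ptime E (\<lambda>x. snd (f x))"
  by (rule ptime_comp[of _ f UNIV snd]) (auto intro: ptime_right_id simp: enc_prod_def)

text \<open>On the code of the empty list, \<open>left\<close> gives \<open>Tip\<close>, which is
  unrelated to \<open>hd []\<close>.\<close>

lemma ptime_hd: "ptime E f \<Longrightarrow> (\<And>x. x \<in> E \<Longrightarrow> f x \<noteq> []) \<Longrightarrow> ptime E (\<lambda>x. hd (f x))"
proof (rule ptime_comp[of _ f "{xs. xs \<noteq> []}" hd], assumption)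
  have "enc (hd xs) = left (enc xs)" if "xs \<noteq> []" for xs :: "'b list" using that by (cases xs) auto
  then show "ptime {xs. xs \<noteq> []} (hd :: 'b list \<Rightarrow> 'b)" by (intro ptime_left_id) simp
qed simp

text \<open>Truncated subtraction agrees with \<open>right Tip = Tip\<close>.\<close>

lemma ptime_pred: "ptime E f \<Longrightarrow> ptime E (\<lambda>x. f x - (1::nat))"
proof (rule ptime_comp[of _ f UNIV "\<lambda>n. n - 1"], assumption)
  have "enc (n - 1) = right (enc n)" for n :: nat by (cases n) auto
  then show "ptime UNIV (\<lambda>n::nat. n - 1)" by (intro ptime_right_id)
qed simp

section \<open>Pairing, case distinction and loops\<close>

lemma exec_run_copy:
  assumes "works m' c (enc x) y b" "s m = enc x" "m < m'"
  obtains t s' where "exec (Seq (Assign m' (Var m)) c) s t s'" "s' m' = y" "\<And>i. i < m' \<Longrightarrow> s' i = s i"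
    "t \<le> 1 + sz x + b"
proof -
  let ?s = "s(m' := enc x)"
  have 1: "exec (Assign m' (Var m)) s (1 + sz x) ?s"
    using exec.Assign[of m' "Var m" s] assms(2) by simp
  obtain t s' where 2: "exec c ?s t s'" "s' m' = y" "\<And>i. i < m' \<Longrightarrow> s' i = ?s i" "t \<le> b"
    using worksD[OF assms(1), of ?s] by auto
  show ?thesis
  proof (rule that)
    show "exec (Seq (Assign m' (Var m)) c) s (1 + sz x + t) s'" by (rule exec.Seq[OF 1 2(1)])
  qed (use 2 in auto)
qed

lemma ptime_Pair:
  assumes "ptime E f" "ptime E g"
  shows "ptime E (\<lambda>x. (f x, g x))"
proof -
  obtain h c where h: "pbound E h" "\<And>m x. x \<in> E \<Longrightarrow> works m (c m) (enc x) (enc (f x)) (h x)"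
    using assms(1) by (rule ptimeE) blast
  obtain k d where k: "pbound E k" "\<And>m x. x \<in> E \<Longrightarrow> works m (d m) (enc x) (enc (g x)) (k x)"
    using assms(2) by (rule ptimeE) blast
  let ?h = "\<lambda>x. (1 + sz x + h x) + ((1 + sz x + k x) + (2 + sz (f x) + sz (g x)))"
  show ?thesis
  proof (rule ptimeI)
    show "pbound E ?h"
      using h(1) k(1) ptime_sz[OF assms(1)] ptime_sz[OF assms(2)] by (intro pbound_add pbound_const pbound_id)
    fix m
    let ?c = "Seq (Seq (Assign (m+1) (Var m)) (c (m+1))) (Seq (Seq (Assign (m+2) (Var m)) (d (m+2)))
      (Assign m (EBr (Var (m+1)) (Var (m+2)))))"
    have "works m ?c (enc x) (enc (f x, g x)) (?h x)" if x: "x \<in> E" for x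
      unfolding works_def
    proof (intro allI impI)
      fix s assume s: "s m = enc x"
      obtain t1 s1 where 1: "exec (Seq (Assign (m+1) (Var m)) (c (m+1))) s t1 s1" "s1 (m+1) = enc (f x)"
        "\<And>i. i < m+1 \<Longrightarrow> s1 i = s i" "t1 \<le> 1 + sz x + h x"
        using exec_run_copy[where s=s and m=m and m'="m+1", OF h(2)[OF x] s] by auto
      have s1: "s1 m = enc x" using 1(3) s by simp
      obtain t2 s2 where 2: "exec (Seq (Assign (m+2) (Var m)) (d (m+2))) s1 t2 s2" "s2 (m+2) = enc (g x)"
        "\<And>i. i < m+2 \<Longrightarrow> s2 i = s1 i" "t2 \<le> 1 + sz x + k x"
        using exec_run_copy[where s=s1 and m=m and m'="m+2", OF k(2)[OF x] s1] by auto
      have 3: "exec (Assign m (EBr (Var (m+1)) (Var (m+2)))) s2 (2 + sz (f x) + sz (g x))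
          (s2(m := Br (enc (f x)) (enc (g x))))"
        using exec.Assign[of m "EBr (Var (m+1)) (Var (m+2))" s2] 1(2) 2(2) 2(3)[of "m+1"] by simp
      show "\<exists>t s'. exec ?c s t s' \<and> s' m = enc (f x, g x) \<and> (\<forall>i<m. s' i = s i) \<and> t \<le> ?h x"
        using exec.Seq[OF 1(1) exec.Seq[OF 2(1) 3]] 1(3,4) 2(3,4)
        by (intro exI conjI) (assumption, auto)
    qed
    then show "\<exists>c. \<forall>x\<in>E. works m c (enc x) (enc (f x, g x)) (?h x)" by blast
  qed
qed

lemma ptime_if_test:
  assumes "ptime E t" "\<And>x. x \<in> E \<Longrightarrow> b x \<longleftrightarrow> enc (t x) \<noteq> Tip"
    and "ptime {x\<in>E. b x} f" "ptime {x\<in>E. \<not> b x} g"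
  shows "ptime E (\<lambda>x. if b x then f x else g x)"
proof -
  let ?Ef = "{x\<in>E. b x}" and ?Eg = "{x\<in>E. \<not> b x}"
  obtain l a where l: "pbound E l" "\<And>m x. x \<in> E \<Longrightarrow> works m (a m) (enc x) (enc (t x)) (l x)"
    using assms(1) by (rule ptimeE) blast
  obtain h c where h: "pbound ?Ef h" "\<And>m x. x \<in> ?Ef \<Longrightarrow> works m (c m) (enc x) (enc (f x)) (h x)"
    using assms(3) by (rule ptimeE) blast
  obtain k d where k: "pbound ?Eg k" "\<And>m x. x \<in> ?Eg \<Longrightarrow> works m (d m) (enc x) (enc (g x)) (k x)"
    using assms(4) by (rule ptimeE) blast
  \<comment> \<open>Outside its branch \<open>h\<close> is arbitrary, so the common time bound uses
    polynomials in the input size.\<close>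
  obtain p where p: "\<And>x. x \<in> ?Ef \<Longrightarrow> h x \<le> poly p (sz x)" using h(1) by (auto simp: pbound_def)
  obtain q where q: "\<And>x. x \<in> ?Eg \<Longrightarrow> k x \<le> poly q (sz x)" using k(1) by (auto simp: pbound_def)
  let ?h = "\<lambda>x. (1 + sz x + l x) + (1 + poly p (sz x) + poly q (sz x))"
  show ?thesis
  proof (rule ptimeI)
    show "pbound E ?h"
      using l(1) by (intro pbound_add pbound_const pbound_id pbound_poly)
    fix m
    let ?c = "Seq (Seq (Assign (m+1) (Var m)) (a (m+1))) (If (Var (m+1)) (c m) (d m))"
    have "works m ?c (enc x) (enc (if b x then f x else g x)) (?h x)" if x: "x \<in> E" for x
      unfolding works_def
    proof (intro allI impI)
      fix s assume s: "s m = enc x"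
      obtain t1 s1 where 1: "exec (Seq (Assign (m+1) (Var m)) (a (m+1))) s t1 s1" "s1 (m+1) = enc (t x)"
        "\<And>i. i < m+1 \<Longrightarrow> s1 i = s i" "t1 \<le> 1 + sz x + l x"
        using exec_run_copy[where s=s and m=m and m'="m+1", OF l(2)[OF x] s] by auto
      have s1: "s1 m = enc x" using 1(3) s by simp
      have "\<exists>t2 s2. exec (If (Var (m+1)) (c m) (d m)) s1 t2 s2 \<and> s2 m = enc (if b x then f x else g x) \<and>
        (\<forall>i<m. s2 i = s1 i) \<and> t2 \<le> 1 + poly p (sz x) + poly q (sz x)"
      proof (cases "b x")
        case True
        then have xf: "x \<in> ?Ef" using x by simp
        obtain t2 s2 where 2: "exec (c m) s1 t2 s2" "s2 m = enc (f x)" "\<And>i. i < m \<Longrightarrow> s2 i = s1 i" "t2 \<le> h x"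
          using worksD[where s=s1 and m=m, OF h(2)[OF xf] s1] by blast
        have "exec (If (Var (m+1)) (c m) (d m)) s1 (1 + t2) s2"
          using 2(1) 1(2) assms(2)[OF x] True by (intro exec.IfTrue) simp_all
        then show ?thesis using 2 True p[OF xf] by (intro exI[of _ "1 + t2"] exI[of _ s2]) auto
      next
        case False
        then have xg: "x \<in> ?Eg" using x by simp
        obtain t2 s2 where 2: "exec (d m) s1 t2 s2" "s2 m = enc (g x)" "\<And>i. i < m \<Longrightarrow> s2 i = s1 i" "t2 \<le> k x"
          using worksD[where s=s1 and m=m, OF k(2)[OF xg] s1] by blast
        have "exec (If (Var (m+1)) (c m) (d m)) s1 (1 + t2) s2"
          using 2(1) 1(2) assms(2)[OF x] False by (intro exec.IfFalse) simp_all
        then show ?thesis using 2 False q[OF xg] by (intro exI[of _ "1 + t2"] exI[of _ s2]) auto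
      qed
      then obtain t2 s2 where 2: "exec (If (Var (m+1)) (c m) (d m)) s1 t2 s2"
        "s2 m = enc (if b x then f x else g x)" "\<forall>i<m. s2 i = s1 i" "t2 \<le> 1 + poly p (sz x) + poly q (sz x)"
        by blast
      show "\<exists>t s'. exec ?c s t s' \<and> s' m = enc (if b x then f x else g x) \<and> (\<forall>i<m. s' i = s i) \<and> t \<le> ?h x"
        using exec.Seq[OF 1(1) 2(1)] 1(3,4) 2(2-4)
        by (intro exI[of _ "t1 + t2"] exI[of _ s2]) auto
    qed
    then show "\<exists>c. \<forall>x\<in>E. works m c (enc x) (enc (if b x then f x else g x)) (?h x)" by blast
  qed
qed

text \<open>Variable \<open>m\<close> holds the parameter, \<open>m + 1\<close> the rest of the
  list, \<open>m + 2\<close> the accumulator; the body works at \<open>m + 3\<close>. In the cost of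
  a round, \<open>2 * sz ys\<close> pays for the current entry and the shortened list,
  \<open>2 * B\<close> for the old and the new accumulator, and \<open>10\<close> generously for the
  constants.\<close>

lemma fold_loop:
  fixes step :: "'b::enc \<Rightarrow> 'c::enc \<Rightarrow> 'c"
  assumes step: "\<And>y acc. y \<in> set ys \<Longrightarrow> R acc \<Longrightarrow> works (m+3) c (enc (x, y, acc)) (enc (step y acc)) b"
    and R: "\<And>us vs. ys = us @ vs \<Longrightarrow> R (fold step us acc)"
    and B: "\<And>acc. R acc \<Longrightarrow> sz acc \<le> B"
    and s: "s m = enc (x::'a::enc)" "s (m+1) = enc ys" "s (m+2) = enc acc"
  shows "\<exists>t s'. exec (While (Var (m+1))
      (Seq (Assign (m+3) (EBr (Var m) (EBr (Left (Var (m+1))) (Var (m+2)))))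
      (Seq c (Seq (Assign (m+2) (Var (m+3))) (Assign (m+1) (Right (Var (m+1)))))))) s t s' \<and>
    s' (m+2) = enc (fold step ys acc) \<and> (\<forall>i<m. s' i = s i) \<and>
    t \<le> 1 + length ys * (10 + sz x + 2 * sz ys + 2 * B + b)"
  using assms
proof (induction ys arbitrary: acc s)
  case Nil
  then show ?case by (auto intro!: exI[of _ 1] exI[of _ s] exec.WhileFalse)
next
  case (Cons y ys)
  let ?w = "While (Var (m+1))
      (Seq (Assign (m+3) (EBr (Var m) (EBr (Left (Var (m+1))) (Var (m+2)))))
      (Seq c (Seq (Assign (m+2) (Var (m+3))) (Assign (m+1) (Right (Var (m+1)))))))"
  have Racc: "R acc" using Cons.prems(2)[of "[]" "y # ys"] by simp
  have Racc': "R (step y acc)" using Cons.prems(2)[of "[y]" ys] by simp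
  let ?s1 = "s(m+3 := enc (x, y, acc))"
  have 1: "exec (Assign (m+3) (EBr (Var m) (EBr (Left (Var (m+1))) (Var (m+2))))) s (1 + sz (x, y, acc)) ?s1"
    using exec.Assign[of "m+3" "EBr (Var m) (EBr (Left (Var (m+1))) (Var (m+2)))" s] Cons.prems(4-6) by simp
  have st: "works (m+3) c (enc (x, y, acc)) (enc (step y acc)) b"
    using Cons.prems(1) Racc by simp
  obtain t2 s2 where 2: "exec c ?s1 t2 s2" "s2 (m+3) = enc (step y acc)" "\<And>i. i < m+3 \<Longrightarrow> s2 i = ?s1 i" "t2 \<le> b"
    using worksD[OF st, of ?s1] by auto
  let ?s3 = "s2(m+2 := enc (step y acc))"
  have 3: "exec (Assign (m+2) (Var (m+3))) s2 (1 + sz (step y acc)) ?s3"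
    using exec.Assign[of "m+2" "Var (m+3)" s2] 2(2) by simp
  let ?s4 = "?s3(m+1 := enc ys)"
  have 4: "exec (Assign (m+1) (Right (Var (m+1)))) ?s3 (1 + sz ys) ?s4"
    using exec.Assign[of "m+1" "Right (Var (m+1))" ?s3] 2(3)[of "m+1"] Cons.prems(5) by simp
  have "\<exists>t s'. exec ?w ?s4 t s' \<and> s' (m+2) = enc (fold step ys (step y acc)) \<and> (\<forall>i<m. s' i = ?s4 i) \<and>
    t \<le> 1 + length ys * (10 + sz x + 2 * sz ys + 2 * B + b)"
  proof (rule Cons.IH)
    show "works (m+3) c (enc (x, y', acc')) (enc (step y' acc')) b" if "y' \<in> set ys" "R acc'" for y' acc'
      using Cons.prems(1) that by simp
    show "R (fold step us (step y acc))" if "ys = us @ vs" for us vs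
      using Cons.prems(2)[of "y # us" vs] that by simp
  qed (use Cons.prems(3,4) 2(3)[of m] in auto)
  then obtain t5 s5 where 5: "exec ?w ?s4 t5 s5" "s5 (m+2) = enc (fold step ys (step y acc))"
    "\<forall>i<m. s5 i = ?s4 i" "t5 \<le> 1 + length ys * (10 + sz x + 2 * sz ys + 2 * B + b)" by blast
  have w: "exec ?w s (1 + (1 + sz (x, y, acc) + (t2 + (1 + sz (step y acc) + (1 + sz ys)))) + t5) s5"
    by (rule exec.WhileTrue[OF _ exec.Seq[OF 1 exec.Seq[OF 2(1) exec.Seq[OF 3 4]]] 5(1)])
      (use Cons.prems(5) in simp)
  have "sz acc \<le> B" "sz (step y acc) \<le> B" using Cons.prems(3) Racc Racc' by auto
  moreover have "length ys * (10 + sz x + 2 * sz ys + 2 * B + b) \<le> length ys * (10 + sz x + 2 * sz (y # ys) + 2 * B + b)"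
    by (intro mult_left_mono) auto
  moreover have "1 + sz (x, y, acc) + (t2 + (1 + sz (step y acc) + (1 + sz ys))) + 1 \<le> 10 + sz x + 2 * sz (y # ys) + 2 * B + b"
    using calculation(1,2) 2(4) by simp
  ultimately have "1 + (1 + sz (x, y, acc) + (t2 + (1 + sz (step y acc) + (1 + sz ys)))) + t5
      \<le> 1 + length (y # ys) * (10 + sz x + 2 * sz (y # ys) + 2 * B + b)"
    using 5(4) unfolding length_Cons mult_Suc by linarith
  moreover have "\<forall>i<m. s5 i = s i" using 5(3) 2(3) by simp
  ultimately show ?case using w 5(2) by (intro exI[of _ s5] exI) (auto simp del: tree_size.simps enc_simps)
qed

text \<open>\<open>R\<close> has to hold only for results on prefixes of the list, so it may express
  a bound that an arbitrary further step would violate, as happens for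
  \<open>[0..<n]\<close>.\<close>

lemma ptime_fold_prefix:
  assumes xs: "ptime E xs" and init: "ptime E init"
    and step: "ptime {z. fst z \<in> E \<and> fst (snd z) \<in> set (xs (fst z)) \<and> R (fst z) (snd (snd z))}
      (\<lambda>z. step (fst z) (fst (snd z)) (snd (snd z)))" (is "ptime ?E _")
    and R: "\<And>x us vs. x \<in> E \<Longrightarrow> xs x = us @ vs \<Longrightarrow> R x (fold (step x) us (init x))"
    and B: "\<And>x acc. x \<in> E \<Longrightarrow> R x acc \<Longrightarrow> sz acc \<le> B x" "pbound E B"
  shows "ptime E (\<lambda>x. fold (step x) (xs x) (init x))"
proof -
  obtain h c where h: "pbound E h" "\<And>m x. x \<in> E \<Longrightarrow> works m (c m) (enc x) (enc (xs x)) (h x)"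
    using xs by (rule ptimeE) blast
  obtain k d where k: "pbound E k" "\<And>m x. x \<in> E \<Longrightarrow> works m (d m) (enc x) (enc (init x)) (k x)"
    using init by (rule ptimeE) blast
  obtain l a where l: "pbound ?E l"
    "\<And>m z. z \<in> ?E \<Longrightarrow> works m (a m) (enc z) (enc (step (fst z) (fst (snd z)) (snd (snd z)))) (l z)"
    using step by (rule ptimeE) blast
  obtain q where q: "\<And>z. z \<in> ?E \<Longrightarrow> l z \<le> poly q (sz z)" using l(1) unfolding pbound_def by blast
  let ?b = "\<lambda>x. poly q (2 + sz x + sz (xs x) + B x)"
  let ?h = "\<lambda>x. (1 + sz x + h x) + ((1 + sz x + k x) +
    ((1 + sz (xs x) * (10 + sz x + 2 * sz (xs x) + 2 * B x + ?b x)) + (1 + B x)))"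
  show ?thesis
  proof (rule ptimeI)
    show "pbound E ?h"
      using h(1) k(1) B(2) ptime_sz[OF xs]
      by (intro pbound_add pbound_mult pbound_const pbound_id pbound_poly)
    fix m
    let ?w = "While (Var (m+1))
      (Seq (Assign (m+3) (EBr (Var m) (EBr (Left (Var (m+1))) (Var (m+2)))))
      (Seq (a (m+3)) (Seq (Assign (m+2) (Var (m+3))) (Assign (m+1) (Right (Var (m+1)))))))"
    let ?c = "Seq (Seq (Assign (m+1) (Var m)) (c (m+1))) (Seq (Seq (Assign (m+2) (Var m)) (d (m+2)))
      (Seq ?w (Assign m (Var (m+2)))))"
    have "works m ?c (enc x) (enc (fold (step x) (xs x) (init x))) (?h x)" if x: "x \<in> E" for x
      unfolding works_def
    proof (intro allI impI)
      fix s assume s: "s m = enc x"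
      obtain t1 s1 where 1: "exec (Seq (Assign (m+1) (Var m)) (c (m+1))) s t1 s1" "s1 (m+1) = enc (xs x)"
        "\<And>i. i < m+1 \<Longrightarrow> s1 i = s i" "t1 \<le> 1 + sz x + h x"
        using exec_run_copy[where s=s and m=m and m'="m+1", OF h(2)[OF x] s] by auto
      have s1: "s1 m = enc x" using 1(3) s by simp
      obtain t2 s2 where 2: "exec (Seq (Assign (m+2) (Var m)) (d (m+2))) s1 t2 s2" "s2 (m+2) = enc (init x)"
        "\<And>i. i < m+2 \<Longrightarrow> s2 i = s1 i" "t2 \<le> 1 + sz x + k x"
        using exec_run_copy[where s=s1 and m=m and m'="m+2", OF k(2)[OF x] s1] by auto
      have s2: "s2 m = enc x" "s2 (m+1) = enc (xs x)" using 2(3) 1(2) s1 by simp_all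
      have body: "works (m+3) (a (m+3)) (enc (x, y, acc)) (enc (step x y acc)) (?b x)"
        if "y \<in> set (xs x)" "R x acc" for y acc
      proof -
        have z: "(x, y, acc) \<in> ?E" using that x by simp
        have "sz (x, y, acc) \<le> 2 + sz x + sz (xs x) + B x"
          using sz_Cons_mem[OF that(1)] B(1)[OF x that(2)] by simp
        then have "l (x, y, acc) \<le> ?b x" using q[OF z] poly_nat_mono order.trans by blast
        then show ?thesis using works_mono[OF l(2)[OF z]] by simp
      qed
      obtain t3 s3 where 3: "exec ?w s2 t3 s3" "s3 (m+2) = enc (fold (step x) (xs x) (init x))"
        "\<forall>i<m. s3 i = s2 i" "t3 \<le> 1 + length (xs x) * (10 + sz x + 2 * sz (xs x) + 2 * B x + ?b x)"
        using fold_loop[of "xs x" "R x" m "a (m+3)" x "step x" "?b x" "init x" "B x" s2] body R[OF x] B(1)[OF x] s2 2(2)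
        by blast
      have szf: "sz (fold (step x) (xs x) (init x)) \<le> B x"
        using B(1)[OF x] R[OF x, of "xs x" "[]"] by simp
      have 4: "exec (Assign m (Var (m+2))) s3 (1 + sz (fold (step x) (xs x) (init x)))
          (s3(m := enc (fold (step x) (xs x) (init x))))"
        using exec.Assign[of m "Var (m+2)" s3] 3(2) by simp
      have "length (xs x) * (10 + sz x + 2 * sz (xs x) + 2 * B x + ?b x)
        \<le> sz (xs x) * (10 + sz x + 2 * sz (xs x) + 2 * B x + ?b x)"
        using length_less_sz[of "xs x"] by (intro mult_right_mono) auto
      then have "t1 + (t2 + (t3 + (1 + sz (fold (step x) (xs x) (init x))))) \<le> ?h x"
        using 1(4) 2(4) 3(4) szf by linarith
      moreover have "exec ?c s (t1 + (t2 + (t3 + (1 + sz (fold (step x) (xs x) (init x))))))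
          (s3(m := enc (fold (step x) (xs x) (init x))))"
        by (rule exec.Seq[OF 1(1) exec.Seq[OF 2(1) exec.Seq[OF 3(1) 4]]])
      moreover have "(s3(m := enc (fold (step x) (xs x) (init x)))) i = s i" if "i < m" for i
        using 1(3) 2(3) 3(3) that by simp
      ultimately show "\<exists>t s'. exec ?c s t s' \<and> s' m = enc (fold (step x) (xs x) (init x)) \<and>
          (\<forall>i<m. s' i = s i) \<and> t \<le> ?h x"
        by (metis fun_upd_same)
    qed
    then show "\<exists>c. \<forall>x\<in>E. works m c (enc x) (enc (fold (step x) (xs x) (init x))) (?h x)" by blast
  qed
qed

named_theorems ptime_intros

lemmas [ptime_intros] = ptime_id ptime_const ptime_fst ptime_snd ptime_hd ptime_pred ptime_Pair

lemma ptime_cong: "ptime E f \<Longrightarrow> (\<And>x. x \<in> E \<Longrightarrow> g x = f x) \<Longrightarrow> ptime E g"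
  by (rule ptime_enc_cong) auto

lemma ptime_comp2:
  assumes "ptime UNIV (\<lambda>z. F (fst z) (snd z))" "ptime E a" "ptime E b"
  shows "ptime E (\<lambda>x. F (a x) (b x))"
  using ptime_comp[OF ptime_Pair[OF assms(2,3)] assms(1)] by simp

lemma ptime_comp3:
  assumes "ptime UNIV (\<lambda>z. F (fst z) (fst (snd z)) (snd (snd z)))" "ptime E a" "ptime E b" "ptime E c"
  shows "ptime E (\<lambda>x. F (a x) (b x) (c x))"
  using ptime_comp[OF ptime_Pair[OF assms(2) ptime_Pair[OF assms(3,4)]] assms(1)] by simp

lemma ptime_comp4:
  assumes "ptime UNIV (\<lambda>z. F (fst z) (fst (snd z)) (fst (snd (snd z))) (snd (snd (snd z))))"
    "ptime E a" "ptime E b" "ptime E c" "ptime E d"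
  shows "ptime E (\<lambda>x. F (a x) (b x) (c x) (d x))"
  using ptime_comp[OF ptime_Pair[OF assms(2) ptime_Pair[OF assms(3) ptime_Pair[OF assms(4,5)]]] assms(1)]
  by simp

lemma ptime_comp5:
  assumes "ptime UNIV (\<lambda>z. F (fst z) (fst (snd z)) (fst (snd (snd z))) (fst (snd (snd (snd z))))
      (snd (snd (snd (snd z)))))"
    "ptime E a" "ptime E b" "ptime E c" "ptime E d" "ptime E e"
  shows "ptime E (\<lambda>x. F (a x) (b x) (c x) (d x) (e x))"
  using ptime_comp[OF ptime_Pair[OF assms(2) ptime_Pair[OF assms(3) ptime_Pair[OF assms(4) ptime_Pair[OF assms(5,6)]]]] assms(1)]
  by simp

lemma ptime_if [ptime_intros]:
  "ptime E b \<Longrightarrow> ptime {x\<in>E. b x} f \<Longrightarrow> ptime {x\<in>E. \<not> b x} g \<Longrightarrow> ptime E (\<lambda>x. if b x then f x else g x)"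
  by (rule ptime_if_test[of E b]) auto

lemma ptime_not [ptime_intros]: "ptime E b \<Longrightarrow> ptime E (\<lambda>x. \<not> b x)"
  by (rule ptime_cong[OF ptime_if[OF _ ptime_const ptime_const]]) auto

lemma ptime_conj [ptime_intros]: "ptime E b \<Longrightarrow> ptime {x\<in>E. b x} c \<Longrightarrow> ptime E (\<lambda>x. b x \<and> c x)"
  by (rule ptime_cong[OF ptime_if[OF _ _ ptime_const]]) auto

lemma ptime_Cons [ptime_intros]: "ptime E f \<Longrightarrow> ptime E g \<Longrightarrow> ptime E (\<lambda>x. f x # g x)"
  by (rule ptime_enc_cong[of _ "\<lambda>x. (f x, g x)"]) (auto intro: ptime_Pair)

lemma ptime_Suc [ptime_intros]: "ptime E f \<Longrightarrow> ptime E (\<lambda>x. Suc (f x))"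
  by (rule ptime_enc_cong[of _ "\<lambda>x. ((), f x)"]) (auto intro: ptime_Pair ptime_const)

lemma ptime_null [ptime_intros]: "ptime E f \<Longrightarrow> ptime E (\<lambda>x. f x = [])"
proof (rule ptime_cong[of _ "\<lambda>x. if f x \<noteq> [] then False else True"])
  assume "ptime E f"
  then show "ptime E (\<lambda>x. if f x \<noteq> [] then False else True)"
    by (rule ptime_if_test) (auto intro: ptime_const)
qed auto

lemma ptime_is_0 [ptime_intros]: "ptime E f \<Longrightarrow> ptime E (\<lambda>x. f x = (0::nat))"
proof (rule ptime_cong[of _ "\<lambda>x. if f x \<noteq> 0 then False else True"])
  assume "ptime E f"
  then show "ptime E (\<lambda>x. if f x \<noteq> 0 then False else True)"
    by (rule ptime_if_test) (auto intro: ptime_const)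
qed auto

lemma ptime_swap [ptime_intros]: "ptime E f \<Longrightarrow> ptime E (\<lambda>x. prod.swap (f x))"
  by (rule ptime_cong[of _ "\<lambda>x. (snd (f x), fst (f x))"]) (auto intro!: ptime_Pair ptime_fst ptime_snd simp: prod.swap_def)

lemma pbound_length: "ptime E f \<Longrightarrow> pbound E (\<lambda>x. length (f x))"
  by (rule pbound_mono[OF ptime_sz[of E f]]) (use length_less_sz less_imp_le in auto)

lemma pbound_Suc: "pbound E h \<Longrightarrow> pbound E (\<lambda>x. Suc (h x))"
  using pbound_add[OF pbound_const[of E 1]] by simp

lemmas pbound_intros = pbound_const pbound_Suc pbound_add pbound_mult pbound_length ptime_sz


subsection \<open>Folds\<close>

lemma ptime_fold:
  assumes xs: "ptime E xs" and init: "ptime E init"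
    and step: "ptime {z. fst z \<in> E \<and> fst (snd z) \<in> set (xs (fst z)) \<and> Inv (fst z) (snd (snd z))}
      (\<lambda>z. step (fst z) (fst (snd z)) (snd (snd z)))"
    and Inv0: "\<And>x. x \<in> E \<Longrightarrow> Inv x (init x)"
    and Inv1: "\<And>x y acc. x \<in> E \<Longrightarrow> y \<in> set (xs x) \<Longrightarrow> Inv x acc \<Longrightarrow> Inv x (step x y acc)"
    and B: "\<And>x acc. x \<in> E \<Longrightarrow> Inv x acc \<Longrightarrow> sz acc \<le> B x" "pbound E B"
  shows "ptime E (\<lambda>x. fold (step x) (xs x) (init x))"
proof (rule ptime_fold_prefix[OF xs init step _ B])
  show "Inv x (fold (step x) us (init x))" if "x \<in> E" "xs x = us @ ws" for x us ws
    by (rule fold_invariant[where Q = "\<lambda>y. y \<in> set us"]) (use that Inv0 Inv1 in simp_all)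
qed

text \<open>A step that could multiply the size of the accumulator might cause exponential growth.
  Additive growth \<open>h x\<close>, independent of the accumulator, accumulates to at most
  \<open>length (xs x) * h x\<close>.\<close>

lemma ptime_fold_incr:
  assumes xs: "ptime E xs" and init: "ptime E init"
    and step: "ptime {z. fst z \<in> E \<and> fst (snd z) \<in> set (xs (fst z)) \<and> Inv (fst z) (snd (snd z))}
      (\<lambda>z. step (fst z) (fst (snd z)) (snd (snd z)))"
    and Inv0: "\<And>x. x \<in> E \<Longrightarrow> Inv x (init x)"
    and Inv1: "\<And>x y acc. x \<in> E \<Longrightarrow> y \<in> set (xs x) \<Longrightarrow> Inv x acc \<Longrightarrow> Inv x (step x y acc)"
    and h: "\<And>x y acc. x \<in> E \<Longrightarrow> y \<in> set (xs x) \<Longrightarrow> Inv x acc \<Longrightarrow> sz (step x y acc) \<le> sz acc + h x"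
      "pbound E h"
  shows "ptime E (\<lambda>x. fold (step x) (xs x) (init x))"
proof -
  let ?R = "\<lambda>x acc. Inv x acc \<and> sz acc \<le> sz (init x) + length (xs x) * h x"
  show ?thesis
  proof (rule ptime_fold_prefix[of _ _ _ ?R step "\<lambda>x. sz (init x) + length (xs x) * h x", OF xs init])
    show "ptime {z. fst z \<in> E \<and> fst (snd z) \<in> set (xs (fst z)) \<and> ?R (fst z) (snd (snd z))}
        (\<lambda>z. step (fst z) (fst (snd z)) (snd (snd z)))"
      by (rule ptime_subset[OF step]) auto
    show "?R x (fold (step x) us (init x))" if x: "x \<in> E" "xs x = us @ ws" for x us ws
    proof -
      have "Inv x (fold (step x) us (init x)) \<and> sz (fold (step x) us (init x)) \<le> sz (init x) + length us * h x"
        using x(2)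
      proof (induction us arbitrary: ws rule: rev_induct)
        case Nil
        then show ?case using Inv0[OF x(1)] by simp
      next
        case (snoc y us)
        have y: "y \<in> set (xs x)" using snoc.prems by simp
        have IH: "Inv x (fold (step x) us (init x))"
          "sz (fold (step x) us (init x)) \<le> sz (init x) + length us * h x"
          using snoc.IH[of "y # ws"] snoc.prems by simp_all
        show ?case using Inv1[OF x(1) y IH(1)] h(1)[OF x(1) y IH(1)] IH(2) by simp
      qed
      moreover have "length us * h x \<le> length (xs x) * h x" using x(2) by simp
      ultimately show ?thesis by linarith
    qed
    show "pbound E (\<lambda>x. sz (init x) + length (xs x) * h x)"
      using xs init h(2) by (intro pbound_intros)
  qed auto
qed

lemma ptime_replicate_unit: "ptime E n \<Longrightarrow> ptime E (\<lambda>x. replicate (n x) ())"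
proof (erule ptime_enc_cong)
  have "enc (replicate m ()) = enc m" for m by (induction m) auto
  then show "enc (replicate (n x) ()) = enc (n x)" for x .
qed

lemma ptime_funpow:
  assumes n: "ptime E n" and init: "ptime E init"
    and step: "ptime {z. fst z \<in> E \<and> Inv (fst z) (snd z)} (\<lambda>z. f (fst z) (snd z))"
    and Inv0: "\<And>x. x \<in> E \<Longrightarrow> Inv x (init x)"
    and Inv1: "\<And>x acc. x \<in> E \<Longrightarrow> Inv x acc \<Longrightarrow> Inv x (f x acc)"
    and B: "\<And>x acc. x \<in> E \<Longrightarrow> Inv x acc \<Longrightarrow> sz acc \<le> B x" "pbound E B"
  shows "ptime E (\<lambda>x. (f x ^^ n x) (init x))"
proof -
  have "ptime E (\<lambda>x. fold (\<lambda>_. f x) (replicate (n x) ()) (init x))"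
  proof (rule ptime_fold[where step = "\<lambda>x _. f x" and Inv = Inv, OF ptime_replicate_unit[OF n] init])
    let ?D = "{z. fst z \<in> E \<and> fst (snd z) \<in> set (replicate (n (fst z)) ()) \<and> Inv (fst z) (snd (snd z))}"
    have "ptime ?D (\<lambda>z. (fst z, snd (snd z)))" by (intro ptime_intros)
    from ptime_comp[OF this step] show "ptime ?D (\<lambda>z. f (fst z) (snd (snd z)))" by simp
  qed (use Inv0 Inv1 B in auto)
  then show ?thesis by (simp add: fold_const)
qed

section \<open>Functions on numbers and lists\<close>

lemma ptime_eq_nat [ptime_intros]:
  fixes f g :: "'a::enc \<Rightarrow> nat"
  assumes "ptime E f" "ptime E g"
  shows "ptime E (\<lambda>x. f x = g x)"
proof (rule ptime_comp2[OF _ assms])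
  \<comment> \<open>The second number is counted down as often as the first one says; the flag
    records whether it ran out early. After \<open>m\<close> rounds the state is
    \<open>(m \<le> n, n - m)\<close>.\<close>
  let ?step = "\<lambda>z acc. (fst acc \<and> snd acc \<noteq> (0::nat), snd acc - 1)"
  have sz: "sz acc \<le> 4 + sz n" if "snd acc \<le> n" for n :: nat and acc :: "bool \<times> nat"
  proof -
    have "sz a \<le> sz b" if "a \<le> b" for a b :: nat
      using that by (induction rule: dec_induct) auto
    from this[OF that] show ?thesis using sz_bool[of "fst acc"] sz_pair[of acc] by linarith
  qed
  have "ptime UNIV (\<lambda>z::nat \<times> nat. (?step z ^^ fst z) (True, snd z))"
    by (rule ptime_funpow[where Inv = "\<lambda>z acc. snd acc \<le> snd z" and B = "\<lambda>z. 4 + sz (snd z)"])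
      (intro ptime_intros pbound_intros | simp add: sz)+
  from ptime_conj[OF ptime_fst[OF this] ptime_subset[OF ptime_is_0[OF ptime_snd[OF this]]]]
  have "ptime UNIV (\<lambda>z::nat \<times> nat. fst ((?step z ^^ fst z) (True, snd z)) \<and> snd ((?step z ^^ fst z) (True, snd z)) = 0)"
    by simp
  moreover have "(?step z ^^ m) (True, n) = (m \<le> n, n - m)" for z :: "nat \<times> nat" and m n
    by (induction m) auto
  ultimately show "ptime UNIV (\<lambda>z::nat \<times> nat. fst z = snd z)"
    by (elim ptime_cong) auto
qed

lemma ptime_eq_nat_pair [ptime_intros]:
  fixes f g :: "'a::enc \<Rightarrow> nat \<times> nat"
  assumes "ptime E f" "ptime E g"
  shows "ptime E (\<lambda>x. f x = g x)"
proof (rule ptime_comp2[OF _ assms])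
  show "ptime UNIV (\<lambda>z::(nat \<times> nat) \<times> (nat \<times> nat). fst z = snd z)"
    unfolding prod_eq_iff by (intro ptime_conj ptime_eq_nat ptime_fst ptime_snd ptime_id)
qed

lemma fold_Cons: "fold (#) xs ys = rev xs @ ys"
  by (induction xs arbitrary: ys) auto

lemma ptime_rev_append:
  assumes "ptime E f" "ptime E g"
  shows "ptime E (\<lambda>x. rev (f x) @ g x)"
proof -
  have "ptime E (\<lambda>x. fold (#) (f x) (g x))"
  proof (rule ptime_fold_incr[OF assms, where Inv = "\<lambda>_ _. True" and h = "\<lambda>x. 1 + sz (f x)"])
    show "sz (y # acc) \<le> sz acc + (1 + sz (f x))" if "y \<in> set (f x)" for x y acc
      using sz_Cons_mem[OF that] by simp
  qed (use assms in \<open>(intro ptime_intros pbound_intros | assumption | simp)+\<close>)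
  then show ?thesis by (simp add: fold_Cons)
qed

lemma ptime_rev [ptime_intros]: "ptime E f \<Longrightarrow> ptime E (\<lambda>x. rev (f x))"
  using ptime_rev_append[OF _ ptime_const[of E "[]"], of f] by simp

lemma ptime_append [ptime_intros]: "ptime E f \<Longrightarrow> ptime E g \<Longrightarrow> ptime E (\<lambda>x. f x @ g x)"
  using ptime_rev_append[OF ptime_rev, of E f g] by simp

lemma ptime_triple:
  assumes "ptime {z. fst z \<in> E \<and> snd z \<in> set (xs (fst z))} (\<lambda>z. f (fst z) (snd z))"
  shows "ptime {z. fst z \<in> E \<and> fst (snd z) \<in> set (xs (fst z)) \<and> R z} (\<lambda>z. f (fst z) (fst (snd z)))"
proof -
  let ?D = "{z. fst z \<in> E \<and> fst (snd z) \<in> set (xs (fst z)) \<and> R z}"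
  have "ptime ?D (\<lambda>z. (fst z, fst (snd z)))" by (intro ptime_intros)
  from ptime_comp[OF this assms] show ?thesis by simp
qed

lemma pbound_pair:
  assumes f: "ptime {z. fst z \<in> E \<and> snd z \<in> set (xs (fst z))} (\<lambda>z. f (fst z) (snd z))" and xs: "ptime E xs"
  obtains h where "pbound E h" "\<And>x y. x \<in> E \<Longrightarrow> y \<in> set (xs x) \<Longrightarrow> sz (f x y) \<le> h x"
proof -
  obtain q where q: "\<And>x y. x \<in> E \<Longrightarrow> y \<in> set (xs x) \<Longrightarrow> sz (f x y) \<le> poly q (sz (x, y))"
    using ptime_sz[OF f] unfolding pbound_def by force
  have "sz (f x y) \<le> poly q (1 + sz x + sz (xs x))" if "x \<in> E" "y \<in> set (xs x)" for x y
  proof -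
    have "sz (x, y) \<le> 1 + sz x + sz (xs x)" using sz_Cons_mem[OF that(2)] by simp
    then show ?thesis using q[OF that] poly_nat_mono order.trans by blast
  qed
  moreover have "pbound E (\<lambda>x. poly q (1 + sz x + sz (xs x)))"
    using xs by (intro pbound_poly pbound_intros pbound_id)
  ultimately show ?thesis using that by blast
qed

lemma fold_map_rev: "fold (\<lambda>y acc. f y # acc) xs ys = rev (map f xs) @ ys"
  by (induction xs arbitrary: ys) auto

lemma ptime_map [ptime_intros]:
  assumes xs: "ptime E xs" and f: "ptime {z. fst z \<in> E \<and> snd z \<in> set (xs (fst z))} (\<lambda>z. f (fst z) (snd z))"
  shows "ptime E (\<lambda>x. map (f x) (xs x))"
proof -
  obtain h where h: "pbound E h" "\<And>x y. x \<in> E \<Longrightarrow> y \<in> set (xs x) \<Longrightarrow> sz (f x y) \<le> h x"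
    using pbound_pair[OF f xs] by blast
  have "ptime E (\<lambda>x. fold (\<lambda>y acc. f x y # acc) (xs x) [])"
  proof (rule ptime_fold_incr[OF xs ptime_const, where Inv = "\<lambda>_ _. True" and h = "\<lambda>x. 1 + h x"])
    show "sz (f x y # acc) \<le> sz acc + (1 + h x)" if "x \<in> E" "y \<in> set (xs x)" for x y acc
      using h(2)[OF that] by simp
  qed (use h(1) in \<open>(intro ptime_intros pbound_intros ptime_triple[OF f] | assumption | simp)+\<close>)
  from ptime_rev[OF this] show ?thesis by (simp add: fold_map_rev)
qed

lemma fold_filter_rev: "fold (\<lambda>y acc. if P y then y # acc else acc) xs ys = rev (filter P xs) @ ys"
  by (induction xs arbitrary: ys) auto

lemma ptime_filter [ptime_intros]:
  assumes xs: "ptime E xs" and P: "ptime {z. fst z \<in> E \<and> snd z \<in> set (xs (fst z))} (\<lambda>z. P (fst z) (snd z))"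
  shows "ptime E (\<lambda>x. filter (P x) (xs x))"
proof -
  have "ptime E (\<lambda>x. fold (\<lambda>y acc. if P x y then y # acc else acc) (xs x) [])"
  proof (rule ptime_fold_incr[OF xs ptime_const, where Inv = "\<lambda>_ _. True" and h = "\<lambda>x. 1 + sz (xs x)"])
    show "sz (if P x y then y # acc else acc) \<le> sz acc + (1 + sz (xs x))" if "y \<in> set (xs x)" for x y acc
      using sz_Cons_mem[OF that] by simp
  qed (use xs in \<open>(intro ptime_intros pbound_intros ptime_triple[OF P] | assumption | simp)+\<close>)
  from ptime_rev[OF this] show ?thesis by (simp add: fold_filter_rev)
qed

lemma fold_append_rev: "fold (@) xss ys = concat (rev xss) @ ys"
  by (induction xss arbitrary: ys) auto

lemma ptime_concat [ptime_intros]: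
  assumes "ptime E f" shows "ptime E (\<lambda>x. concat (f x))"
proof -
  have "ptime E (\<lambda>x. fold (@) (rev (f x)) [])"
  proof (rule ptime_fold_incr[OF ptime_rev[OF assms] ptime_const, where Inv = "\<lambda>_ _. True" and h = "\<lambda>x. sz (f x)"])
    show "sz (y @ acc) \<le> sz acc + sz (f x)" if "y \<in> set (rev (f x))" for x y acc
      using sz_Cons_mem[of y "f x"] that sz_append[of y acc] by simp
  qed (use assms in \<open>(intro ptime_intros pbound_intros | assumption | simp)+\<close>)
  then show ?thesis by (simp add: fold_append_rev)
qed

lemma fold_list_all: "fold (\<lambda>y b. b \<and> P y) xs b \<longleftrightarrow> b \<and> list_all P xs"
  by (induction xs arbitrary: b) auto

lemma ptime_list_all [ptime_intros]:
  assumes xs: "ptime E xs" and P: "ptime {z. fst z \<in> E \<and> snd z \<in> set (xs (fst z))} (\<lambda>z. P (fst z) (snd z))"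
  shows "ptime E (\<lambda>x. list_all (P x) (xs x))"
proof -
  have "ptime E (\<lambda>x. fold (\<lambda>y b. b \<and> P x y) (xs x) True)"
  proof (rule ptime_fold[OF xs ptime_const, where Inv = "\<lambda>_ _. True" and B = "\<lambda>x. 3"])
    show "ptime {z. fst z \<in> E \<and> fst (snd z) \<in> set (xs (fst z)) \<and> True}
       (\<lambda>z. snd (snd z) \<and> P (fst z) (fst (snd z)))"
      by (intro ptime_conj ptime_snd ptime_id ptime_subset[OF ptime_triple[OF P, of "\<lambda>_. True"]]) auto
  qed (auto intro!: pbound_intros sz_bool)
  then show ?thesis by (simp add: fold_list_all)
qed

lemma ptime_list_ex [ptime_intros]:
  assumes xs: "ptime E xs" and P: "ptime {z. fst z \<in> E \<and> snd z \<in> set (xs (fst z))} (\<lambda>z. P (fst z) (snd z))"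
  shows "ptime E (\<lambda>x. list_ex (P x) (xs x))"
  using ptime_not[OF ptime_list_all[OF xs ptime_not[OF P]]] by (simp add: list_all_iff list_ex_iff)

lemma ptime_mem [ptime_intros]:
  fixes f :: "'a::enc \<Rightarrow> nat"
  assumes "ptime E f" "ptime E g"
  shows "ptime E (\<lambda>x. f x \<in> set (g x))"
proof (rule ptime_comp2[OF _ assms])
  have "ptime UNIV (\<lambda>z::nat \<times> nat list. list_ex (\<lambda>y. y = fst z) (snd z))"
    by (intro ptime_intros)
  then show "ptime UNIV (\<lambda>z::nat \<times> nat list. fst z \<in> set (snd z))"
    by (rule ptime_cong) (auto simp: list_ex_iff)
qed

lemma ptime_subset_list [ptime_intros]:
  fixes f g :: "'a::enc \<Rightarrow> nat list"
  assumes "ptime E f" "ptime E g"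
  shows "ptime E (\<lambda>x. set (f x) \<subseteq> set (g x))"
proof (rule ptime_comp2[OF _ assms])
  have "ptime UNIV (\<lambda>z::nat list \<times> nat list. list_all (\<lambda>y. y \<in> set (snd z)) (fst z))"
    by (intro ptime_intros)
  then show "ptime UNIV (\<lambda>z::nat list \<times> nat list. set (fst z) \<subseteq> set (snd z))"
    by (rule ptime_cong) (auto simp: list_all_iff)
qed

lemma map_of_filter: "map_of ps u = (case filter (\<lambda>p. fst p = u) ps of [] \<Rightarrow> None | p # _ \<Rightarrow> Some (snd p))"
  by (induction ps) auto

lemma ptime_case_map_of [ptime_intros]:
  fixes u :: "'a::enc \<Rightarrow> nat" and ps :: "'a \<Rightarrow> (nat \<times> 'b::enc) list"
  assumes ps: "ptime E ps" and u: "ptime E u" and d: "ptime E d"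
    and f: "ptime {z. fst z \<in> E \<and> map_of (ps (fst z)) (u (fst z)) = Some (snd z)} (\<lambda>z. f (fst z) (snd z))"
  shows "ptime E (\<lambda>x. case map_of (ps x) (u x) of None \<Rightarrow> d x | Some q \<Rightarrow> f x q)"
proof -
  let ?g = "\<lambda>x. filter (\<lambda>p. fst p = u x) (ps x)"
  have "ptime {z. fst z \<in> E \<and> snd z \<in> set (ps (fst z))} (\<lambda>z. u (fst z))"
    by (rule ptime_comp[OF ptime_fst[OF ptime_id] u]) auto
  then have g: "ptime E ?g" using ps by (intro ptime_intros)
  have "ptime E (\<lambda>x. if ?g x = [] then d x else f x (snd (hd (?g x))))"
  proof (rule ptime_if[OF ptime_null[OF g] ptime_subset[OF d]])
    have "ptime {x\<in>E. ?g x \<noteq> []} (\<lambda>x. (x, snd (hd (?g x))))"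
      by (intro ptime_Pair ptime_id ptime_snd ptime_hd ptime_subset[OF g]) auto
    from ptime_comp[OF this f] show "ptime {x\<in>E. ?g x \<noteq> []} (\<lambda>x. f x (snd (hd (?g x))))"
      by (auto simp: map_of_filter split: list.split)
  qed auto
  then show ?thesis
    by (rule ptime_cong) (auto simp: map_of_filter split: list.split)
qed

lemma sz_nat: "sz (m::nat) = 1 + 2 * m"
  by (induction m) auto

lemma ptime_upt [ptime_intros]:
  assumes "ptime E n" shows "ptime E (\<lambda>x. [0..<n x])"
proof (rule ptime_comp[OF assms, of UNIV "\<lambda>n. [0..<n]"])
  let ?step = "\<lambda>acc. (Suc (fst acc), fst acc # snd acc)"
  have eq: "(?step ^^ m) (0, []) = (m, rev [0..<m])" for m by (induction m) auto
  have "ptime UNIV (\<lambda>n. fold (\<lambda>_. ?step) (replicate n ()) (0, []))"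
  proof (rule ptime_fold_prefix[where R = "\<lambda>n acc. \<exists>m\<le>n. acc = (m, rev [0..<m])"
        and B = "\<lambda>n. 2 + sz n + sz n * (1 + sz n)", OF ptime_replicate_unit[OF ptime_id] ptime_const])
    show "\<exists>m\<le>n. fold (\<lambda>_. ?step) us (0, []) = (m, rev [0..<m])"
      if "replicate n () = us @ ws" for n us ws
    proof -
      have "length us + length ws = n" using arg_cong[OF that, of length] by simp
      then show ?thesis by (intro exI[of _ "length us"]) (simp add: fold_const eq)
    qed
    show "sz acc \<le> 2 + sz n + sz n * (1 + sz n)" if "\<exists>m\<le>n. acc = (m, rev [0..<m])" for n acc
    proof -
      obtain m where m: "m \<le> n" "acc = (m, rev [0..<m])" using \<open>\<exists>m\<le>n. _ m\<close> by blast
      have "sz [0..<m] \<le> 1 + m * (1 + sz n)"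
        using sz_list_le[of "[0..<m]" "sz n"] m(1) by (simp add: sz_nat)
      also have "\<dots> \<le> 1 + sz n * (1 + sz n)"
        by (intro add_left_mono mult_le_mono1) (use m(1) in \<open>simp add: sz_nat\<close>)
      finally have "sz [0..<m] \<le> 1 + sz n * (1 + sz n)" .
      moreover have "sz acc = 1 + sz m + sz [0..<m]" "sz m \<le> sz n" using m by (simp_all add: sz_nat)
      ultimately show ?thesis by linarith
    qed
  qed (intro ptime_intros pbound_intros | simp)+
  then have "ptime UNIV (\<lambda>n. rev (snd (fold (\<lambda>_. ?step) (replicate n ()) (0, []))))"
    by (intro ptime_intros)
  then show "ptime UNIV (\<lambda>n. [0..<n])"
    by (rule ptime_cong) (simp only: fold_const eq length_replicate snd_conv rev_rev_ident)
qed simp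

section \<open>The running time of the algorithm\<close>

lemma sz_swap [simp]: "sz (prod.swap p) = sz p"
  by (cases p) auto

lemma sz_flip1 [simp]: "sz (flip1 e as) = sz as"
  by (induction as) auto

lemma sz_fold_flip1 [simp]: "sz (fold flip1 q as) = sz as"
  by (induction q arbitrary: as) auto

lemma sz_augment [simp]: "sz (augment vs u v as) = sz as"
  by (simp add: augment_def split: option.split)

text \<open>The flag records that a copy of \<open>e\<close> has been met, so that only the first
  copy is reversed.\<close>

lemma flip1_fold:
  "fold (\<lambda>y acc. if \<not> fst acc \<and> y = e then (True, prod.swap y # snd acc) else (fst acc, y # snd acc)) as (b, acc) =
   (b \<or> e \<in> set as, rev (if b then as else flip1 e as) @ acc)"
  by (induction as arbitrary: b acc) auto

lemma ptime_flip1 [ptime_intros]: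
  fixes e :: "'a::enc \<Rightarrow> nat \<times> nat"
  assumes "ptime E e" "ptime E as"
  shows "ptime E (\<lambda>x. flip1 (e x) (as x))"
proof (rule ptime_comp2[OF _ assms])
  let ?step = "\<lambda>(z::(nat \<times> nat) \<times> (nat \<times> nat) list) y acc.
    if \<not> fst acc \<and> y = fst z then (True, prod.swap y # snd acc) else (fst acc, y # snd acc)"
  have "ptime UNIV (\<lambda>z. fold (?step z) (snd z) (False, []))"
  proof (rule ptime_fold_incr[where Inv = "\<lambda>_ _. True" and h = "\<lambda>z. 3 + sz (snd z)"])
    fix z :: "(nat \<times> nat) \<times> (nat \<times> nat) list" and y and acc :: "bool \<times> (nat \<times> nat) list"
    assume "y \<in> set (snd z)"
    from sz_Cons_mem[OF this] show "sz (?step z y acc) \<le> sz acc + (3 + sz (snd z))"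
      using sz_bool[of "fst acc"] by (cases acc) auto
  qed (intro ptime_intros pbound_intros | simp)+
  then have "ptime UNIV (\<lambda>z. rev (snd (fold (?step z) (snd z) (False, []))))"
    by (intro ptime_rev ptime_snd)
  then show "ptime UNIV (\<lambda>z::(nat \<times> nat) \<times> (nat \<times> nat) list. flip1 (fst z) (snd z))"
    by (rule ptime_cong) (simp add: flip1_fold)
qed

lemma ptime_fold_flip1 [ptime_intros]:
  fixes q :: "'a::enc \<Rightarrow> (nat \<times> nat) list"
  assumes "ptime E q" "ptime E as"
  shows "ptime E (\<lambda>x. fold flip1 (q x) (as x))"
proof (rule ptime_comp2[OF _ assms])
  show "ptime UNIV (\<lambda>z::(nat \<times> nat) list \<times> (nat \<times> nat) list. fold flip1 (fst z) (snd z))"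
    by (rule ptime_fold[where Inv = "\<lambda>z acc. sz acc = sz (snd z)" and B = "\<lambda>z. sz (snd z)"])
      (intro ptime_intros pbound_intros | simp)+
qed

lemma ptime_search_step [ptime_intros]:
  fixes U :: "'a::enc \<Rightarrow> nat list"
  assumes "ptime E U" "ptime E e" "ptime E ps"
  shows "ptime E (\<lambda>x. search_step (U x) (e x) (ps x))"
proof (rule ptime_comp3[OF _ assms])
  show "ptime UNIV (\<lambda>z::nat list \<times> (nat \<times> nat) \<times> (nat \<times> (nat \<times> nat) list) list.
      search_step (fst z) (fst (snd z)) (snd (snd z)))"
    unfolding search_step_def by (intro ptime_intros)
qed

text \<open>A search step copies a path out of the accumulator, so its growth has no evident bound
  in the input. The invariant supplies one: there are at most \<open>length U + 1\<close> entries,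
  and each path has at most that many arcs, all from \<open>as\<close>.\<close>

lemma sz_search_inv:
  fixes s :: nat
  assumes "search_inv U s as ps"
  shows "sz ps \<le> 1 + Suc (length U) * (1 + (1 + (sz s + sz U) + (1 + Suc (length U) * (1 + sz as))))"
proof -
  have len: "length ps \<le> Suc (length U)" using assms by (rule search_inv_length)
  have "sz p \<le> 1 + (sz s + sz U) + (1 + Suc (length U) * (1 + sz as))" if p: "p \<in> set ps" for p
  proof -
    obtain v q where vq: "p = (v, q)" by (cases p)
    have "walk s (rev q) v \<and> set q \<subseteq> set as \<and> distinct q \<and>
        snd ` set q \<subseteq> set U \<inter> fst ` set ps \<and> length q < length ps"
      using assms p vq unfolding search_inv_def by blast
    then have q: "set q \<subseteq> set as" "length q \<le> Suc (length U)" using len by auto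
    have "fst p \<in> fst ` set ps" using p by simp
    then have "v \<in> insert s (set U)" using assms vq unfolding search_inv_def by auto
    then have "sz v \<le> sz s + sz U" using sz_Cons_mem[of v U] by auto
    moreover have "sz q \<le> 1 + length q * (1 + sz as)"
    proof (rule sz_list_le)
      fix e assume "e \<in> set q"
      then have "e \<in> set as" using q(1) by blast
      then show "sz e \<le> sz as" using sz_Cons_mem[of e as] by simp
    qed
    moreover have "length q * (1 + sz as) \<le> Suc (length U) * (1 + sz as)"
      using q(2) by (rule mult_le_mono1)
    ultimately show ?thesis using vq by simp
  qed
  then have "sz ps \<le> 1 + length ps * (1 + (1 + (sz s + sz U) + (1 + Suc (length U) * (1 + sz as))))"
    by (rule sz_list_le)
  also have "\<dots> \<le> 1 + Suc (length U) * (1 + (1 + (sz s + sz U) + (1 + Suc (length U) * (1 + sz as))))"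
    using len by (intro add_left_mono mult_le_mono1)
  finally show ?thesis .
qed

lemma ptime_search [ptime_intros]:
  fixes U :: "'a::enc \<Rightarrow> nat list"
  assumes "ptime E U" "ptime E s" "ptime E as"
  shows "ptime E (\<lambda>x. search (U x) (s x) (as x))"
proof (rule ptime_comp3[OF _ assms])
  let ?Inv = "\<lambda>z::nat list \<times> nat \<times> (nat \<times> nat) list. search_inv (fst z) (fst (snd z)) (snd (snd z))"
  let ?B = "\<lambda>z::nat list \<times> nat \<times> (nat \<times> nat) list.
    1 + Suc (length (fst z)) * (1 + (1 + (sz (fst (snd z)) + sz (fst z)) + (1 + Suc (length (fst z)) * (1 + sz (snd (snd z))))))"
  let ?D = "{z. fst z \<in> (UNIV :: (nat list \<times> nat \<times> (nat \<times> nat) list) set) \<and>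
    fst (snd z) \<in> set (fst (fst z)) \<and> ?Inv (fst z) (snd (snd z))}"
  have inner: "ptime ?D (\<lambda>z. fold (search_step (fst (fst z))) (snd (snd (fst z))) (snd (snd z)))"
  proof (rule ptime_fold[where Inv = "\<lambda>z. ?Inv (fst z)" and B = "\<lambda>z. ?B (fst z)"])
    show "sz acc \<le> ?B (fst z)" if "?Inv (fst z) acc"
      for z :: "(nat list \<times> nat \<times> (nat \<times> nat) list) \<times> nat \<times> (nat \<times> (nat \<times> nat) list) list"
      and acc :: "(nat \<times> (nat \<times> nat) list) list"
      using that by (rule sz_search_inv)
    show "pbound ?D (\<lambda>z. ?B (fst z))" by (intro ptime_intros pbound_intros)
  qed (intro ptime_intros | simp add: search_inv_step)+
  show "ptime UNIV (\<lambda>z::nat list \<times> nat \<times> (nat \<times> nat) list. search (fst z) (fst (snd z)) (snd (snd z)))"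
    unfolding search_def
  proof (rule ptime_fold[where Inv = ?Inv and B = ?B])
    show "sz acc \<le> ?B z" if "?Inv z acc"
      for z :: "nat list \<times> nat \<times> (nat \<times> nat) list" and acc :: "(nat \<times> (nat \<times> nat) list) list"
      using that by (rule sz_search_inv)
    show "pbound UNIV ?B" by (intro ptime_intros pbound_intros)
    show "ptime ?D (\<lambda>z. fold (search_step (fst (fst z))) (snd (snd (fst z))) (snd (snd z)))"
      by (fact inner)
  qed (intro ptime_intros | simp add: search_inv_init search_inv_pass)+
qed

lemma ptime_augment [ptime_intros]:
  fixes vs :: "'a::enc \<Rightarrow> nat list"
  assumes "ptime E vs" "ptime E u" "ptime E v" "ptime E as"
  shows "ptime E (\<lambda>x. augment (vs x) (u x) (v x) (as x))"
proof (rule ptime_comp4[OF _ assms])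
  show "ptime UNIV (\<lambda>z::nat list \<times> nat \<times> nat \<times> (nat \<times> nat) list.
      augment (fst z) (fst (snd z)) (fst (snd (snd z))) (snd (snd (snd z))))"
    unfolding augment_def by (intro ptime_intros)
qed

lemma ptime_mincut [ptime_intros]:
  fixes vs :: "'a::enc \<Rightarrow> nat list"
  assumes "ptime E l" "ptime E vs" "ptime E u" "ptime E v" "ptime E as"
  shows "ptime E (\<lambda>x. mincut (l x) (vs x) (u x) (v x) (as x))"
proof (rule ptime_comp5[OF _ assms])
  have "ptime UNIV (\<lambda>z::nat \<times> nat list \<times> nat \<times> nat \<times> (nat \<times> nat) list.
      (augment (fst (snd z)) (fst (snd (snd z))) (fst (snd (snd (snd z)))) ^^ fst z) (snd (snd (snd (snd z)))))"
    by (rule ptime_funpow[where Inv = "\<lambda>z acc. sz acc = sz (snd (snd (snd (snd z))))"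
        and B = "\<lambda>z. sz (snd (snd (snd (snd z))))"])
      (intro ptime_intros pbound_intros | simp)+
  then show "ptime UNIV (\<lambda>z::nat \<times> nat list \<times> nat \<times> nat \<times> (nat \<times> nat) list.
      mincut (fst z) (fst (snd z)) (fst (snd (snd z))) (fst (snd (snd (snd z)))) (snd (snd (snd (snd z)))))"
    unfolding mincut_def by (intro ptime_intros)
qed

lemma ptime_cuts [ptime_intros]:
  fixes vs :: "'a::enc \<Rightarrow> nat list"
  assumes "ptime E l" "ptime E vs" "ptime E as"
  shows "ptime E (\<lambda>x. cuts (l x) (vs x) (as x))"
proof (rule ptime_comp3[OF _ assms])
  show "ptime UNIV (\<lambda>z::nat \<times> nat list \<times> (nat \<times> nat) list. cuts (fst z) (fst (snd z)) (snd (snd z)))"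
    unfolding cuts_def by (intro ptime_intros)
qed

lemma ptime_tight_list [ptime_intros]:
  fixes vs :: "'a::enc \<Rightarrow> nat list"
  assumes "ptime E l" "ptime E vs" "ptime E as"
  shows "ptime E (\<lambda>x. tight_list (l x) (vs x) (as x))"
proof (rule ptime_comp3[OF _ assms])
  show "ptime UNIV (\<lambda>z::nat \<times> nat list \<times> (nat \<times> nat) list. tight_list (fst z) (fst (snd z)) (snd (snd z)))"
    unfolding tight_list_def by (intro ptime_intros)
qed

lemma ptime_better_list [ptime_intros]:
  fixes L :: "'a::enc \<Rightarrow> nat list list"
  assumes "ptime E L" "ptime E L'"
  shows "ptime E (\<lambda>x. better_list (L x) (L' x))"
proof (rule ptime_comp2[OF _ assms])
  show "ptime UNIV (\<lambda>z::nat list list \<times> nat list list. better_list (fst z) (snd z))"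
    unfolding better_list_def by (intro ptime_intros)
qed

lemma ptime_safe_list [ptime_intros]:
  fixes vs :: "'a::enc \<Rightarrow> nat list"
  assumes "ptime E l" "ptime E vs" "ptime E s" "ptime E as"
  shows "ptime E (\<lambda>x. safe_list (l x) (vs x) (s x) (as x))"
proof (rule ptime_comp4[OF _ assms])
  show "ptime UNIV (\<lambda>z::nat \<times> nat list \<times> nat \<times> (nat \<times> nat) list.
      safe_list (fst z) (fst (snd z)) (fst (snd (snd z))) (snd (snd (snd z))))"
    unfolding safe_list_def by (intro ptime_intros)
qed

lemma ptime_path_to [ptime_intros]:
  fixes vs :: "'a::enc \<Rightarrow> nat list"
  assumes "ptime E l" "ptime E vs" "ptime E s" "ptime E t" "ptime E as"
  shows "ptime E (\<lambda>x. path_to (l x) (vs x) (s x) (t x) (as x))"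
proof (rule ptime_comp5[OF _ assms])
  show "ptime UNIV (\<lambda>z::nat \<times> nat list \<times> nat \<times> nat \<times> (nat \<times> nat) list.
      path_to (fst z) (fst (snd z)) (fst (snd (snd z))) (fst (snd (snd (snd z)))) (snd (snd (snd (snd z)))))"
    unfolding path_to_def by (intro ptime_intros)
qed

section \<open>Growth of the run states\<close>

lemma length_path_to: "length (path_to l vs s t as) \<le> length vs"
proof (cases "map_of (search (safe_list l vs s as) s as) t")
  case (Some q)
  have "length (safe_list l vs s as) \<le> length vs" by (simp add: safe_list_def)
  then show ?thesis using search_walk(5)[OF Some] Some by (simp add: path_to_def)
qed (simp add: path_to_def)

text \<open>Flips keep the size of the arc list, so the history grows by an amount depending only on
  a fixed size. This is the additive growth that the incremental fold rule asks for.\<close>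

definition grows :: "nat \<Rightarrow> nat run_state \<Rightarrow> nat run_state \<Rightarrow> bool" where
  "grows c \<sigma> \<sigma>' \<longleftrightarrow> sz (fst \<sigma>') = sz (fst \<sigma>) \<and> sz \<sigma>' \<le> sz \<sigma> + c"

lemma grows_fold:
  assumes "\<And>y \<tau>. y \<in> set xs \<Longrightarrow> sz (fst \<tau>) = sz (fst \<sigma>) \<Longrightarrow> grows c \<tau> (f y \<tau>)"
  shows "grows (length xs * c) \<sigma> (fold f xs \<sigma>)"
  using assms
proof (induction xs arbitrary: \<sigma>)
  case (Cons x xs)
  have 1: "grows c \<sigma> (f x \<sigma>)" using Cons.prems by simp
  have "grows (length xs * c) (f x \<sigma>) (fold f xs (f x \<sigma>))"
    using Cons.prems 1 by (intro Cons.IH) (simp add: grows_def)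
  with 1 show ?case by (simp add: grows_def)
qed (simp add: grows_def)

lemma grows_push: "grows (1 + sz (fst \<sigma>)) \<sigma> (push l vs e \<sigma>)"
  by (simp add: grows_def push_def sz_pair[of \<sigma>])

lemma grows_attempt: "grows (length vs * (1 + sz (fst \<sigma>))) \<sigma> (attempt l vs s t \<sigma>)"
proof -
  let ?q = "path_to l vs s t (fst \<sigma>)"
  have "grows (length ?q * (1 + sz (fst \<sigma>))) \<sigma> (fold (push l vs) ?q \<sigma>)"
    by (rule grows_fold) (metis grows_push)
  moreover have "length ?q * (1 + sz (fst \<sigma>)) \<le> length vs * (1 + sz (fst \<sigma>))"
    using length_path_to by (rule mult_le_mono1)
  ultimately show ?thesis by (simp add: attempt_def grows_def)
qed

lemma grows_sweep: "grows (length vs * (length vs * (length vs * (1 + sz (fst \<sigma>))))) \<sigma> (sweep l vs \<sigma>)"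
  unfolding sweep_def by (intro grows_fold) (metis grows_attempt)

lemma grows_raise_level:
  "grows (length vs * (length vs * (length vs * (length vs * (length vs * (1 + sz (fst \<sigma>))))))) \<sigma> (raise_level l vs \<sigma>)"
  unfolding raise_level_def by (intro grows_fold) (metis grows_sweep)

lemma ptime_fold_grows:
  fixes init :: "'a::enc \<Rightarrow> nat run_state"
  assumes xs: "ptime E xs" and init: "ptime E init"
    and step: "ptime {z. fst z \<in> E \<and> fst (snd z) \<in> set (xs (fst z)) \<and> sz (fst (snd (snd z))) = sz (fst (init (fst z)))}
      (\<lambda>z. step (fst z) (fst (snd z)) (snd (snd z)))"
    and g: "\<And>x y \<sigma>. x \<in> E \<Longrightarrow> y \<in> set (xs x) \<Longrightarrow> sz (fst \<sigma>) = sz (fst (init x)) \<Longrightarrow> grows (h x) \<sigma> (step x y \<sigma>)"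
    and h: "pbound E h"
  shows "ptime E (\<lambda>x. fold (step x) (xs x) (init x))"
  by (rule ptime_fold_incr[where Inv = "\<lambda>x \<sigma>. sz (fst \<sigma>) = sz (fst (init x))" and h = h, OF xs init step])
    (use g h in \<open>auto simp: grows_def\<close>)

lemma ptime_push [ptime_intros]:
  fixes vs :: "'a::enc \<Rightarrow> nat list"
  assumes "ptime E l" "ptime E vs" "ptime E e" "ptime E \<sigma>"
  shows "ptime E (\<lambda>x. push (l x) (vs x) (e x) (\<sigma> x))"
proof (rule ptime_comp4[OF _ assms])
  show "ptime UNIV (\<lambda>z::nat \<times> nat list \<times> (nat \<times> nat) \<times> nat run_state.
      push (fst z) (fst (snd z)) (fst (snd (snd z))) (snd (snd (snd z))))"
    unfolding push_def by (intro ptime_intros)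
qed

lemma ptime_attempt [ptime_intros]:
  fixes vs :: "'a::enc \<Rightarrow> nat list"
  assumes "ptime E l" "ptime E vs" "ptime E s" "ptime E t" "ptime E \<sigma>"
  shows "ptime E (\<lambda>x. attempt (l x) (vs x) (s x) (t x) (\<sigma> x))"
proof (rule ptime_comp5[OF _ assms])
  let ?q = "\<lambda>z::nat \<times> nat list \<times> nat \<times> nat \<times> nat run_state.
    path_to (fst z) (fst (snd z)) (fst (snd (snd z))) (fst (snd (snd (snd z)))) (fst (snd (snd (snd (snd z)))))"
  \<comment> \<open>Stated for all domains, since the conditional in \<open>attempt\<close>
    restricts the domain to inputs that pass the test.\<close>
  have "ptime E' (\<lambda>z. fold (push (fst z) (fst (snd z))) (?q z) (snd (snd (snd (snd z)))))" for E'
  proof (rule ptime_fold_grows[where h = "\<lambda>z. 1 + sz (fst (snd (snd (snd (snd z)))))"])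
    show "grows (1 + sz (fst (snd (snd (snd (snd x)))))) \<sigma> (push (fst x) (fst (snd x)) y \<sigma>)"
      if "sz (fst \<sigma>) = sz (fst (snd (snd (snd (snd x)))))"
      for x :: "nat \<times> nat list \<times> nat \<times> nat \<times> nat run_state" and y and \<sigma> :: "nat run_state"
      using grows_push[of \<sigma>] that by simp
  qed (intro ptime_intros pbound_intros)+
  then show "ptime UNIV (\<lambda>z::nat \<times> nat list \<times> nat \<times> nat \<times> nat run_state.
      attempt (fst z) (fst (snd z)) (fst (snd (snd z))) (fst (snd (snd (snd z)))) (snd (snd (snd (snd z)))))"
    unfolding attempt_def by (intro ptime_intros)
qed

lemma ptime_sweep [ptime_intros]:
  fixes vs :: "'a::enc \<Rightarrow> nat list"
  assumes "ptime E l" "ptime E vs" "ptime E \<sigma>"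
  shows "ptime E (\<lambda>x. sweep (l x) (vs x) (\<sigma> x))"
proof (rule ptime_comp3[OF _ assms])
  have inner: "ptime E' (\<lambda>z::(nat \<times> nat list \<times> nat run_state) \<times> nat \<times> nat run_state.
      fold (\<lambda>t. attempt (fst (fst z)) (fst (snd (fst z))) (fst (snd z)) t) (fst (snd (fst z))) (snd (snd z)))" for E'
  proof (rule ptime_fold_grows[where h = "\<lambda>z. length (fst (snd (fst z))) * (1 + sz (fst (snd (snd z))))"])
    fix x :: "(nat \<times> nat list \<times> nat run_state) \<times> nat \<times> nat run_state" and y and \<sigma> :: "nat run_state"
    assume "sz (fst \<sigma>) = sz (fst (snd (snd x)))"
    then show "grows (length (fst (snd (fst x))) * (1 + sz (fst (snd (snd x))))) \<sigma>
        (attempt (fst (fst x)) (fst (snd (fst x))) (fst (snd x)) y \<sigma>)"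
      using grows_attempt[of "fst (snd (fst x))" \<sigma>] by simp
  qed (intro ptime_intros pbound_intros)+
  show "ptime UNIV (\<lambda>z::nat \<times> nat list \<times> nat run_state. sweep (fst z) (fst (snd z)) (snd (snd z)))"
    unfolding sweep_def
  proof (rule ptime_fold_grows[where h = "\<lambda>z. length (fst (snd z)) * (length (fst (snd z)) * (1 + sz (fst (snd (snd z)))))"])
    fix x :: "nat \<times> nat list \<times> nat run_state" and y and \<sigma> :: "nat run_state"
    assume eq: "sz (fst \<sigma>) = sz (fst (snd (snd x)))"
    show "grows (length (fst (snd x)) * (length (fst (snd x)) * (1 + sz (fst (snd (snd x)))))) \<sigma>
       (fold (attempt (fst x) (fst (snd x)) y) (fst (snd x)) \<sigma>)"
      unfolding eq[symmetric] by (intro grows_fold) (metis grows_attempt)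
  qed (intro inner ptime_intros pbound_intros)+
qed

lemma ptime_raise_level [ptime_intros]:
  fixes vs :: "'a::enc \<Rightarrow> nat list"
  assumes "ptime E l" "ptime E vs" "ptime E \<sigma>"
  shows "ptime E (\<lambda>x. raise_level (l x) (vs x) (\<sigma> x))"
proof (rule ptime_comp3[OF _ assms])
  let ?h = "\<lambda>vs \<sigma>. length vs * (length vs * (length vs * (1 + sz (fst \<sigma>))))"
  have inner: "ptime E' (\<lambda>z::(nat \<times> nat list \<times> nat run_state) \<times> nat \<times> nat run_state.
      fold (\<lambda>_. sweep (fst (fst z)) (fst (snd (fst z)))) (fst (snd (fst z))) (snd (snd z)))" for E'
  proof (rule ptime_fold_grows[where h = "\<lambda>z. ?h (fst (snd (fst z))) (snd (snd z))"])
    fix x :: "(nat \<times> nat list \<times> nat run_state) \<times> nat \<times> nat run_state" and \<sigma> :: "nat run_state"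
    assume "sz (fst \<sigma>) = sz (fst (snd (snd x)))"
    then show "grows (?h (fst (snd (fst x))) (snd (snd x))) \<sigma> (sweep (fst (fst x)) (fst (snd (fst x))) \<sigma>)"
      using grows_sweep[of "fst (snd (fst x))" \<sigma>] by simp
  qed (intro ptime_intros pbound_intros)+
  show "ptime UNIV (\<lambda>z::nat \<times> nat list \<times> nat run_state. raise_level (fst z) (fst (snd z)) (snd (snd z)))"
    unfolding raise_level_def
  proof (rule ptime_fold_grows[where h = "\<lambda>z. length (fst (snd z)) * ?h (fst (snd z)) (snd (snd z))"])
    fix x :: "nat \<times> nat list \<times> nat run_state" and \<sigma> :: "nat run_state"
    assume eq: "sz (fst \<sigma>) = sz (fst (snd (snd x)))"
    show "grows (length (fst (snd x)) * ?h (fst (snd x)) (snd (snd x))) \<sigma>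
       (fold (\<lambda>_. sweep (fst x) (fst (snd x))) (fst (snd x)) \<sigma>)"
      unfolding eq[symmetric] by (intro grows_fold) (metis grows_sweep)
  qed (intro inner ptime_intros pbound_intros)+
qed

lemma ptime_run:
  "ptime UNIV (\<lambda>z::nat \<times> nat \<times> (nat \<times> nat) list. run (fst z) [0..<fst (snd z)] (snd (snd z)))"
proof -
  let ?h = "\<lambda>vs as. length vs * (length vs * (length vs * (length vs * (length vs * (1 + sz as)))))"
  let ?vs = "\<lambda>z::nat \<times> nat \<times> (nat \<times> nat) list. [0..<fst (snd z)]"
  have "ptime UNIV (\<lambda>z::nat \<times> nat \<times> (nat \<times> nat) list.
      fold (\<lambda>l. raise_level l (?vs z)) [0..<fst z] (snd (snd z), []))"
  proof (rule ptime_fold_grows[where h = "\<lambda>z. ?h (?vs z) (snd (snd z))"])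
    fix x :: "nat \<times> nat \<times> (nat \<times> nat) list" and y and \<sigma> :: "nat run_state"
    assume eq: "sz (fst \<sigma>) = sz (fst (snd (snd x), [] :: (nat \<times> nat) list list))"
    then show "grows (?h (?vs x) (snd (snd x))) \<sigma> (raise_level y (?vs x) \<sigma>)"
      using grows_raise_level[of "?vs x" \<sigma> y] by simp
  next
    show "pbound UNIV (\<lambda>z. ?h (?vs z) (snd (snd z)))"
      by (intro ptime_intros pbound_intros)
  qed (intro ptime_intros)+
  then show ?thesis unfolding run_def by (intro ptime_intros)
qed

section \<open>Arc lists and digraphs\<close>

text \<open>Position \<open>i\<close> of the arc list stands for the edge \<open>es ! i\<close>. In
  this way edge names, which the algorithm never sees, are recovered and parallel edges kept
  apart.\<close>

definition represents :: "'v set \<Rightarrow> 'e list \<Rightarrow> ('v, 'e) pre_digraph \<Rightarrow> ('v \<times> 'v) list \<Rightarrow> bool" where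
  "represents V es D as \<longleftrightarrow> verts D = V \<and> arcs D = set es \<and> distinct es \<and> length as = length es \<and>
     (\<forall>i<length es. as ! i = (tail D (es ! i), head D (es ! i)))"

lemma represents_card:
  assumes "represents V es D as"
  shows "card {a \<in> arcs D. P (tail D a) (head D a)} = length (filter (\<lambda>e. P (fst e) (snd e)) as)"
proof -
  let ?I = "{i. i < length as \<and> P (fst (as ! i)) (snd (as ! i))}"
  have inj: "inj_on ((!) es) ?I"
    using assms by (auto simp: represents_def inj_on_def nth_eq_iff_index_eq)
  have "{a \<in> arcs D. P (tail D a) (head D a)} = (!) es ` ?I"
    using assms by (auto simp: represents_def in_set_conv_nth image_iff)
  then show ?thesis using card_image[OF inj] by (simp add: length_filter_conv_card)
qed

lemma represents_cut_out: "represents V es D as \<Longrightarrow> cut_out D S = dout as S"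
  unfolding cut_out_def dout_def by (rule represents_card)

lemma represents_cut_in: "represents V es D as \<Longrightarrow> cut_in D S = din as S"
  unfolding cut_in_def din_def by (rule represents_card)

lemma edge_connectivity_ge_iff_conn:
  "represents V es D as \<Longrightarrow> enat m \<le> edge_connectivity D \<longleftrightarrow> conn V m as"
  using represents_cut_out[of V es D as] represents_cut_in[of V es D as]
  by (simp add: edge_connectivity_ge_iff directed_edge_connected_def conn_def represents_def)

lemma edge_connectivity_le_iff_conn:
  assumes "represents V es D as"
  shows "edge_connectivity D \<le> enat m \<longleftrightarrow> \<not> conn V (Suc m) as"
  unfolding edge_connectivity_ge_iff_conn[OF assms, symmetric]
  by (metis Suc_ile_eq not_le)

lemma flip1_update: "e \<in> set as \<Longrightarrow> \<exists>i<length as. as ! i = e \<and> flip1 e as = as[i := prod.swap e]"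
proof (induction as)
  case (Cons x as)
  show ?case
  proof (cases "x = e")
    case True
    then show ?thesis by (intro exI[of _ 0]) auto
  next
    case False
    then obtain i where "i < length as" "as ! i = e" "flip1 e as = as[i := prod.swap e]"
      using Cons by auto
    then show ?thesis using False by (intro exI[of _ "Suc i"]) auto
  qed
qed simp

lemma good_flip_flip:
  assumes "good_flip V k as as'" "represents V es D as" "represents V es D' as'"
  shows "flip D D'"
proof -
  obtain e where e: "e \<in> set as" "as' = flip1 e as" using assms(1) by (auto simp: good_flip_def)
  then obtain i where i: "i < length as" "as ! i = e" "as' = as[i := prod.swap e]"
    using flip1_update by metis
  have D: "arcs D = set es" "distinct es" "length as = length es"
    "\<And>j. j < length es \<Longrightarrow> as ! j = (tail D (es ! j), head D (es ! j))"
    using assms(2) by (simp_all add: represents_def)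
  have D': "\<And>j. j < length es \<Longrightarrow> as' ! j = (tail D' (es ! j), head D' (es ! j))"
    using assms(3) by (simp add: represents_def)
  have at_i: "tail D' (es ! i) = head D (es ! i) \<and> head D' (es ! i) = tail D (es ! i)"
    using D'[of i] D(4)[of i] i D(3) by auto
  have other: "tail D' b = tail D b \<and> head D' b = head D b" if b: "b \<in> arcs D - {es ! i}" for b
  proof -
    obtain j where j: "j < length es" "b = es ! j" using b D(1) by (auto simp: in_set_conv_nth)
    then have "j \<noteq> i" using b by auto
    then show ?thesis using D'[OF j(1)] D(4)[OF j(1)] i(3) j(2) by simp
  qed
  have "es ! i \<in> arcs D" using i(1) D by simp
  then show ?thesis
    unfolding flip_def using at_i other assms(2,3) by (auto simp: represents_def intro!: bexI[of _ "es ! i"])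
qed

lemma good_flip_edge_connectivity:
  assumes "good_flip V k as as'" "represents V es D as" "represents V es D' as'"
  shows "edge_connectivity D \<le> edge_connectivity D'"
proof -
  obtain l where "\<not> conn V (Suc l) as" "conn V l as'" using assms(1) by (auto simp: good_flip_def)
  then have "edge_connectivity D \<le> enat l" "enat l \<le> edge_connectivity D'"
    using edge_connectivity_le_iff_conn[OF assms(2)] edge_connectivity_ge_iff_conn[OF assms(3)] by simp_all
  then show ?thesis by (rule order.trans)
qed

text \<open>One flip changes each degree of a set by at most one, so connectivity
  \<open>k + 1\<close> afterwards would force at least \<open>k\<close>, hence \<open>l + 1\<close>,
  before.\<close>

lemma good_flip_not_conn:
  assumes "good_flip V k as as'"
  shows "\<not> conn V (Suc k) as'"
proof
  assume c: "conn V (Suc k) as'"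
  obtain e l where e: "e \<in> set as" "as' = flip1 e as" and l: "l < k" "\<not> conn V (Suc l) as"
    using assms by (auto simp: good_flip_def)
  have "conn V (Suc l) as"
    unfolding conn_def
  proof (intro allI impI)
    fix S assume S: "S \<noteq> {} \<and> S \<subset> V"
    have "Suc k \<le> dout as' S" "Suc k \<le> din as' S" using c S by (simp_all add: conn_def)
    moreover have "dout as' S \<le> dout as S + 1"
      using dout_flip1[OF e(1), of S] e(2) by (cases "snd e \<in> S") auto
    moreover have "din as' S \<le> din as S + 1"
      using din_flip1[OF e(1), of S] e(2) by (cases "fst e \<in> S") auto
    ultimately show "Suc l \<le> dout as S \<and> Suc l \<le> din as S" using l(1) by linarith
  qed
  with l(2) show False by simp
qed

section \<open>From runs on arc lists to sequences of orientations\<close>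

lemma successively_invariant:
  assumes "successively R (x # xs)" "P x" "\<And>a b. R a b \<Longrightarrow> P a \<Longrightarrow> P b" "y \<in> set (x # xs)"
  shows "P y"
  using assms(1,2,4)
proof (induction xs arbitrary: x)
  case (Cons z zs)
  then show ?case using assms(3) by auto
qed simp

lemma good_flips_flips:
  assumes "successively (good_flip V k) (as # ass)" "represents V es D as"
    and "\<And>as'. as' \<in> set ass \<Longrightarrow> represents V es (mk as') as'"
  shows "successively flip (D # map mk ass) \<and> sorted (map edge_connectivity (D # map mk ass))"
  using assms
proof (induction ass arbitrary: as D)
  case (Cons b ass)
  have g: "good_flip V k as b" "successively (good_flip V k) (b # ass)" using Cons.prems(1) by auto
  have b: "represents V es (mk b) b" using Cons.prems(3) by simp
  have IH: "successively flip (mk b # map mk ass)" "sorted (map edge_connectivity (mk b # map mk ass))"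
    using Cons.IH[OF g(2) b] Cons.prems(3) by simp_all
  have "edge_connectivity D \<le> edge_connectivity (mk b)"
    using good_flip_edge_connectivity[OF g(1) Cons.prems(2) b] .
  then have "sorted (map edge_connectivity (D # mk b # map mk ass))"
    using IH(2) by (auto intro: order.trans)
  moreover have "flip D (mk b)" using good_flip_flip[OF g(1) Cons.prems(2) b] .
  ultimately show ?case using IH(1) by simp
qed simp

text \<open>\<open>mk\<close> turns arc lists back into digraphs. As a parameter it lets the same
  argument serve graphs with arbitrary edge names and the digraphs
  \<open>list_digraph n\<close>.\<close>

lemma run_monotone_flips:
  assumes G: "finite_multigraph G" "undirected_edge_connected G (2 * k)" "orientation G D"
    and le: "edge_connectivity D \<le> enat k"
    and vs: "distinct vs" "set vs = vertices G"
    and D: "represents (vertices G) es D as"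
    and mk: "\<And>as'. length as' = length es \<Longrightarrow> represents (vertices G) es (mk as') as'"
  shows "monotone_flips G k D (map mk (run k vs as))"
proof -
  let ?V = "vertices G"
  have es: "arcs D = set es" "edges G = set es" "distinct es" "length as = length es"
    "\<And>i. i < length es \<Longrightarrow> as ! i = (tail D (es ! i), head D (es ! i))"
    using D G(3) by (auto simp: represents_def orientation_def)
  have ends: "\<And>e. e \<in> edges G \<Longrightarrow> {tail D e, head D e} = ends G e"
    "\<And>e. e \<in> edges G \<Longrightarrow> ends G e \<subseteq> ?V" "\<And>e. e \<in> edges G \<Longrightarrow> card (ends G e) = 2"
    using G by (auto simp: orientation_def finite_multigraph_def)
  have arcs: "set as \<subseteq> set vs \<times> set vs"
  proof
    fix x assume "x \<in> set as"
    then obtain i where i: "i < length es" "x = (tail D (es ! i), head D (es ! i))"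
      using es(4,5) by (metis in_set_conv_nth)
    then have "{tail D (es ! i), head D (es ! i)} \<subseteq> ?V" using ends(1,2)[of "es ! i"] es(2) by simp
    then show "x \<in> set vs \<times> set vs" using i vs(2) by simp
  qed
  interpret run_graph vs k as
  proof
    fix S assume S: "S \<noteq> {}" "S \<subset> set vs"
    let ?out = "{a \<in> arcs D. tail D a \<in> S \<and> head D a \<notin> S}" and ?in = "{a \<in> arcs D. tail D a \<notin> S \<and> head D a \<in> S}"
    have "2 * k \<le> card {e \<in> edges G. card (ends G e \<inter> S) = 1}"
      using G(2) S vs(2) by (auto simp: undirected_edge_connected_def)
    also have "\<dots> \<le> card (?out \<union> ?in)"
    proof (rule card_mono)
      show "finite (?out \<union> ?in)" using es(1) by simp
      show "{e \<in> edges G. card (ends G e \<inter> S) = 1} \<subseteq> ?out \<union> ?in"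
      proof
        fix e assume "e \<in> {e \<in> edges G. card (ends G e \<inter> S) = 1}"
        then have e: "e \<in> edges G" "card ({tail D e, head D e} \<inter> S) = 1" using ends(1) by auto
        have "tail D e \<noteq> head D e" using ends(1,3)[OF e(1)] by (metis card_1_singleton_iff insert_absorb2 is_singletonI is_singleton_altdef numeral_eq_one_iff semiring_norm(85))
        then show "e \<in> ?out \<union> ?in" using e es(1,2)
          by (cases "tail D e \<in> S"; cases "head D e \<in> S") auto
      qed
    qed
    also have "\<dots> \<le> cut_out D S + cut_in D S" unfolding cut_out_def cut_in_def by (rule card_Un_le)
    finally show "2 * k \<le> dout as S + din as S"
      using represents_cut_out[OF D] represents_cut_in[OF D] by simp
  qed (use vs arcs in auto)
  note run = run_correct[unfolded vs(2)]
  \<comment> \<open>A flip only swaps the entry at one position, so position \<open>i\<close> always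
    keeps the end points of \<open>es ! i\<close>.\<close>
  let ?P = "\<lambda>as'. length as' = length es \<and> (\<forall>i<length es. {fst (as' ! i), snd (as' ! i)} = ends G (es ! i))"
  have P: "?P as'" if "as' \<in> set (run k vs as)" for as'
  proof (rule successively_invariant[OF run(1), where P = ?P])
    show "?P as" using es ends(1) by simp
    show "?P b" if ab: "good_flip ?V k a b" "?P a" for a b
    proof -
      obtain e where "e \<in> set a" "b = flip1 e a" using ab(1) unfolding good_flip_def by blast
      then obtain i where i: "i < length a" "a ! i = e" "b = a[i := prod.swap e]"
        using flip1_update by metis
      have "{fst (b ! j), snd (b ! j)} = {fst (a ! j), snd (a ! j)}" if "j < length a" for j
        using i that by (cases "j = i") auto
      then show ?thesis using ab(2) i(3) by simp
    qed
  qed (use that in simp)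
  have rep: "represents ?V es (mk as') as'" if "as' \<in> set (run k vs as)" for as'
    using P[OF that] mk by blast
  have "orientation G (mk as')" if "as' \<in> set (run k vs as)" for as'
    unfolding orientation_def
  proof (intro conjI ballI)
    note r = rep[OF that, unfolded represents_def]
    show "verts (mk as') = ?V" "arcs (mk as') = edges G" using r es(2) by simp_all
    fix e assume "e \<in> edges G"
    then obtain i where i: "i < length es" "e = es ! i" using es(2) by (metis in_set_conv_nth)
    then have "as' ! i = (tail (mk as') e, head (mk as') e)" using r by simp
    then show "{tail (mk as') e, head (mk as') e} = ends G e" using P[OF that] i by force
  qed
  moreover have "length (map mk (run k vs as)) \<le> k * card ?V ^ 3"
    using run(3) distinct_card[OF vs(1)] vs(2) by simp
  moreover note good_flips_flips[OF run(1) D rep]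
  moreover have "edge_connectivity (last (D # map mk (run k vs as))) = enat k"
  proof -
    have last: "represents ?V es (last (D # map mk (run k vs as))) (last (as # run k vs as))"
      using D rep by (simp add: last_map)
    \<comment> \<open>If the run is empty, this is the hypothesis on \<open>D\<close>; otherwise the
      last flip started below \<open>k\<close> and could not lead beyond it.\<close>
    have "\<not> conn ?V (Suc k) (last (as # run k vs as))"
    proof (cases "run k vs as" rule: rev_cases)
      case Nil
      then show ?thesis using le edge_connectivity_le_iff_conn[OF D] by simp
    next
      case (snoc ass b)
      then have "successively (good_flip ?V k) ((as # ass) @ [b])" using run(1) by simp
      then have "good_flip ?V k (last (as # ass)) b" unfolding successively_append_iff by simp
      then show ?thesis using good_flip_not_conn snoc by simp
    qed
    then have "edge_connectivity (last (D # map mk (run k vs as))) \<le> enat k"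
      using edge_connectivity_le_iff_conn[OF last] by simp
    moreover have "enat k \<le> edge_connectivity (last (D # map mk (run k vs as)))"
      using edge_connectivity_ge_iff_conn[OF last] run(2) by simp
    ultimately show ?thesis by (rule antisym)
  qed
  ultimately show ?thesis unfolding monotone_flips_def by auto
qed

lemma ex_monotone_flips:
  fixes G :: "('v, 'e) multigraph"
  assumes G: "finite_multigraph G" "undirected_edge_connected G (2 * k)" "orientation G D"
    and le: "edge_connectivity D \<le> enat k"
  shows "\<exists>Ds. monotone_flips G k D Ds"
proof -
  have fin: "finite (vertices G)" "finite (edges G)" using G(1) by (auto simp: finite_multigraph_def)
  obtain vs where vs: "set vs = vertices G" "distinct vs" using finite_distinct_list[OF fin(1)] by blast
  obtain es where es: "set es = edges G" "distinct es" using finite_distinct_list[OF fin(2)] by blast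
  define idx where "idx = inv_into {..<length es} ((!) es)"
  have idx: "idx (es ! i) = i" if "i < length es" for i
    unfolding idx_def using that es(2) by (intro inv_into_f_f inj_on_nth) auto
  define mk :: "('v \<times> 'v) list \<Rightarrow> ('v, 'e) pre_digraph" where
    "mk as = \<lparr>verts = vertices G, arcs = edges G, tail = (\<lambda>e. fst (as ! idx e)), head = (\<lambda>e. snd (as ! idx e))\<rparr>" for as
  have mk: "represents (vertices G) es (mk as) as" if "length as = length es" for as
    using that es idx by (simp add: represents_def mk_def)
  have "represents (vertices G) es D (map (\<lambda>e. (tail D e, head D e)) es)"
    using G(3) es by (simp add: represents_def orientation_def)
  from run_monotone_flips[OF G le vs(2,1) this mk] show ?thesis by blast
qed

lemma arcs_tree_enc: "arcs_tree as = enc as"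
  by (induction as) (auto simp: arcs_tree_def enc_nat_def)

lemma input_tree_enc: "input_tree k n as = enc (k, n, as)"
  by (simp add: input_tree_def arcs_tree_enc enc_nat_def)

lemma output_tree_enc: "output_tree ass = enc ass"
  by (induction ass) (simp_all add: output_tree_def arcs_tree_enc)

text \<open>A number \<open>m\<close> has code size \<open>1 + 2 * m\<close>, so an arc between
  vertices below \<open>n\<close> costs at most \<open>3 + 4 * n\<close>. Two pairs, two numbers and
  the arc list add up to \<open>5 + 8 * N + 4 * N * N\<close>.\<close>

lemma input_size:
  assumes "k \<le> N" "n \<le> N" "length as \<le> N" "set as \<subseteq> {..<n} \<times> {..<n}"
  shows "sz (k, n, as) \<le> poly [:5, 8, 4:] N"
proof -
  have "sz as \<le> 1 + length as * (1 + (3 + 4 * n))"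
  proof (rule sz_list_le)
    fix e assume "e \<in> set as"
    then have "fst e < n" "snd e < n" using assms(4) by auto
    then show "sz e \<le> 3 + 4 * n" by (simp add: sz_pair[of e] sz_nat)
  qed
  also have "\<dots> \<le> 1 + N * (4 + 4 * N)"
    using assms(2,3) by (intro add_left_mono mult_mono) auto
  finally show ?thesis using assms(1,2) by (simp add: sz_nat algebra_simps)
qed

lemma list_digraph_arcs:
  assumes "finite_multigraph G" "orientation G (list_digraph n as)"
  shows "set as \<subseteq> {..<n} \<times> {..<n}"
proof
  fix x assume "x \<in> set as"
  then obtain i where i: "i < length as" "x = as ! i" by (metis in_set_conv_nth)
  then have "{fst x, snd x} = ends G i" "ends G i \<subseteq> {..<n}"
    using assms by (auto simp: orientation_def list_digraph_def finite_multigraph_def)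
  then show "x \<in> {..<n} \<times> {..<n}" by (simp add: mem_Times_iff) blast
qed

theorem theorem1:
  shows
    "(\<forall>(k::nat) (G::('v, 'e) multigraph) D.
        finite_multigraph G \<and> undirected_edge_connected G (2 * k) \<and> orientation G D \<and>
        edge_connectivity D \<le> enat k \<longrightarrow>
        (\<exists>Ds. monotone_flips G k D Ds)) \<and>
     (\<exists>(c::cmd) (p::nat poly).
        \<forall>(k::nat) (G::(nat, nat) multigraph) n as.
          finite_multigraph G \<and> undirected_edge_connected G (2 * k) \<and>
          orientation G (list_digraph n as) \<and>
          edge_connectivity (list_digraph n as) \<le> enat k \<longrightarrow>
          (\<exists>ass. monotone_flips G k (list_digraph n as) (map (list_digraph n) ass) \<and>
             computes_within c (input_tree k n as) (output_tree ass)
               (poly p (card (vertices G) + card (edges G)))))"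
proof (intro conjI)
  show "\<forall>(k::nat) (G::('v, 'e) multigraph) D.
        finite_multigraph G \<and> undirected_edge_connected G (2 * k) \<and> orientation G D \<and>
        edge_connectivity D \<le> enat k \<longrightarrow> (\<exists>Ds. monotone_flips G k D Ds)"
    using ex_monotone_flips by blast
next
  obtain h c where h: "pbound UNIV h"
    "\<And>m z. works m (c m) (enc z) (enc (run (fst z) [0..<fst (snd z)] (snd (snd z)))) (h z)"
    using ptime_run by (rule ptimeE) blast
  obtain q where q: "\<And>z. h z \<le> poly q (sz z)" using h(1) unfolding pbound_def by blast
  have main: "\<exists>ass. monotone_flips G k (list_digraph n as) (map (list_digraph n) ass) \<and>
      computes_within (c 0) (input_tree k n as) (output_tree ass)
        (poly (pcompose q [:5, 8, 4:]) (card (vertices G) + card (edges G)))"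
    if G: "finite_multigraph G" "undirected_edge_connected G (2 * k)" "orientation G (list_digraph n as)"
      and le: "edge_connectivity (list_digraph n as) \<le> enat k"
    for k n as and G :: "(nat, nat) multigraph"
  proof (intro exI conjI)
    have V: "vertices G = {..<n}" "edges G = {..<length as}"
      using G(3) by (simp_all add: orientation_def list_digraph_def)
    have rep: "represents (vertices G) [0..<length as] (list_digraph n as') as'"
      if "length as' = length [0..<length as]" for as'
      using that V(1) by (simp add: represents_def list_digraph_def lessThan_atLeast0)
    show "monotone_flips G k (list_digraph n as) (map (list_digraph n) (run k [0..<n] as))"
    proof (rule run_monotone_flips[OF G le])
      show "set [0..<n] = vertices G" using V(1) by (simp add: lessThan_atLeast0)
      show "represents (vertices G) [0..<length as] (list_digraph n as) as" by (rule rep) simp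
    qed (use rep in auto)
    let ?N = "card (vertices G) + card (edges G)"
    \<comment> \<open>Finite connectivity provides a proper nonempty vertex set, so there are at
      least \<open>2 * k\<close> edges and the unary code of \<open>k\<close> is small
      enough.\<close>
    have "\<not> directed_edge_connected (list_digraph n as) (Suc k)"
      using le unfolding edge_connectivity_ge_iff[symmetric] by (metis Suc_ile_eq not_le)
    then obtain S where "S \<noteq> {}" "S \<subset> vertices G"
      using V(1) by (auto simp: directed_edge_connected_def list_digraph_def)
    then have "2 * k \<le> card {e \<in> edges G. card (ends G e \<inter> S) = 1}"
      using G(2) by (simp add: undirected_edge_connected_def)
    also have "\<dots> \<le> card (edges G)" using V(2) by (intro card_mono) auto
    finally have "k \<le> ?N" by simp
    moreover have "n \<le> ?N" "length as \<le> ?N" using V by simp_all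
    ultimately have "sz (k, n, as) \<le> poly [:5, 8, 4:] ?N"
      using list_digraph_arcs[OF G(1,3)] by (rule input_size)
    \<comment> \<open>\<open>q\<close> bounds the time in the size of the code, and the inner
      polynomial bounds that size in the number of vertices and edges.\<close>
    then have "h (k, n, as) \<le> poly (pcompose q [:5, 8, 4:]) ?N"
      unfolding poly_pcompose using q poly_nat_mono order.trans by blast
    then have "works 0 (c 0) (enc (k, n, as)) (enc (run k [0..<n] as)) (poly (pcompose q [:5, 8, 4:]) ?N)"
      using works_mono[OF h(2)[of 0 "(k, n, as)"]] by simp
    from worksD[OF this, of "(\<lambda>_. Tip)(0 := enc (k, n, as))"]
    show "computes_within (c 0) (input_tree k n as) (output_tree (run k [0..<n] as)) (poly (pcompose q [:5, 8, 4:]) ?N)"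
      unfolding computes_within_def input_tree_enc output_tree_enc by (metis fun_upd_same)
  qed
  then show "\<exists>(c::cmd) (p::nat poly).
        \<forall>(k::nat) (G::(nat, nat) multigraph) n as.
          finite_multigraph G \<and> undirected_edge_connected G (2 * k) \<and>
          orientation G (list_digraph n as) \<and>
          edge_connectivity (list_digraph n as) \<le> enat k \<longrightarrow>
          (\<exists>ass. monotone_flips G k (list_digraph n as) (map (list_digraph n) ass) \<and>
             computes_within c (input_tree k n as) (output_tree ass)
               (poly p (card (vertices G) + card (edges G))))"
    by blast
qed

end
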